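(* Let $\gamma\in[0,1]$ and $\eta\in[1,1+\gamma]$. In the 2-LFLP, the approximation ratio of the 2-Chance Greedy Algorithm with discount factor $\gamma$ and opening cost scalar $\eta$ is at most $$\Gamma_{\mathrm{SFR}}(\gamma,\eta):=\inf_{n\in\mathbb{N}}\mathrm{Obj}\big(\mathcal{P}_{\mathrm{SFR}}(n,\gamma,\eta)\big).$$
   Context: The 2-LFLP: an instance consists of locations $[n]=\{1,\dots,n\}$ with a metric $d$, facility opening costs $f_i\ge0$, and for every edge $e=(e_H,e_W)\in E:=[n]^2$ a number $\tau_e\ge0$ of individuals living at $e_H$ and working at $e_W$. Put $d(e,i)=\min\{d(e_H,i),d(e_W,i)\}$ and $\mathrm{Cost}(\mathrm{SOL})=\sum_{i\in\mathrm{SOL}}f_i+\sum_{e\in E}\tau_e\min_{i\in\mathrm{SOL}}d(e,i)$ for $\mathrm{SOL}\subseteq[n]$; $\mathrm{OPT}$ is a cost minimizer. An algorithm has approximation ratio at most $\Gamma$ if on every instance its output has cost at most $\Gamma\cdot\mathrm{Cost}(\mathrm{OPT})$. 2-Chance Greedy Algorithm (parameters $\gamma\in[0,1]$, $\eta>0$; $x^+=\max\{x,0\}$): it maintains $\mathrm{SOL}$ (initially $\emptyset$), values $\alpha(e)$ (initially $0$), a set $U\subseteq E$ of unconnected edges (initially $E$), and $\psi(e,L)\in[n]\cup\{\bot\}$ for $e\in E$, $L\in\{H,W\}$ (initially $\bot$). Time runs continuously and $\alpha(e)$ increases at unit rate for each $e\in U$ (it is frozen once $e\notin U$). Events are processed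 as soon as they occur: (a) if $e\in U$ and $i\in\mathrm{SOL}$ satisfy $\alpha(e)=d(e,i)$, remove $e$ from $U$ and set $\psi(e,L)=i$ for each $L$ with $\alpha(e)=d(e_L,i)$; (b) if $i\notin\mathrm{SOL}$ satisfies $\sum_{e\in U}\tau_e(\alpha(e)-d(e,i))^++\sum_{e\notin U}\sum_{L\in\{H,W\}:\psi(e,L)=\bot}\tau_e(\gamma\alpha(e)-d(e_L,i))^+=\eta f_i$, add $i$ to $\mathrm{SOL}$, set $\psi(e,L)=i$ for every $e\notin U$ and $L$ with $\psi(e,L)=\bot$ and $\gamma\alpha(e)\ge d(e_L,i)$, and then for every $e\in U$ with $\alpha(e)\ge d(e,i)$ remove $e$ from $U$ and set $\psi(e,L)=i$ for each $L$ with $\alpha(e)\ge d(e_L,i)$. It stops when $U=\emptyset$ and outputs $\mathrm{SOL}$. For $n\in\mathbb{N}$, $\gamma\in[0,1]$, $\eta\in[1,1+\gamma]$, $\mathcal{P}_{\mathrm{SFR}}(n,\gamma,\eta)$ is the maximization problem over $f\ge0$ and $q(a,b),\alpha(a,b),\delta(a,b),\beta(a,b)\ge0$ for $a\in[n]$, $b\in[a]$, of $\sum_{a\in[n],b\in[a]}q(a,b)\big(\frac{1+\gamma}{\eta}\alpha(a,b)-(\frac{1+\gamma}{\eta}-1)\beta(a,b)\big)$ subject to (with $[x:y]=\{x,\dots,y\}$): (i) $\alpha(a,b)\le\alpha(a',b')$ for all $a,a'\in[n]$, $b\in[a]$, $b'\in[a']$ with $b<b'$; (ii) $\gamma\alpha(a',b')\le\beta(a,b)+\delta(a,b)+\delta(a',b')$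 for all $a<a'$ in $[n]$, $b\in[a]$, $b'\in[a']$; (iii) for each $a\in[n-1]$: $\sum_{a'\in[a+1:n]}\sum_{b'\in[a]}q(a',b')(\gamma\alpha(a',b')-\delta(a',b'))^++\sum_{a'\in[a+1:n]}\sum_{b'\in[a+1:a']}q(a',b')(\gamma\alpha(a,a)-\delta(a',b'))^+\le\eta f$; (iv) $\delta(a,b)\le\alpha(a,b)$; (v) $\beta(a,b)\le\alpha(a,b)$; (vi) $f+\sum_{a\in[n],b\in[a]}q(a,b)\delta(a,b)\le1$; (vii) $\sum_{a\in[b:n]}q(a,b)=1$ for each $b\in[n]$. $\mathrm{Obj}(\mathcal{P})$ denotes the optimal (supremum) objective value of a program $\mathcal{P}$. *)

theory Defs
  imports "HOL-Analysis.Analysis"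
begin

section \<open>The 2-location facility location problem\<close>

datatype side = Home | Work

type_synonym edge = "nat \<times> nat"

fun endpoint :: "edge \<Rightarrow> side \<Rightarrow> nat" where
  "endpoint e Home = fst e"
| "endpoint e Work = snd e"

record lflp =
  num :: nat
  metric :: "nat \<Rightarrow> nat \<Rightarrow> real"
  open_cost :: "nat \<Rightarrow> real"
  people :: "edge \<Rightarrow> real"

definition locs :: "lflp \<Rightarrow> nat set" where
  "locs I = {1..num I}"

definition edges :: "lflp \<Rightarrow> edge set" where
  "edges I = locs I \<times> locs I"

definition lflp_instance :: "lflp \<Rightarrow> bool" where
  "lflp_instance I \<longleftrightarrow> 1 \<le> num I \<and> Metric_space (locs I) (metric I) \<and>
     (\<forall>i\<in>locs I. 0 \<le> open_cost I i) \<and> (\<forall>e\<in>edges I. 0 \<le> people I e)"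

definition end_dist :: "lflp \<Rightarrow> edge \<Rightarrow> side \<Rightarrow> nat \<Rightarrow> real" where
  "end_dist I e L i = metric I (endpoint e L) i"

definition edge_dist :: "lflp \<Rightarrow> edge \<Rightarrow> nat \<Rightarrow> real" where
  "edge_dist I e i = min (end_dist I e Home i) (end_dist I e Work i)"

text \<open>Meaningful for nonempty \<open>S\<close> only: the minimum over the empty set is unspecified, so
  \<open>opt_cost\<close> below ranges over nonempty solutions.\<close>

definition cost :: "lflp \<Rightarrow> nat set \<Rightarrow> real" where
  "cost I S = (\<Sum>i\<in>S. open_cost I i) + (\<Sum>e\<in>edges I. people I e * (MIN i\<in>S. edge_dist I e i))"

definition opt_cost :: "lflp \<Rightarrow> real" where
  "opt_cost I = Min (cost I ` {S. S \<subseteq> locs I \<and> S \<noteq> {}})"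

text \<open>
  An algorithm is given as the relation between instances and possible outputs; the bound is
  required of every possible output, that is, for every way of breaking ties. The ratio is an
  extended real because the optimal value of a maximization program may be infinite. As
  \<open>\<infinity> * 0 = 0\<close> in \<^typ>\<open>ereal\<close>, an infinite ratio still demands cost 0 where the optimum is 0.
\<close>

definition approx_ratio_at_most :: "(lflp \<Rightarrow> nat set \<Rightarrow> bool) \<Rightarrow> ereal \<Rightarrow> bool" where
  "approx_ratio_at_most alg \<Gamma> \<longleftrightarrow>
     (\<forall>I S. lflp_instance I \<longrightarrow> alg I S \<longrightarrow> ereal (cost I S) \<le> \<Gamma> * ereal (opt_cost I))"


section \<open>The 2-Chance Greedy Algorithm\<close>

record state =
  sol :: "nat set"
  alpha :: "edge \<Rightarrow> real"
  unconn :: "edge set"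
  psi :: "edge \<Rightarrow> side \<Rightarrow> nat option"

definition init_state :: "lflp \<Rightarrow> state" where
  "init_state I = \<lparr>sol = {}, alpha = (\<lambda>_. 0), unconn = edges I, psi = (\<lambda>_ _. None)\<rparr>"

definition offer :: "real \<Rightarrow> lflp \<Rightarrow> state \<Rightarrow> nat \<Rightarrow> real" where
  "offer \<gamma> I s i =
     (\<Sum>e\<in>unconn s. people I e * max (alpha s e - edge_dist I e i) 0) +
     (\<Sum>e\<in>edges I - unconn s. \<Sum>L | psi s e L = None.
        people I e * max (\<gamma> * alpha s e - end_dist I e L i) 0)"

definition connect :: "lflp \<Rightarrow> edge \<Rightarrow> nat \<Rightarrow> state \<Rightarrow> state" where
  "connect I e i s = s\<lparr>unconn := unconn s - {e},
     psi := (psi s)(e := (\<lambda>L. if alpha s e = end_dist I e L i then Some i else psi s e L))\<rparr>"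

text \<open>Both connection rounds triggered by an opening refer to the set of unconnected edges
  before the opening, so they act on disjoint sets of edges and can be written as one update.\<close>

definition open_facility :: "real \<Rightarrow> lflp \<Rightarrow> nat \<Rightarrow> state \<Rightarrow> state" where
  "open_facility \<gamma> I i s = s\<lparr>sol := insert i (sol s),
     unconn := {e \<in> unconn s. \<not> edge_dist I e i \<le> alpha s e},
     psi := (\<lambda>e L.
       if e \<in> edges I - unconn s \<and> psi s e L = None \<and> end_dist I e L i \<le> \<gamma> * alpha s e
          \<or> e \<in> unconn s \<and> edge_dist I e i \<le> alpha s e \<and> end_dist I e L i \<le> alpha s e
       then Some i else psi s e L)\<rparr>"

inductive event :: "real \<Rightarrow> real \<Rightarrow> lflp \<Rightarrow> state \<Rightarrow> state \<Rightarrow> bool" for \<gamma> \<eta> I where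
  event_connect: "\<lbrakk>e \<in> unconn s; i \<in> sol s; alpha s e = edge_dist I e i\<rbrakk>
    \<Longrightarrow> event \<gamma> \<eta> I s (connect I e i s)"
| event_open: "\<lbrakk>i \<in> locs I; i \<notin> sol s; offer \<gamma> I s i = \<eta> * open_cost I i\<rbrakk>
    \<Longrightarrow> event \<gamma> \<eta> I s (open_facility \<gamma> I i s)"

definition wait :: "real \<Rightarrow> state \<Rightarrow> state" where
  "wait r s = s\<lparr>alpha := (\<lambda>e. if e \<in> unconn s then alpha s e + r else alpha s e)\<rparr>"

text \<open>
  Time may pass only as long as no event is pending, so events are processed as soon as they
  occur; simultaneous events are processed in an arbitrary order. Nothing happens any more once
  all edges are connected.
\<close>

inductive greedy_step :: "real \<Rightarrow> real \<Rightarrow> lflp \<Rightarrow> state \<Rightarrow> state \<Rightarrow> bool" for \<gamma> \<eta> I where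
  step_event: "\<lbrakk>unconn s \<noteq> {}; event \<gamma> \<eta> I s s'\<rbrakk> \<Longrightarrow> greedy_step \<gamma> \<eta> I s s'"
| step_wait: "\<lbrakk>unconn s \<noteq> {}; 0 < t; \<And>r s'. 0 \<le> r \<Longrightarrow> r < t \<Longrightarrow> \<not> event \<gamma> \<eta> I (wait r s) s'\<rbrakk>
    \<Longrightarrow> greedy_step \<gamma> \<eta> I s (wait t s)"

definition two_chance_greedy :: "real \<Rightarrow> real \<Rightarrow> lflp \<Rightarrow> nat set \<Rightarrow> bool" where
  "two_chance_greedy \<gamma> \<eta> I S \<longleftrightarrow>
     (\<exists>s. (greedy_step \<gamma> \<eta> I)\<^sup>*\<^sup>* (init_state I) s \<and> unconn s = {} \<and> sol s = S)"


section \<open>The strongly factor-revealing program\<close>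

text \<open>As a function of the pair of indices, only the values at \<open>(a, b)\<close> with
  \<open>1 \<le> b \<le> a \<le> n\<close> matter.\<close>

definition sfr_feasible ::
  "nat \<Rightarrow> real \<Rightarrow> real \<Rightarrow> real \<Rightarrow> (nat \<Rightarrow> nat \<Rightarrow> real) \<Rightarrow> (nat \<Rightarrow> nat \<Rightarrow> real) \<Rightarrow>
   (nat \<Rightarrow> nat \<Rightarrow> real) \<Rightarrow> (nat \<Rightarrow> nat \<Rightarrow> real) \<Rightarrow> bool" where
  "sfr_feasible n \<gamma> \<eta> f q \<alpha> \<delta> \<beta> \<longleftrightarrow>
     0 \<le> f \<and>
     (\<forall>a\<in>{1..n}. \<forall>b\<in>{1..a}. 0 \<le> q a b \<and> 0 \<le> \<alpha> a b \<and> 0 \<le> \<delta> a b \<and> 0 \<le> \<beta> a b) \<and>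
     (\<forall>a\<in>{1..n}. \<forall>a'\<in>{1..n}. \<forall>b\<in>{1..a}. \<forall>b'\<in>{1..a'}. b < b' \<longrightarrow> \<alpha> a b \<le> \<alpha> a' b') \<and>
     (\<forall>a\<in>{1..n}. \<forall>a'\<in>{1..n}. \<forall>b\<in>{1..a}. \<forall>b'\<in>{1..a'}. a < a' \<longrightarrow>
        \<gamma> * \<alpha> a' b' \<le> \<beta> a b + \<delta> a b + \<delta> a' b') \<and>
     (\<forall>a\<in>{1..<n}.
        (\<Sum>a'=a+1..n. \<Sum>b'=1..a. q a' b' * max (\<gamma> * \<alpha> a' b' - \<delta> a' b') 0) +
        (\<Sum>a'=a+1..n. \<Sum>b'=a+1..a'. q a' b' * max (\<gamma> * \<alpha> a a - \<delta> a' b') 0) \<le> \<eta> * f) \<and>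
     (\<forall>a\<in>{1..n}. \<forall>b\<in>{1..a}. \<delta> a b \<le> \<alpha> a b) \<and>
     (\<forall>a\<in>{1..n}. \<forall>b\<in>{1..a}. \<beta> a b \<le> \<alpha> a b) \<and>
     f + (\<Sum>a=1..n. \<Sum>b=1..a. q a b * \<delta> a b) \<le> 1 \<and>
     (\<forall>b\<in>{1..n}. (\<Sum>a=b..n. q a b) = 1)"

definition sfr_objective ::
  "nat \<Rightarrow> real \<Rightarrow> real \<Rightarrow> (nat \<Rightarrow> nat \<Rightarrow> real) \<Rightarrow> (nat \<Rightarrow> nat \<Rightarrow> real) \<Rightarrow> (nat \<Rightarrow> nat \<Rightarrow> real) \<Rightarrow> real"
where
  "sfr_objective n \<gamma> \<eta> q \<alpha> \<beta> =
     (\<Sum>a=1..n. \<Sum>b=1..a. q a b * ((1 + \<gamma>) / \<eta> * \<alpha> a b - ((1 + \<gamma>) / \<eta> - 1) * \<beta> a b))"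

definition Obj_SFR :: "nat \<Rightarrow> real \<Rightarrow> real \<Rightarrow> ereal" where
  "Obj_SFR n \<gamma> \<eta> =
     Sup {ereal (sfr_objective n \<gamma> \<eta> q \<alpha> \<beta>) | f q \<alpha> \<delta> \<beta>. sfr_feasible n \<gamma> \<eta> f q \<alpha> \<delta> \<beta>}"

text \<open>The program with \<open>n = 0\<close> is excluded: its objective is the empty sum, so its value
  would be 0.\<close>

definition Gamma_SFR :: "real \<Rightarrow> real \<Rightarrow> ereal" where
  "Gamma_SFR \<gamma> \<eta> = (INF n\<in>{1..}. Obj_SFR n \<gamma> \<eta>)"


section \<open>The algorithm produces an output\<close>

lemma UNIV_side: "(UNIV :: side set) = {Home, Work}"
proof (intro set_eqI iffI)
  fix x :: side show "x \<in> {Home, Work}" by (cases x) auto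
qed simp

lemma finite_side [simp]: "finite (A :: side set)"
  by (rule finite_subset[OF subset_UNIV]) (simp add: UNIV_side)

lemma finite_edges [simp]: "finite (edges I)"
  by (simp add: edges_def locs_def)

definition greedy_inv :: "real \<Rightarrow> real \<Rightarrow> lflp \<Rightarrow> state \<Rightarrow> bool" where
  "greedy_inv \<gamma> \<eta> I s \<longleftrightarrow>
     sol s \<subseteq> locs I \<and> unconn s \<subseteq> edges I \<and> (\<forall>e. 0 \<le> alpha s e) \<and>
     (sol s = {} \<longrightarrow> unconn s = edges I) \<and>
     (\<forall>e\<in>unconn s. \<forall>i\<in>sol s. alpha s e \<le> edge_dist I e i) \<and>
     (\<forall>i\<in>locs I - sol s. offer \<gamma> I s i \<le> \<eta> * open_cost I i)"

lemma edge_dist_le: "edge_dist I e i \<le> end_dist I e L i"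
  by (cases L) (auto simp: edge_dist_def)

lemma edge_dist_attained: "\<exists>L. end_dist I e L i = edge_dist I e i"
  unfolding edge_dist_def by (cases "end_dist I e Home i \<le> end_dist I e Work i") (auto simp: min_def)

lemma edge_dist_nonneg:
  assumes "lflp_instance I" shows "0 \<le> edge_dist I e i"
  using assms Metric_space.nonneg[of "locs I" "metric I"]
  unfolding lflp_instance_def edge_dist_def end_dist_def by simp

lemma init_inv:
  assumes I: "lflp_instance I" and "0 \<le> \<eta>"
  shows "greedy_inv \<gamma> \<eta> I (init_state I)"
proof -
  have "offer \<gamma> I (init_state I) i \<le> \<eta> * open_cost I i" if "i \<in> locs I" for i
  proof -
    have "offer \<gamma> I (init_state I) i = 0"
      using edge_dist_nonneg[OF I] by (simp add: offer_def init_state_def)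
    then show ?thesis using that I \<open>0 \<le> \<eta>\<close> by (simp add: lflp_instance_def)
  qed
  then show ?thesis by (auto simp: greedy_inv_def init_state_def)
qed

definition single :: "real \<Rightarrow> lflp \<Rightarrow> state \<Rightarrow> nat \<Rightarrow> edge \<Rightarrow> real" where
  "single \<gamma> I s i e = (if e \<in> unconn s then people I e * max (alpha s e - edge_dist I e i) 0
     else \<Sum>L | psi s e L = None. people I e * max (\<gamma> * alpha s e - end_dist I e L i) 0)"

lemma offer_single:
  assumes "unconn s \<subseteq> edges I"
  shows "offer \<gamma> I s i = (\<Sum>e\<in>edges I. single \<gamma> I s i e)"
proof -
  have "(\<Sum>e\<in>edges I. single \<gamma> I s i e) =
     (\<Sum>e\<in>edges I - unconn s. single \<gamma> I s i e) + (\<Sum>e\<in>unconn s. single \<gamma> I s i e)"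
    by (rule sum.subset_diff) (use assms in auto)
  also have "\<dots> = offer \<gamma> I s i"
    unfolding offer_def by (simp add: single_def add.commute)
  finally show ?thesis by simp
qed

lemma single_drop:
  assumes "0 \<le> people I e" "0 \<le> alpha s e" "\<gamma> \<in> {0..1}"
    and "alpha s' e = alpha s e"
    and "e \<in> unconn s' \<Longrightarrow> e \<in> unconn s"
    and "e \<notin> unconn s \<Longrightarrow> {L. psi s' e L = None} \<subseteq> {L. psi s e L = None}"
    and "\<lbrakk>e \<in> unconn s; e \<notin> unconn s'\<rbrakk> \<Longrightarrow> \<exists>L. psi s' e L \<noteq> None"
  shows "single \<gamma> I s' i e \<le> single \<gamma> I s i e"
proof -
  consider (a) "e \<in> unconn s'" | (b) "e \<notin> unconn s" | (c) "e \<in> unconn s" "e \<notin> unconn s'"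
    by blast
  then show ?thesis
  proof cases
    case a then show ?thesis using assms by (simp add: single_def)
  next
    case b
    then have "e \<notin> unconn s'" using assms by blast
    with b show ?thesis using assms
      by (auto simp: single_def intro!: sum_mono2)
  next
    case c
    then obtain L where L: "psi s' e L \<noteq> None" using assms by blast
    obtain L' where L': "\<And>x. x = L \<or> x = L'" by (metis side.exhaust)
    have "single \<gamma> I s' i e = (\<Sum>L | psi s' e L = None. people I e * max (\<gamma> * alpha s e - end_dist I e L i) 0)"
      using c assms by (simp add: single_def)
    also have "\<dots> \<le> (\<Sum>L\<in>{L'}. people I e * max (\<gamma> * alpha s e - end_dist I e L i) 0)"
    proof (rule sum_mono2)
      show "{L. psi s' e L = None} \<subseteq> {L'}"
      proof
        fix x assume "x \<in> {L. psi s' e L = None}"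
        then have "x \<noteq> L" using L by auto
        then show "x \<in> {L'}" using L'[of x] by blast
      qed
    qed (use assms in auto)
    also have "\<dots> \<le> people I e * max (alpha s e - edge_dist I e i) 0"
    proof -
      have "\<gamma> * alpha s e \<le> alpha s e" using assms by (simp add: mult_left_le_one_le)
      then have "max (\<gamma> * alpha s e - end_dist I e L' i) 0 \<le> max (alpha s e - edge_dist I e i) 0"
        using edge_dist_le[of I e i L'] by linarith
      then show ?thesis using assms by (simp add: mult_left_mono)
    qed
    also have "\<dots> = single \<gamma> I s i e" using c by (simp add: single_def)
    finally show ?thesis .
  qed
qed

lemma event_inv:
  assumes I: "lflp_instance I" and g: "\<gamma> \<in> {0..1}"
    and inv: "greedy_inv \<gamma> \<eta> I s" and ev: "event \<gamma> \<eta> I s s'"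
  shows "greedy_inv \<gamma> \<eta> I s'"
    and "card (unconn s') + card (locs I - sol s') < card (unconn s) + card (locs I - sol s)"
proof -
  have fin: "finite (unconn s)" using inv finite_edges finite_subset
    unfolding greedy_inv_def by blast
  have finl: "finite (locs I - sol s)" by (simp add: locs_def)
  have pe: "\<And>e. e \<in> edges I \<Longrightarrow> 0 \<le> people I e" using I by (simp add: lflp_instance_def)
  have "greedy_inv \<gamma> \<eta> I s' \<and>
    card (unconn s') + card (locs I - sol s') < card (unconn s) + card (locs I - sol s)"
    using ev
  proof cases
    case (event_connect e i)
    have off: "offer \<gamma> I s' j \<le> offer \<gamma> I s j" for j
    proof -
      have "(\<Sum>e\<in>edges I. single \<gamma> I s' j e) \<le> (\<Sum>e\<in>edges I. single \<gamma> I s j e)"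
      proof (rule sum_mono)
        fix e' assume e': "e' \<in> edges I"
        show "single \<gamma> I s' j e' \<le> single \<gamma> I s j e'"
        proof (rule single_drop)
          assume "e' \<in> unconn s" "e' \<notin> unconn s'"
          then have "e' = e" using event_connect by (simp add: connect_def)
          moreover obtain L where "end_dist I e L i = edge_dist I e i"
            using edge_dist_attained by blast
          ultimately have "psi s' e' L \<noteq> None" using event_connect by (simp add: connect_def)
          then show "\<exists>L. psi s' e' L \<noteq> None" by blast
        qed (use event_connect pe[OF e'] g inv in \<open>auto simp: connect_def greedy_inv_def simp del: split_paired_All split: if_splits\<close>)
      qed
      then show ?thesis
        using inv event_connect by (subst (1 2) offer_single) (auto simp: greedy_inv_def connect_def)
    qed
    have "greedy_inv \<gamma> \<eta> I s'"
      unfolding greedy_inv_def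
    proof (intro conjI)
      show "\<forall>j\<in>locs I - sol s'. offer \<gamma> I s' j \<le> \<eta> * open_cost I j"
      proof
        fix j assume "j \<in> locs I - sol s'"
        then have "j \<in> locs I - sol s" using event_connect by (auto simp: connect_def)
        then have "offer \<gamma> I s j \<le> \<eta> * open_cost I j" using inv by (simp add: greedy_inv_def)
        then show "offer \<gamma> I s' j \<le> \<eta> * open_cost I j" using off[of j] by linarith
      qed
    qed (use inv event_connect in \<open>auto simp: connect_def greedy_inv_def simp del: split_paired_All\<close>)
    moreover have "card (unconn s') < card (unconn s)"
      using event_connect fin by (intro psubset_card_mono) (auto simp: connect_def)
    ultimately show ?thesis using event_connect by (simp add: connect_def)
  next
    case (event_open i)
    have off: "offer \<gamma> I s' j \<le> offer \<gamma> I s j" for j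
    proof -
      have "(\<Sum>e\<in>edges I. single \<gamma> I s' j e) \<le> (\<Sum>e\<in>edges I. single \<gamma> I s j e)"
      proof (rule sum_mono)
        fix e' assume e': "e' \<in> edges I"
        show "single \<gamma> I s' j e' \<le> single \<gamma> I s j e'"
        proof (rule single_drop)
          assume "e' \<in> unconn s" "e' \<notin> unconn s'"
          then have "e' \<in> unconn s \<and> edge_dist I e' i \<le> alpha s e'"
            using event_open by (simp add: open_facility_def)
          moreover obtain L where "end_dist I e' L i = edge_dist I e' i"
            using edge_dist_attained by blast
          ultimately have "psi s' e' L \<noteq> None"
            using event_open by (simp add: open_facility_def)
          then show "\<exists>L. psi s' e' L \<noteq> None" by blast
        qed (use event_open pe[OF e'] g inv in \<open>auto simp: open_facility_def greedy_inv_def simp del: split_paired_All split: if_splits\<close>)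
      qed
      then show ?thesis
        using inv event_open by (subst (1 2) offer_single) (auto simp: greedy_inv_def open_facility_def)
    qed
    have "greedy_inv \<gamma> \<eta> I s'"
      unfolding greedy_inv_def
    proof (intro conjI)
      show "\<forall>j\<in>locs I - sol s'. offer \<gamma> I s' j \<le> \<eta> * open_cost I j"
      proof
        fix j assume "j \<in> locs I - sol s'"
        then have "j \<in> locs I - sol s" using event_open by (auto simp: open_facility_def)
        then have "offer \<gamma> I s j \<le> \<eta> * open_cost I j" using inv by (simp add: greedy_inv_def)
        then show "offer \<gamma> I s' j \<le> \<eta> * open_cost I j" using off[of j] by linarith
      qed
    qed (use inv event_open in \<open>auto simp: open_facility_def greedy_inv_def simp del: split_paired_All\<close>)
    moreover have "card (locs I - sol s') < card (locs I - sol s)"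
      using event_open finl by (intro psubset_card_mono) (auto simp: open_facility_def)
    moreover have "card (unconn s') \<le> card (unconn s)"
      using event_open fin by (intro card_mono) (auto simp: open_facility_def)
    ultimately show ?thesis by simp
  qed
  then show "greedy_inv \<gamma> \<eta> I s'"
    and "card (unconn s') + card (locs I - sol s') < card (unconn s) + card (locs I - sol s)"
    by auto
qed

lemma wait_simps [simp]:
  "sol (wait r s) = sol s" "unconn (wait r s) = unconn s" "psi (wait r s) = psi s"
  "alpha (wait r s) e = (if e \<in> unconn s then alpha s e + r else alpha s e)"
  by (simp_all add: wait_def)

lemma wait_0 [simp]: "wait 0 s = s"
  by (simp add: wait_def cong: if_cong)

lemma offer_wait:
  "offer \<gamma> I (wait r s) i =
     (\<Sum>e\<in>unconn s. people I e * max (alpha s e + r - edge_dist I e i) 0) +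
     (\<Sum>e\<in>edges I - unconn s. \<Sum>L | psi s e L = None.
        people I e * max (\<gamma> * alpha s e - end_dist I e L i) 0)"
  by (simp add: offer_def)

lemma continuous_offer_wait: "continuous_on A (\<lambda>r. offer \<gamma> I (wait r s) i)"
  unfolding offer_wait by (intro continuous_intros)

lemma offer_reached:
  assumes "0 \<le> t" "offer \<gamma> I s i \<le> c" "c \<le> offer \<gamma> I (wait t s) i"
  obtains r where "0 \<le> r" "r \<le> t" "offer \<gamma> I (wait r s) i = c"
proof -
  have "\<exists>r\<ge>0. r \<le> t \<and> offer \<gamma> I (wait r s) i = c"
    by (rule IVT') (use assms continuous_offer_wait in simp_all)
  then show ?thesis using that by blast
qed

lemma wait_inv:
  assumes inv: "greedy_inv \<gamma> \<eta> I s" and "0 \<le> t"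
    and no: "\<And>r s'. 0 \<le> r \<Longrightarrow> r < t \<Longrightarrow> \<not> event \<gamma> \<eta> I (wait r s) s'"
  shows "greedy_inv \<gamma> \<eta> I (wait t s)"
proof -
  have 1: "alpha s e + t \<le> edge_dist I e i" if "e \<in> unconn s" "i \<in> sol s" for e i
  proof (rule ccontr)
    assume *: "\<not> ?thesis"
    define r where "r = edge_dist I e i - alpha s e"
    have "0 \<le> r" using that inv by (auto simp: r_def greedy_inv_def)
    moreover have "r < t" using * by (simp add: r_def)
    moreover have "event \<gamma> \<eta> I (wait r s) (connect I e i (wait r s))"
      by (rule event_connect) (use that in \<open>auto simp: r_def\<close>)
    ultimately show False using no by blast
  qed
  have 2: "offer \<gamma> I (wait t s) i \<le> \<eta> * open_cost I i" if "i \<in> locs I - sol s" for i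
  proof (rule ccontr)
    assume *: "\<not> ?thesis"
    have "offer \<gamma> I s i \<le> \<eta> * open_cost I i" using inv that by (simp add: greedy_inv_def)
    moreover have "\<eta> * open_cost I i \<le> offer \<gamma> I (wait t s) i" using * by linarith
    ultimately obtain r where r: "0 \<le> r" "r \<le> t" "offer \<gamma> I (wait r s) i = \<eta> * open_cost I i"
      using offer_reached \<open>0 \<le> t\<close> by blast
    have "r \<noteq> t" using r * by auto
    then have "r < t" using r by simp
    moreover have "event \<gamma> \<eta> I (wait r s) (open_facility \<gamma> I i (wait r s))"
      by (rule event_open) (use that r in auto)
    ultimately show False using no r by blast
  qed
  show ?thesis unfolding greedy_inv_def
  proof (intro conjI)
    show "\<forall>i\<in>locs I - sol (wait t s). offer \<gamma> I (wait t s) i \<le> \<eta> * open_cost I i"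
      using 2 by simp
  qed (use inv 1 \<open>0 \<le> t\<close> in \<open>auto simp: greedy_inv_def simp del: split_paired_All\<close>)
qed

lemma reachable_inv:
  assumes I: "lflp_instance I" and g: "\<gamma> \<in> {0..1}" and "0 \<le> \<eta>"
    and "(greedy_step \<gamma> \<eta> I)\<^sup>*\<^sup>* (init_state I) s"
  shows "greedy_inv \<gamma> \<eta> I s"
  using assms(4)
proof induction
  case base then show ?case using init_inv[OF I \<open>0 \<le> \<eta>\<close>] .
next
  case (step s s')
  from step(2) show ?case
  proof cases
    case step_event then show ?thesis using event_inv[OF I g step.IH] by blast
  next
    case (step_wait t) then show ?thesis using wait_inv[OF step.IH, of t] by simp
  qed
qed

lemma event_eventually:
  assumes I: "lflp_instance I" and g: "\<gamma> \<in> {0..1}" and inv: "greedy_inv \<gamma> \<eta> I s"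
    and nondeg: "(\<exists>e\<in>edges I. 0 < people I e) \<or> (\<exists>i\<in>locs I. open_cost I i = 0)"
    and ne: "unconn s \<noteq> {}"
  shows "\<exists>r s'. 0 \<le> r \<and> event \<gamma> \<eta> I (wait r s) s'"
proof (cases "sol s = {}")
  case False
  then obtain e i where ei: "e \<in> unconn s" "i \<in> sol s" using ne by blast
  define r where "r = edge_dist I e i - alpha s e"
  have "0 \<le> r" using ei inv by (auto simp: r_def greedy_inv_def)
  moreover have "event \<gamma> \<eta> I (wait r s) (connect I e i (wait r s))"
    by (rule event_connect) (use ei in \<open>auto simp: r_def\<close>)
  ultimately show ?thesis by blast
next
  case True
  then have U: "unconn s = edges I" using inv by (simp add: greedy_inv_def)
  have pe: "\<And>e. e \<in> edges I \<Longrightarrow> 0 \<le> people I e" using I by (simp add: lflp_instance_def)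
  have "\<exists>i\<in>locs I. \<exists>r\<ge>0. \<eta> * open_cost I i \<le> offer \<gamma> I (wait r s) i"
    using nondeg
  proof
    assume "\<exists>e\<in>edges I. 0 < people I e"
    then obtain e where e: "e \<in> edges I" "0 < people I e" by blast
    have "1 \<in> locs I" using I by (simp add: lflp_instance_def locs_def)
    define r where "r = edge_dist I e 1 + \<bar>\<eta> * open_cost I 1\<bar> / people I e"
    have r: "0 \<le> r" using e edge_dist_nonneg[OF I] by (simp add: r_def)
    have "\<eta> * open_cost I 1 \<le> people I e * (\<bar>\<eta> * open_cost I 1\<bar> / people I e)"
      using e by simp
    also have "\<dots> \<le> people I e * max (alpha s e + r - edge_dist I e 1) 0"
      using e inv by (intro mult_left_mono) (auto simp: r_def greedy_inv_def le_max_iff_disj simp del: split_paired_All)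
    also have "\<dots> \<le> (\<Sum>e\<in>edges I. people I e * max (alpha s e + r - edge_dist I e 1) 0)"
      by (rule member_le_sum) (use e pe in auto)
    also have "\<dots> = offer \<gamma> I (wait r s) 1" by (simp add: offer_wait U)
    finally show ?thesis using r \<open>1 \<in> locs I\<close> by blast
  next
    assume "\<exists>i\<in>locs I. open_cost I i = 0"
    then obtain i where i: "i \<in> locs I" "open_cost I i = 0" by blast
    have "0 \<le> offer \<gamma> I (wait 0 s) i" unfolding offer_wait U using pe
      by (auto intro!: sum_nonneg)
    then show ?thesis using i by force
  qed
  then obtain i r where ir: "i \<in> locs I" "0 \<le> r" "\<eta> * open_cost I i \<le> offer \<gamma> I (wait r s) i"
    by blast
  have "offer \<gamma> I s i \<le> \<eta> * open_cost I i"
    using inv ir True by (simp add: greedy_inv_def)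
  then obtain r' where r': "0 \<le> r'" "offer \<gamma> I (wait r' s) i = \<eta> * open_cost I i"
    using offer_reached ir by metis
  have "event \<gamma> \<eta> I (wait r' s) (open_facility \<gamma> I i (wait r' s))"
    by (rule event_open) (use ir r' True in auto)
  then show ?thesis using r' by blast
qed

lemma next_event:
  assumes I: "lflp_instance I" and g: "\<gamma> \<in> {0..1}" and inv: "greedy_inv \<gamma> \<eta> I s"
    and nondeg: "(\<exists>e\<in>edges I. 0 < people I e) \<or> (\<exists>i\<in>locs I. open_cost I i = 0)"
    and ne: "unconn s \<noteq> {}"
  obtains t s' where "0 \<le> t" "event \<gamma> \<eta> I (wait t s) s'"
    "\<And>r s'. 0 \<le> r \<Longrightarrow> r < t \<Longrightarrow> \<not> event \<gamma> \<eta> I (wait r s) s'"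
proof -
  define R where "R = {r. 0 \<le> r \<and> (\<exists>s'. event \<gamma> \<eta> I (wait r s) s')}"
  have fin: "finite (unconn s)" "finite (sol s)" "finite (locs I)"
    using inv finite_edges finite_subset
    unfolding greedy_inv_def locs_def by blast+
  have "R = {0..} \<inter> ((\<Union>e\<in>unconn s. \<Union>i\<in>sol s. {r. alpha s e + r = edge_dist I e i}) \<union>
     (\<Union>i\<in>locs I - sol s. {r. offer \<gamma> I (wait r s) i = \<eta> * open_cost I i}))" (is "_ = ?R")
  proof (intro set_eqI iffI)
    fix r assume "r \<in> R"
    then obtain s' where "0 \<le> r" and ev: "event \<gamma> \<eta> I (wait r s) s'" by (auto simp: R_def)
    from ev show "r \<in> ?R" using \<open>0 \<le> r\<close> by cases auto
  next
    fix r assume r: "r \<in> ?R"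
    then consider e i where "e \<in> unconn s" "i \<in> sol s" "alpha s e + r = edge_dist I e i"
      | i where "i \<in> locs I" "i \<notin> sol s" "offer \<gamma> I (wait r s) i = \<eta> * open_cost I i"
      by blast
    then have "\<exists>s'. event \<gamma> \<eta> I (wait r s) s'"
    proof cases
      case (1 e i)
      then have "event \<gamma> \<eta> I (wait r s) (connect I e i (wait r s))"
        by (intro event_connect) simp_all
      then show ?thesis by blast
    next
      case (2 i)
      then have "event \<gamma> \<eta> I (wait r s) (open_facility \<gamma> I i (wait r s))"
        by (intro event_open) simp_all
      then show ?thesis by blast
    qed
    then show "r \<in> R" using r by (simp add: R_def)
  qed
  moreover have "closed ?R"
  proof (intro closed_Int closed_Un)
    show "closed (\<Union>e\<in>unconn s. \<Union>i\<in>sol s. {r. alpha s e + r = edge_dist I e i})"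
      using fin by (intro closed_UN ballI closed_Collect_eq continuous_intros)
    show "closed (\<Union>i\<in>locs I - sol s. {r. offer \<gamma> I (wait r s) i = \<eta> * open_cost I i})"
      using fin by (intro closed_UN ballI closed_Collect_eq continuous_offer_wait continuous_on_const finite_Diff)
  qed simp
  ultimately have "closed R" by simp
  moreover have "R \<noteq> {}" using event_eventually[OF I g inv nondeg ne] by (auto simp: R_def)
  moreover have bdd: "bdd_below R" by (rule bdd_belowI[of _ 0]) (auto simp: R_def)
  ultimately have "Inf R \<in> R" by (intro closed_contains_Inf)
  moreover have "r \<notin> R" if "r < Inf R" for r using cInf_lower[OF _ bdd, of r] that by auto
  ultimately show ?thesis using that[of "Inf R"] by (auto simp: R_def)
qed

text \<open>
  No run gets stuck: from every reachable state the algorithm can complete. The exceptional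
  instances, without any individuals and with positive opening costs only, are those on which
  no facility is ever paid for.
\<close>

lemma greedy_completes:
  assumes I: "lflp_instance I" and g: "\<gamma> \<in> {0..1}" and eta: "0 \<le> \<eta>"
    and nondeg: "(\<exists>e\<in>edges I. 0 < people I e) \<or> (\<exists>i\<in>locs I. open_cost I i = 0)"
    and "(greedy_step \<gamma> \<eta> I)\<^sup>*\<^sup>* (init_state I) s"
  shows "\<exists>s'. (greedy_step \<gamma> \<eta> I)\<^sup>*\<^sup>* s s' \<and> unconn s' = {}"
proof -
  have "greedy_inv \<gamma> \<eta> I s" using reachable_inv assms by blast
  then show ?thesis
  proof (induction "card (unconn s) + card (locs I - sol s)" arbitrary: s rule: less_induct)
    case less
    show ?case
    proof (cases "unconn s = {}")
      case False
      obtain t s' where t: "0 \<le> t" and ev: "event \<gamma> \<eta> I (wait t s) s'"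
        and no: "\<And>r s'. 0 \<le> r \<Longrightarrow> r < t \<Longrightarrow> \<not> event \<gamma> \<eta> I (wait r s) s'"
        using next_event[OF I g less.prems nondeg False] by metis
      have invw: "greedy_inv \<gamma> \<eta> I (wait t s)" using wait_inv less.prems t no by blast
      have "(greedy_step \<gamma> \<eta> I)\<^sup>*\<^sup>* s (wait t s)"
      proof (cases "t = 0")
        case True then show ?thesis by simp
      next
        case F: False
        then have "greedy_step \<gamma> \<eta> I s (wait t s)" using False t no by (intro step_wait) auto
        then show ?thesis by blast
      qed
      moreover have "greedy_step \<gamma> \<eta> I (wait t s) s'" using ev False by (intro step_event) auto
      moreover obtain s'' where "(greedy_step \<gamma> \<eta> I)\<^sup>*\<^sup>* s' s''" "unconn s'' = {}"
        using less.hyps[of s'] event_inv[OF I g invw ev] by auto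
      ultimately show ?thesis by (meson converse_rtranclp_into_rtranclp rtranclp_trans)
    qed auto
  qed
qed

corollary two_chance_greedy_has_output:
  assumes "lflp_instance I" "\<gamma> \<in> {0..1}" "0 \<le> \<eta>"
    and "(\<exists>e\<in>edges I. 0 < people I e) \<or> (\<exists>i\<in>locs I. open_cost I i = 0)"
  shows "\<exists>S. two_chance_greedy \<gamma> \<eta> I S"
  using greedy_completes[OF assms rtranclp.rtrancl_refl] unfolding two_chance_greedy_def by blast

end

theory Submission
  imports Defs
begin

text \<open>
  Fix an optimal solution and split the edges among its facilities. An edge \<open>e\<close> served by \<open>i\<close> is
  summarised by its final value \<open>\<alpha>\<close>, the distance \<open>\<delta>\<close> from its end nearest to \<open>i\<close>, the distance \<open>\<beta>\<close> from
  that end to the facility assigned to it (\<open>\<beta> = \<alpha>\<close> if there is none), and the time \<open>\<sigma>\<close> of that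
  assignment. The triangle inequality and the fact that the offers to \<open>i\<close> never exceed \<open>\<eta> f\<^sub>i\<close> are the
  only two properties of these data that matter, and the algorithm pays at most
  \<open>\<kappa> \<alpha> - (\<kappa> - 1) \<beta>\<close> for \<open>e\<close>, where \<open>\<kappa> = (1 + \<gamma>) / \<eta>\<close>.

  To turn such data into a feasible point of the program with an arbitrary given \<open>n\<close>, cut them, in
  the order of \<open>\<alpha>\<close>, into \<open>n\<close> groups of equal mass, and average over the pairs \<open>(a, b)\<close>, where \<open>b\<close> is
  the group and \<open>a\<close> encodes \<open>\<sigma>\<close>. The obstacle is that (ii) is also demanded at pairs of mass 0. There
  all values are put equal to the threshold of the group, so that (ii) amounts to
  \<open>\<gamma> \<alpha>' - \<delta>' \<le> 2 \<alpha>\<close>, which fails when the data live on very different time scales. Dividing the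
  times of an item by \<open>p\<close> and multiplying its mass by \<open>p\<close> keeps its contribution to the cost, and
  in this way the data are brought to a common time scale without lowering the ratio, which needs
  \<open>\<Gamma> \<ge> \<kappa> / \<gamma> + \<kappa> - 1\<close>, a bound that an explicit feasible
  point provides.
\<close>

section \<open>Items\<close>

text \<open>For a real \<open>\<Gamma>\<close> the claim about one optimal facility is
  \<open>worth \<kappa> \<Gamma> D \<le> \<Gamma> * (C / \<eta>)\<close>, where \<open>C\<close> is
  \<open>\<eta>\<close> times its opening cost. Both \<open>worth\<close> and \<open>load\<close>
  are linear in the masses, so an item may be split into parts that are treated differently, and the
  bounds for the facilities add up. Rescaling keeps the load bounded if the factors \<open>p\<close>
  do not increase with \<open>\<sigma>\<close>: then a single time of the original schedule
  dominates all rescaled bids. The natural factor is the smallest reach among the items settled so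
  far, since by the triangle inequality it bounds all later gains. Ties are the obstacle: items
  settled at the same time \<open>s\<close> satisfy no such inequality against each other. A
  violation is harmless if twice the reach exceeds \<open>\<gamma> * s\<close>, which bounds every
  gain settled at \<open>s\<close>. The others are removed one by one, and this is where the lower
  bound on \<open>\<Gamma>\<close> enters. That bound must hold for every \<open>n\<close>. It is
  obtained from one balanced list of items, to which the averaging argument applies with any
  \<open>n\<close>.\<close>

text \<open>The fields are the mass, \<open>\<alpha>\<close>, \<open>\<delta>\<close>, \<open>\<beta>\<close>, \<open>\<sigma>\<close>, and whether the item is final, that is, whether
  \<open>\<sigma>\<close> is infinite; the value of \<open>si\<close> is ignored for final items.\<close>

record item =
  wt :: real
  al :: real
  de :: real
  be :: real
  si :: real
  fin :: bool

definition gain :: "real \<Rightarrow> item \<Rightarrow> real" where "gain \<gamma> e = \<gamma> * al e - de e"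
definition reach :: "item \<Rightarrow> real" where "reach e = be e + de e"
definition alive :: "real \<Rightarrow> item \<Rightarrow> bool" where "alive t e \<longleftrightarrow> fin e \<or> t \<le> si e"
definition earlier :: "item \<Rightarrow> item \<Rightarrow> bool" where
  "earlier e e' \<longleftrightarrow> \<not> fin e \<and> (fin e' \<or> si e < si e')"
text \<open>The discount \<open>\<gamma>\<close> applies from the start, although the algorithm bids
  at the full rate until \<open>al\<close>. This only lowers bids, and it gives the load the shape
  of (iii).\<close>

definition bid :: "real \<Rightarrow> real \<Rightarrow> item \<Rightarrow> real" where
  "bid \<gamma> t e = max (\<gamma> * min t (al e) - de e) 0"
definition share :: "real \<Rightarrow> real \<Rightarrow> item \<Rightarrow> real" where
  "share \<gamma> t e = (if alive t e then wt e * bid \<gamma> t e else 0)"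
definition load :: "real \<Rightarrow> item list \<Rightarrow> real \<Rightarrow> real" where
  "load \<gamma> D t = (\<Sum>e\<leftarrow>D. share \<gamma> t e)"
definition item_ok :: "item \<Rightarrow> bool" where
  "item_ok e \<longleftrightarrow> 0 \<le> wt e \<and> 0 \<le> de e \<and> de e \<le> al e \<and> 0 \<le> be e \<and> be e \<le> al e \<and> (fin e \<or> al e \<le> si e)"
definition admissible :: "real \<Rightarrow> real \<Rightarrow> item list \<Rightarrow> bool" where
  "admissible \<gamma> C D \<longleftrightarrow> (\<forall>e\<in>set D. item_ok e) \<and>
     (\<forall>e\<in>set D. \<forall>e'\<in>set D. earlier e e' \<longrightarrow> gain \<gamma> e' \<le> reach e) \<and> (\<forall>t. load \<gamma> D t \<le> C)"

text \<open>Condition (ii) between an empty pair of indices, where \<open>\<beta> = \<delta> = \<alpha>\<close>, and any other pair.\<close>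

definition balanced :: "real \<Rightarrow> item list \<Rightarrow> bool" where
  "balanced \<gamma> D \<longleftrightarrow> (\<forall>e\<in>set D. \<forall>e'\<in>set D. gain \<gamma> e' \<le> 2 * al e)"

definition val :: "real \<Rightarrow> real \<Rightarrow> item \<Rightarrow> real" where
  "val \<kappa> \<Gamma> e = wt e * (\<kappa> * al e - (\<kappa> - 1) * be e - \<Gamma> * de e)"
definition worth :: "real \<Rightarrow> real \<Rightarrow> item list \<Rightarrow> real" where
  "worth \<kappa> \<Gamma> D = (\<Sum>e\<leftarrow>D. val \<kappa> \<Gamma> e)"

lemma sum_list_nonneg_map: "(\<And>x. x \<in> set xs \<Longrightarrow> 0 \<le> f x) \<Longrightarrow> 0 \<le> (\<Sum>x\<leftarrow>xs. f x :: real)"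
  by (induction xs) auto

lemma bid_nonneg [simp]: "0 \<le> bid \<gamma> t e" by (simp add: bid_def)

lemma share_nonneg: "item_ok e \<Longrightarrow> 0 \<le> share \<gamma> t e"
  by (simp add: share_def item_ok_def)

lemma admissibleD:
  assumes "admissible \<gamma> C D"
  shows "e \<in> set D \<Longrightarrow> item_ok e" "load \<gamma> D t \<le> C"
    "e \<in> set D \<Longrightarrow> e' \<in> set D \<Longrightarrow> earlier e e' \<Longrightarrow> gain \<gamma> e' \<le> reach e"
  using assms by (auto simp: admissible_def)

lemma admissible_nonneg: "admissible \<gamma> C D \<Longrightarrow> 0 \<le> C"
  using admissibleD(2)[of \<gamma> C D 0] sum_list_nonneg_map[of D "share \<gamma> 0"] share_nonneg admissibleD(1)
  unfolding load_def by fastforce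

lemma admissible_filter:
  assumes "admissible \<gamma> C D" shows "admissible \<gamma> C (filter P D)"
proof -
  have "load \<gamma> (filter P D) t \<le> load \<gamma> D t" for t
    unfolding load_def sum_list_map_filter'
    using share_nonneg admissibleD(1)[OF assms] by (intro sum_list_mono) auto
  then have "load \<gamma> (filter P D) t \<le> C" for t
    using admissibleD(2)[OF assms, of t] by (meson order_trans)
  then show ?thesis using assms unfolding admissible_def by auto
qed

section \<open>Rescaling and shifting items\<close>

definition scale :: "real \<Rightarrow> item \<Rightarrow> item" where
  "scale r e = \<lparr>wt = wt e * r, al = al e / r, de = de e / r, be = be e / r, si = si e / r, fin = fin e\<rparr>"

lemma scale_simps [simp]:
  "wt (scale r e) = wt e * r" "al (scale r e) = al e / r" "de (scale r e) = de e / r"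
  "be (scale r e) = be e / r" "si (scale r e) = si e / r" "fin (scale r e) = fin e"
  by (auto simp: scale_def)

lemma val_scale: "r > 0 \<Longrightarrow> val \<kappa> \<Gamma> (scale r e) = val \<kappa> \<Gamma> e"
  by (simp add: val_def field_simps)

lemma gain_scale: "gain \<gamma> (scale r e) = gain \<gamma> e / r"
  by (simp add: gain_def diff_divide_distrib)

lemma reach_scale: "reach (scale r e) = reach e / r"
  by (simp add: reach_def add_divide_distrib)

lemma item_ok_scale: "r > 0 \<Longrightarrow> item_ok e \<Longrightarrow> item_ok (scale r e)"
  by (auto simp: item_ok_def divide_right_mono)

lemma bid_scale: "r > 0 \<Longrightarrow> r * bid \<gamma> t (scale r e) = bid \<gamma> (t * r) e"
proof -
  assume r: "r > 0"
  have "r * max (\<gamma> * min t (al e / r) - de e / r) 0 = max (r * (\<gamma> * min t (al e / r) - de e / r)) (r * 0)"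
    using r by (simp add: max_mult_distrib_left)
  also have "r * (\<gamma> * min t (al e / r) - de e / r) = \<gamma> * (r * min t (al e / r)) - de e"
    using r by (simp add: field_simps)
  also have "r * min t (al e / r) = min (t * r) (al e)"
    using r by (simp add: min_mult_distrib_left mult.commute)
  finally show ?thesis by (simp add: bid_def)
qed

lemma bid_mono: "0 \<le> \<gamma> \<Longrightarrow> t \<le> t' \<Longrightarrow> bid \<gamma> t e \<le> bid \<gamma> t' e"
  unfolding bid_def by (intro max.mono diff_mono mult_left_mono min.mono) auto

lemma bid_le_0: "0 \<le> \<gamma> \<Longrightarrow> item_ok e \<Longrightarrow> t \<le> 0 \<Longrightarrow> bid \<gamma> t e = 0"
proof -
  assume a: "0 \<le> \<gamma>" "item_ok e" "t \<le> 0"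
  then have "\<gamma> * min t (al e) \<le> 0" by (simp add: mult_nonneg_nonpos item_ok_def)
  then show ?thesis using a by (simp add: bid_def item_ok_def)
qed

text \<open>One time of the original schedule serves all items that are alive at \<open>t\<close> after rescaling:
  the largest of the times \<open>t * p e\<close>.\<close>

lemma common_time:
  assumes t: "0 < t"
    and mono: "\<And>e e'. e \<in> S \<Longrightarrow> e' \<in> S \<Longrightarrow> earlier e' e \<Longrightarrow> p e \<le> p e'"
    and "finite S" and alive: "\<And>e. e \<in> S \<Longrightarrow> alive (t * p e) e"
  obtains t' where "\<And>e. e \<in> S \<Longrightarrow> t * p e \<le> t' \<and> alive t' e"
proof (cases "S = {}")
  case False
  define t' where "t' = Max ((\<lambda>e. t * p e) ` S)"
  have "t' \<in> (\<lambda>e. t * p e) ` S" unfolding t'_def using False assms(3) by (intro Max_in) auto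
  then obtain e0 where e0: "e0 \<in> S" "t' = t * p e0" by blast
  have "alive t' e" if e: "e \<in> S" for e
  proof (cases "fin e \<or> (\<not> fin e0 \<and> si e0 \<le> si e)")
    case True then show ?thesis using alive[OF e0(1)] e0 by (auto simp: alive_def)
  next
    case F: False
    then have "p e0 \<le> p e" using mono[OF e0(1) e] by (auto simp: earlier_def)
    then have "t * p e0 \<le> t * p e" using t by simp
    then show ?thesis using alive[OF e] e0 F by (auto simp: alive_def)
  qed
  moreover have "t * p e \<le> t'" if "e \<in> S" for e
    unfolding t'_def using that assms(3) by (intro Max_ge) auto
  ultimately show ?thesis using that by blast
qed (use that in blast)

text \<open>At \<open>t\<close> a scaled item, with its mass multiplied by \<open>p e\<close>, bids
  what the original bids at \<open>t * p e\<close>; \<open>common_time\<close> replaces these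
  different times by one. For \<open>t \<le> 0\<close> all scaled bids vanish.\<close>

lemma load_scale:
  assumes "0 \<le> \<gamma>" and ok: "\<And>e. e \<in> set D \<Longrightarrow> item_ok e" and p: "\<And>e. e \<in> set D \<Longrightarrow> 0 < p e"
    and mono: "\<And>e e'. e \<in> set D \<Longrightarrow> e' \<in> set D \<Longrightarrow> earlier e' e \<Longrightarrow> p e \<le> p e'"
  shows "\<exists>t'. load \<gamma> (map (\<lambda>e. scale (p e) e) D) t \<le> load \<gamma> D t'"
proof (cases "0 < t")
  case False
  have "share \<gamma> t (scale (p e) e) \<le> share \<gamma> t e" if "e \<in> set D" for e
    using False bid_le_0[of \<gamma> "scale (p e) e" t] that assms share_nonneg[OF ok[OF that]]
    by (auto simp: share_def[of \<gamma> t "scale (p e) e"] item_ok_scale)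
  then have "load \<gamma> (map (\<lambda>e. scale (p e) e) D) t \<le> load \<gamma> D t"
    unfolding load_def by (auto simp: o_def intro!: sum_list_mono)
  then show ?thesis by blast
next
  case True
  define S where "S = {e \<in> set D. alive t (scale (p e) e)}"
  have al: "alive (t * p e) e" if "e \<in> S" for e
    using that p[of e] by (auto simp: S_def alive_def field_simps)
  obtain t' where t': "\<And>e. e \<in> S \<Longrightarrow> t * p e \<le> t' \<and> alive t' e"
    using common_time[OF True, of S p] mono al unfolding S_def
      by (smt (verit, best) List.finite_set finite_subset mem_Collect_eq subsetI)
  have "share \<gamma> t (scale (p e) e) \<le> share \<gamma> t' e" if e: "e \<in> set D" for e
  proof (cases "e \<in> S")
    case S: True
    have "p e * bid \<gamma> t (scale (p e) e) \<le> bid \<gamma> t' e"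
      using bid_scale[OF p[OF e]] bid_mono[OF assms(1)] t'[OF S] by simp
    then have "wt e * (p e * bid \<gamma> t (scale (p e) e)) \<le> wt e * bid \<gamma> t' e"
      using ok[OF e] by (intro mult_left_mono) (auto simp: item_ok_def)
    then show ?thesis using S t'[OF S] by (simp add: share_def S_def mult.assoc)
  next
    case F: False
    then show ?thesis using e share_nonneg[OF ok[OF e]] by (auto simp: S_def share_def)
  qed
  then have "load \<gamma> (map (\<lambda>e. scale (p e) e) D) t \<le> load \<gamma> D t'"
    unfolding load_def by (auto simp: o_def intro!: sum_list_mono)
  then show ?thesis by blast
qed

text \<open>Stretching an item (without moving the time at which it stops bidding) only delays its bids.\<close>

lemma share_stretch:
  assumes "0 \<le> \<gamma>" "0 < r" "r \<le> 1" "item_ok e"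
  shows "share \<gamma> t ((scale r e)\<lparr>si := si e\<rparr>) \<le> share \<gamma> t e"
proof (cases "0 \<le> t")
  case True
  have b: "bid \<gamma> t ((scale r e)\<lparr>si := si e\<rparr>) = bid \<gamma> t (scale r e)" by (simp add: bid_def)
  have "r * bid \<gamma> t (scale r e) \<le> bid \<gamma> t e"
    using bid_scale[OF assms(2)] bid_mono[OF assms(1)] True assms(3) by (simp add: mult_left_le)
  then have "wt e * (r * bid \<gamma> t (scale r e)) \<le> wt e * bid \<gamma> t e"
    using assms by (intro mult_left_mono) (auto simp: item_ok_def)
  then show ?thesis unfolding share_def b by (simp add: alive_def mult.assoc)
next
  case False
  have b: "bid \<gamma> t ((scale r e)\<lparr>si := si e\<rparr>) = bid \<gamma> t (scale r e)" by (simp add: bid_def)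
  have "bid \<gamma> t (scale r e) = 0" using False assms by (intro bid_le_0 item_ok_scale) auto
  then show ?thesis unfolding share_def b using assms by (auto simp: item_ok_def)
qed

text \<open>Scaling by \<open>p\<close> brings all gains below 1; items whose \<open>\<alpha>\<close> then falls short of 1/2 are stretched
  up to 1/2.\<close>

lemma balance:
  assumes g: "0 < \<gamma>" "\<gamma> \<le> 1" and adm: "admissible \<gamma> C D"
    and pos: "\<And>e. e \<in> set D \<Longrightarrow> 0 < gain \<gamma> e"
    and p: "\<And>e. e \<in> set D \<Longrightarrow> 0 < p e"
    and mono: "\<And>e e'. e \<in> set D \<Longrightarrow> e' \<in> set D \<Longrightarrow> \<not> fin e' \<Longrightarrow> fin e \<or> si e' \<le> si e \<Longrightarrow> p e \<le> p e'"
    and ord: "\<And>e e'. e \<in> set D \<Longrightarrow> e' \<in> set D \<Longrightarrow> earlier e e' \<Longrightarrow> gain \<gamma> e' / p e' \<le> reach e / p e"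
    and gp: "\<And>e. e \<in> set D \<Longrightarrow> gain \<gamma> e \<le> p e"
    and rp: "\<And>e. e \<in> set D \<Longrightarrow> \<not> fin e \<Longrightarrow> p e \<le> 2 * reach e"
    and sp: "\<And>e. e \<in> set D \<Longrightarrow> \<not> fin e \<Longrightarrow> p e \<le> 2 * al e \<or> p e \<le> 2 * si e"
  shows "\<exists>D'. admissible \<gamma> C D' \<and> balanced \<gamma> D' \<and> worth \<kappa> \<Gamma> D' = worth \<kappa> \<Gamma> D"
proof -
  define f where "f e = scale (p e) e" for e
  \<comment> \<open>This brings \<open>\<alpha>\<close> up to exactly 1/2 where it was smaller, so
    that \<open>2 * al (h e)\<close> is at least 1, the bound on all gains.\<close>
  define r where "r e = min 1 (2 * al (f e))" for e
  define h where "h e = (scale (r e) (f e))\<lparr>si := si (f e)\<rparr>" for e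
  have al0: "0 < al e" if "e \<in> set D" for e
  proof -
    have "0 < \<gamma> * al e" using pos[OF that] admissibleD(1)[OF adm that] by (simp add: gain_def item_ok_def)
    then show ?thesis using g by (simp add: zero_less_mult_iff)
  qed
  have okf: "item_ok (f e)" if "e \<in> set D" for e
    using that p adm by (auto simp: f_def intro: item_ok_scale admissibleD)
  have r0: "0 < r e" "r e \<le> 1" "r e \<le> 2 * al (f e)" if "e \<in> set D" for e
    using al0[OF that] p[OF that] by (auto simp: r_def f_def)
  have alh: "al (h e) = max (al (f e)) (1/2)" if "e \<in> set D" for e
    using al0[OF that] p[OF that] unfolding h_def r_def f_def by (auto simp: min_def max_def field_simps)
  have okh: "item_ok (h e)" if e: "e \<in> set D" for e
  proof -
    have *: "item_ok (scale (r e) (f e))" using okf r0 e by (intro item_ok_scale) auto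
    have "al (h e) \<le> si (h e)" if "\<not> fin e"
    proof -
      have "al (f e) \<le> si (f e)" using okf[OF e] that by (simp add: item_ok_def f_def)
      moreover have "1/2 \<le> si (f e) \<or> 1/2 \<le> al (f e)" using sp[OF e that] p[OF e]
        by (auto simp: f_def field_simps)
      ultimately show ?thesis unfolding alh[OF e] by (auto simp: h_def)
    qed
    then show ?thesis using * by (auto simp: item_ok_def h_def f_def)
  qed
  \<comment> \<open>Stretching may increase a gain, but only to 1/2 at most; \<open>rp\<close> keeps
    every reach above that.\<close>
  have gh: "gain \<gamma> (h e) \<le> 1 \<and> (gain \<gamma> (h e) = gain \<gamma> (f e) \<or> gain \<gamma> (h e) \<le> 1/2)" if e: "e \<in> set D" for e
  proof (cases "al (f e) \<ge> 1/2")
    case True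
    then have "r e = 1" by (simp add: r_def)
    then have "gain \<gamma> (h e) = gain \<gamma> (f e)" by (simp add: h_def gain_def)
    moreover have "gain \<gamma> (f e) \<le> 1" using gp[OF e] p[OF e] by (simp add: f_def gain_scale)
    ultimately show ?thesis by simp
  next
    case False
    then have "al (h e) = 1/2" using alh[OF e] by simp
    moreover have "0 \<le> de (h e)" using okh[OF e] by (simp add: item_ok_def)
    moreover have "\<gamma> * al (h e) \<le> 1 * al (h e)" using g calculation by (intro mult_right_mono) auto
    ultimately have "gain \<gamma> (h e) \<le> 1/2" unfolding gain_def by linarith
    then show ?thesis by simp
  qed
  have rh: "reach (f e) \<le> reach (h e)" if e: "e \<in> set D" for e
  proof -
    have "reach (h e) = reach (f e) / r e" by (simp add: h_def reach_def add_divide_distrib)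
    moreover have "0 \<le> reach (f e)" using okf[OF e] by (simp add: item_ok_def reach_def)
    ultimately show ?thesis using r0[OF e] by (simp add: le_divide_eq mult_left_le)
  qed
  have Ah: "gain \<gamma> (h e') \<le> reach (h e)" if e: "e \<in> set D" "e' \<in> set D" and "earlier (h e) (h e')" for e e'
  proof -
    have nf: "\<not> fin e" "fin e' \<or> si (f e) < si (f e')" using that by (auto simp: earlier_def h_def f_def)
    \<comment> \<open>By \<open>mono\<close>, factors do not increase with time and agree on ties,
      so scaling cannot create a new strict order.\<close>
    have "earlier e e'"
    proof (rule ccontr)
      assume n: "\<not> earlier e e'"
      then have F: "\<not> fin e'" "si e' \<le> si e" using nf by (auto simp: earlier_def)
      have "p e \<le> p e'" using mono[of e e'] e F by auto
      moreover have "0 \<le> si e'"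
        using admissibleD(1)[OF adm e(2)] al0[OF e(2)] F by (simp add: item_ok_def)
      ultimately have "si e' / p e' \<le> si e / p e"
        using F p e by (meson frac_le order_trans)
      then show False using nf F by (simp add: f_def)
    qed
    then have "gain \<gamma> (f e') \<le> reach (f e)" using ord e by (simp add: f_def gain_scale reach_scale)
    moreover have "1/2 \<le> reach (f e)" using rp[OF e(1) nf(1)] p[OF e(1)]
      by (simp add: f_def reach_scale field_simps)
    ultimately show ?thesis using gh[OF e(2)] rh[OF e(1)] by linarith
  qed
  have "worth \<kappa> \<Gamma> (map h D) = worth \<kappa> \<Gamma> D"
  proof -
    have "val \<kappa> \<Gamma> (h e) = val \<kappa> \<Gamma> e" if e: "e \<in> set D" for e
    proof -
      have "val \<kappa> \<Gamma> (h e) = val \<kappa> \<Gamma> (scale (r e) (f e))" by (simp add: h_def val_def)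
      then show ?thesis using r0[OF e] p[OF e] by (simp add: val_scale f_def)
    qed
    then show ?thesis by (simp add: worth_def o_def cong: map_cong)
  qed
  moreover have "balanced \<gamma> (map h D)"
    using gh alh by (fastforce simp: balanced_def)
  moreover have "load \<gamma> (map h D) t \<le> C" for t
  proof -
    have "load \<gamma> (map h D) t \<le> load \<gamma> (map f D) t"
      unfolding load_def using share_stretch[of \<gamma> "r e" "f e" t for e] g r0 okf
      by (auto simp: o_def h_def intro!: sum_list_mono)
    moreover have "\<exists>t'. load \<gamma> (map f D) t \<le> load \<gamma> D t'"
      unfolding f_def using g adm p mono by (intro load_scale) (auto intro: admissibleD simp: earlier_def)
    ultimately show ?thesis using admissibleD(2)[OF adm] by (meson order_trans)
  qed
  moreover have "\<forall>e\<in>set (map h D). item_ok e" using okh by auto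
  moreover have "\<forall>e\<in>set (map h D). \<forall>e'\<in>set (map h D). earlier e e' \<longrightarrow> gain \<gamma> e' \<le> reach e"
    using Ah by auto
  ultimately show ?thesis unfolding admissible_def by blast
qed

text \<open>Lowering \<open>\<alpha>\<close> by \<open>h\<close> and \<open>\<delta>\<close> by
  \<open>\<gamma> * h\<close> turns the scaled bid at \<open>t + h\<close> into the bid at
  \<open>t\<close>. The times need to be compared only where the bid is positive, which excludes
  small \<open>t\<close>.\<close>

lemma bid_shift:
  assumes "0 \<le> \<gamma>" "0 < r" and a: "a + h = al e / r" and d: "d = de e / r - \<gamma> * h"
    and le: "0 < \<gamma> * min t a - d \<Longrightarrow> min t a + h \<le> t' / r"
  shows "r * max (\<gamma> * min t a - d) 0 \<le> bid \<gamma> t' e"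
proof (cases "0 < \<gamma> * min t a - d")
  case True
  have "min t a + h \<le> min (t' / r) (al e / r)" using le[OF True] a by auto
  then have "\<gamma> * (min t a + h) \<le> \<gamma> * min (t' / r) (al e / r)" using assms(1) by (rule mult_left_mono)
  then have "max (\<gamma> * min t a - d) 0 \<le> bid \<gamma> (t' / r) (scale r e)"
    using d by (simp add: bid_def algebra_simps)
  then have "r * max (\<gamma> * min t a - d) 0 \<le> r * bid \<gamma> (t' / r) (scale r e)"
    using assms(2) by simp
  then show ?thesis using bid_scale[OF assms(2), of \<gamma> "t' / r" e] assms(2) by simp
next
  case False then show ?thesis by (simp add: max_absorb2)
qed

section \<open>Closing the gaps between time scales\<close>

text \<open>Scaling the items from time \<open>s\<close> on to gains of at most \<open>q\<close> opens a gap between \<open>s\<close> and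
  \<open>x = s / \<rho>\<close>. Moving \<open>\<alpha>\<close> down by \<open>h\<close> and \<open>\<delta>\<close> by \<open>\<gamma> h\<close> preserves the gain, closes the gap by \<open>b\<close>, and
  raises the value because \<open>\<Gamma> \<gamma> \<ge> \<kappa>\<close>. This surplus pays for raising \<open>\<beta>\<close> to \<open>q - \<delta>\<close> at the items
  settled at \<open>s\<close> whose reach is too small. If \<open>Z\<close>, the bids that the items settled after \<open>s\<close> still gain
  from time \<open>x\<close> on, is too small for that, only the fraction \<open>\<theta>\<close> of the mass of these items is
  treated in this way, and the rest is made final, which fits into the load that remains.\<close>

lemma close_gap:
  fixes r :: "item \<Rightarrow> real"
  assumes g: "0 < \<gamma>" "\<gamma> \<le> 1" and adm: "admissible \<gamma> C D"
    and kG: "1 \<le> \<kappa>" "\<gamma> * (\<kappa> - 1) \<le> \<gamma> * \<Gamma> - \<kappa>"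
    and pos: "\<And>e. e \<in> set D \<Longrightarrow> 0 < gain \<gamma> e"
    and rho: "0 < \<rho>" "\<rho> < 1" and q: "0 < q" "q \<le> \<gamma> * s" and gap: "2 * q * \<rho> \<le> \<gamma> * s"
    and before: "\<And>e. e \<in> set D \<Longrightarrow> \<not> fin e \<Longrightarrow> si e < s \<Longrightarrow> q \<le> reach e"
    and r01: "\<And>e. e \<in> set D \<Longrightarrow> fin e \<or> s \<le> si e \<Longrightarrow> 0 < r e \<and> r e \<le> 1 \<and> gain \<gamma> e \<le> q * r e"
    and aft: "\<And>e. e \<in> set D \<Longrightarrow> fin e \<or> s < si e \<Longrightarrow> r e \<le> \<rho> \<and> (\<not> fin e \<longrightarrow> q * r e \<le> reach e)"
    and at: "\<And>e. e \<in> set D \<Longrightarrow> \<not> fin e \<Longrightarrow> si e = s \<Longrightarrow>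
       \<rho> \<le> r e \<and> q * \<rho> \<le> reach e \<and> (reach e < q * r e \<longrightarrow> gain \<gamma> e = q * r e)"
    and mono: "\<And>e e'. e \<in> set D \<Longrightarrow> e' \<in> set D \<Longrightarrow> earlier e' e \<Longrightarrow> s < si e' \<Longrightarrow> r e \<le> r e'"
  shows "\<exists>D'. admissible \<gamma> C D' \<and> worth \<kappa> \<Gamma> D \<le> worth \<kappa> \<Gamma> D' \<and>
    (\<forall>e\<in>set D'. (e \<in> set D \<and> \<not> fin e \<and> si e < s) \<or>
       (0 < gain \<gamma> e \<and> gain \<gamma> e \<le> q \<and> (\<not> fin e \<longrightarrow> s \<le> si e \<and> q \<le> reach e))) \<and>
    ((\<exists>e\<in>set D. fin e) \<longrightarrow> (\<exists>e\<in>set D'. fin e))"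
proof -
  define v where "v = q / \<gamma>"
  have vg: "\<gamma> * v = q" using g by (simp add: v_def)
  define x where "x = s / \<rho>"
  \<comment> \<open>\<open>v\<close> is the time in which a bid rises by \<open>q\<close>. A shifted
    item has \<open>\<alpha> \<ge> w\<close> and gain at most \<open>q\<close>, hence starts bidding
    no earlier than \<open>w - v\<close>. Its bids up to \<open>s\<close> stay below the original
    ones if \<open>\<rho> * b \<le> (1 - \<rho>) * (w - v)\<close> with \<open>w = x - b\<close>;
    this \<open>b\<close> gives equality.\<close>
  define b where "b = (x - v) * (1 - \<rho>)"
  define w where "w = x - b"
  \<comment> \<open>Scaled values of \<open>\<alpha>\<close> up to \<open>w\<close> stay, those
    between \<open>w\<close> and \<open>x\<close> collapse to \<open>w\<close>, and those beyond
    \<open>x\<close> move by the full \<open>b\<close>.\<close>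
  define h where "h e = max 0 (min b (al e / r e - w))" for e :: item
  define d where "d e = de e / r e - \<gamma> * h e" for e :: item
  define a where "a e = al e / r e - h e" for e :: item
  \<comment> \<open>The parameter \<open>c\<close> is the fraction of the mass, \<open>l\<close>
    tells whether the copy is final, and \<open>t\<close> is its new time. The new
    \<open>\<beta>\<close> is the least one with reach at least \<open>q\<close>; a final item is
    never the earlier one of a pair and gets 0.\<close>
  define N where "N c l t e = \<lparr>wt = wt e * r e * c, al = a e, de = d e,
     be = (if l then 0 else max (q - d e) 0), si = t, fin = l\<rparr>" for c l t and e :: item
  define after where "after e \<longleftrightarrow> fin e \<or> s < si e" for e :: item
  define atm where "atm e \<longleftrightarrow> \<not> fin e \<and> si e = s" for e :: item
  define old where "old e \<longleftrightarrow> \<not> fin e \<and> si e < s" for e :: item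
  define low where "low e \<longleftrightarrow> atm e \<and> reach e < q * r e" for e :: item
  define nb where "nb t e = max (\<gamma> * min t (a e) - d e) 0" for t and e :: item
  define u where "u e = max (\<gamma> * min x (al e / r e) - de e / r e) 0" for e
  define z where "z e = gain \<gamma> e / r e - u e" for e
  define M where "M = (\<Sum>e\<leftarrow>D. if low e then wt e * r e * q else 0)"
  define Z where "Z = (\<Sum>e\<leftarrow>D. if after e then wt e * r e * z e else 0)"
  define \<theta> where "\<theta> = (if M \<le> Z then 1 else Z / M)"
  define D' where "D' = filter old D @ map (\<lambda>e. N 1 (fin e) (si e / r e - b) e) (filter after D) @
    map (\<lambda>e. N (if low e then \<theta> else 1) False w e) (filter atm D) @
    map (\<lambda>e. N (1 - \<theta>) True 0 e) (filter low D)"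
  have ok: "item_ok e" if "e \<in> set D" for e using that adm by (rule admissibleD(1)[rotated])
  have s0: "0 < s" using q g by (smt (verit) mult_nonneg_nonpos)
  have gx: "2 * q \<le> \<gamma> * x" using gap rho by (simp add: x_def field_simps)
  have xq: "2 * v \<le> x" using gx g by (simp add: v_def field_simps)
  have qg: "0 < v" "q \<le> v" "v \<le> s" using q g by (auto simp: v_def field_simps)
  have b0: "0 < b" unfolding b_def using xq qg rho by (intro mult_pos_pos) auto
  have wt1: "w = \<rho> * x + (1 - \<rho>) * (v)" by (simp add: w_def b_def algebra_simps)
  have rx: "\<rho> * x = s" using rho by (simp add: x_def)
  have ws: "s < w" using wt1 rx mult_pos_pos[of "1 - \<rho>" v] qg rho by linarith
  have wq: "w - v = \<rho> * (x - v)" by (simp add: wt1 algebra_simps)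
  have bq: "\<rho> * b = (1 - \<rho>) * (w - v)" unfolding b_def wq by (simp add: algebra_simps)
  have h0: "0 \<le> h e" "h e \<le> b" for e using b0 by (auto simp: h_def)
  have aw: "w \<le> a e" if "0 < h e" for e using that by (auto simp: h_def a_def)
  have ah: "a e + h e = al e / r e" for e by (simp add: a_def)
  have new: "0 < r e" "r e \<le> 1" "gain \<gamma> e / r e \<le> q" "0 < gain \<gamma> e / r e" "0 \<le> al e / r e" "0 \<le> de e / r e"
    "0 \<le> be e / r e" "be e / r e \<le> al e / r e" "0 \<le> wt e * r e"
    if "e \<in> set D" "\<not> old e" for e
  proof -
    have "fin e \<or> s \<le> si e" using that by (auto simp: old_def)
    from r01[OF that(1) this] show "0 < r e" "r e \<le> 1" "gain \<gamma> e / r e \<le> q" by (auto simp: field_simps)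
    then show "0 < gain \<gamma> e / r e" "0 \<le> al e / r e" "0 \<le> de e / r e"
      "0 \<le> be e / r e" "be e / r e \<le> al e / r e" "0 \<le> wt e * r e"
      using pos[OF that(1)] ok[OF that(1)] by (auto simp: item_ok_def divide_right_mono)
  qed
  have ga: "\<gamma> * a e - d e = gain \<gamma> e / r e" for e
    by (simp add: a_def d_def gain_def diff_divide_distrib algebra_simps)
  have a0: "0 \<le> a e" if "e \<in> set D" "\<not> old e" for e
    using aw[of e] new(5)[OF that] ws s0 h0(1)[of e] by (cases "0 < h e") (auto simp: a_def)
  have dq: "\<gamma> * w - q \<le> d e" if "e \<in> set D" "\<not> old e" "0 < h e" for e
  proof -
    have "\<gamma> * w \<le> \<gamma> * a e" using aw[OF that(3)] g by simp
    then show ?thesis using ga[of e] new(3)[OF that(1,2)] by linarith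
  qed
  have d0: "0 \<le> d e" if "e \<in> set D" "\<not> old e" for e
  proof (cases "0 < h e")
    case True
    have "\<gamma> * w - q = \<gamma> * (w - v)" using vg by (simp add: algebra_simps)
    also have "\<dots> \<ge> 0" unfolding wq using rho xq qg g by (intro mult_nonneg_nonneg) auto
    finally show ?thesis using dq[OF that True] by linarith
  next
    case False then show ?thesis using h0(1)[of e] new(6)[OF that] by (simp add: d_def)
  qed
  have da: "d e \<le> a e" if "e \<in> set D" "\<not> old e" for e
  proof -
    have "\<gamma> * a e \<le> 1 * a e" using a0[OF that] g by (intro mult_right_mono) auto
    then show ?thesis using ga[of e] new(4)[OF that] by linarith
  qed
  have cls: "old e \<or> after e \<or> atm e" for e by (auto simp: old_def after_def atm_def)
  have nold: "\<not> old e" if "after e \<or> atm e" for e using that by (auto simp: old_def after_def atm_def)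
  have sr: "x \<le> s / r e" "s / r e \<le> si e / r e \<or> fin e" if "e \<in> set D" "after e" for e
  proof -
    have "0 < r e" "r e \<le> \<rho>" using new(1)[OF that(1) nold] aft[OF that(1)] that(2) by (auto simp: after_def)
    then show "x \<le> s / r e" "s / r e \<le> si e / r e \<or> fin e" using s0 that(2)
      by (auto simp: x_def after_def intro!: divide_left_mono divide_right_mono)
  qed
  have atx: "al e / r e \<le> s / r e" "s / r e \<le> x" "h e = max 0 (al e / r e - w)" "a e \<le> w" "\<rho> \<le> r e"
    if "e \<in> set D" "atm e" for e
  proof -
    have 1: "0 < r e" using new(1)[OF that(1) nold] that(2) by auto
    show 2: "\<rho> \<le> r e" using at[OF that(1)] that(2) by (auto simp: atm_def)
    show 3: "al e / r e \<le> s / r e" using 1 ok[OF that(1)] that(2)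
      by (auto simp: atm_def item_ok_def intro!: divide_right_mono)
    show 4: "s / r e \<le> x" using 1 2 s0 rho by (auto simp: x_def intro!: divide_left_mono)
    have "al e / r e - w \<le> b" using 3 4 by (simp add: w_def)
    then show "h e = max 0 (al e / r e - w)" by (simp add: h_def)
    then show "a e \<le> w" by (auto simp: a_def)
  qed
  have aft_si: "a e \<le> si e / r e - b" "w \<le> si e / r e - b" if "e \<in> set D" "after e" "\<not> fin e" for e
  proof -
    have "x \<le> si e / r e" using sr[OF that(1,2)] that(3) by auto
    moreover have "al e / r e \<le> si e / r e"
      using new(1)[OF that(1) nold] that ok[OF that(1)] by (auto simp: item_ok_def intro!: divide_right_mono)
    ultimately show "a e \<le> si e / r e - b" "w \<le> si e / r e - b" by (auto simp: a_def h_def w_def)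
  qed
  \<comment> \<open>The raised \<open>\<beta>\<close> stays below \<open>\<alpha>\<close>: a low
    item has gain exactly \<open>q\<close> after scaling, hence \<open>\<alpha> \<ge> q\<close>; any
    other one already had reach at least \<open>q\<close> after scaling.\<close>
  have bea: "max (q - d e) 0 \<le> a e" if "e \<in> set D" "\<not> old e" "\<not> fin e" for e
  proof (cases "0 < h e")
    case True then show ?thesis using aw[OF True] ws qg d0[OF that(1,2)] s0 by auto
  next
    case False
    then have h: "h e = 0" using h0(1)[of e] by simp
    have "q \<le> a e + d e"
    proof (cases "reach e < q * r e")
      case True
      then have "atm e" using aft[OF that(1)] that cls[of e] by (auto simp: after_def)
      then have "gain \<gamma> e / r e = q" using at[OF that(1)] True new(1)[OF that(1,2)] by (auto simp: atm_def)
      moreover have "\<gamma> * a e \<le> 1 * a e" using a0[OF that(1,2)] g by (intro mult_right_mono) auto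
      ultimately show ?thesis using ga[of e] d0[OF that(1,2)] by linarith
    next
      case F: False
      then have "q \<le> reach e / r e" using new(1)[OF that(1,2)] by (simp add: field_simps)
      then have "q \<le> be e / r e + de e / r e" by (simp add: reach_def add_divide_distrib)
      then show ?thesis using new(8)[OF that(1,2)] h by (simp add: a_def d_def)
    qed
    then show ?thesis using a0[OF that(1,2)] by auto
  qed
  have u0: "0 \<le> u e" for e by (simp add: u_def)
  have z0: "0 \<le> z e" if "e \<in> set D" "after e" for e
  proof -
    have "\<gamma> * min x (al e / r e) \<le> \<gamma> * (al e / r e)" using g by (intro mult_left_mono) auto
    then show ?thesis using new(4)[OF that(1) nold] that(2)
      by (auto simp: z_def u_def gain_def diff_divide_distrib)
  qed
  have M0: "0 \<le> M" unfolding M_def using new(9) q nold by (intro sum_list_nonneg_map) (auto simp: low_def)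
  have Z0: "0 \<le> Z" unfolding Z_def using new(9) z0 nold by (intro sum_list_nonneg_map) (auto)
  have th: "0 \<le> \<theta>" "\<theta> \<le> 1" "\<theta> * M \<le> Z"
    using M0 Z0 by (auto simp: \<theta>_def field_simps)
  have nbs: "r e * nb t e \<le> bid \<gamma> t e" if e: "e \<in> set D" "\<not> old e" and t: "t \<le> s" for e t
    unfolding nb_def
  proof (rule bid_shift[OF _ new(1)[OF e] ah d_def])
    assume p: "0 < \<gamma> * min t (a e) - d e"
    then have "0 < \<gamma> * min t (a e)" using d0[OF e] by linarith
    then have tp: "0 < t" using g by (simp add: zero_less_mult_iff)
    note r = new(1,2)[OF e]
    have "t + h e \<le> t / r e"
    proof (cases "0 < h e")
      case True
      have "\<gamma> * min t (a e) \<le> \<gamma> * t" using g by simp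
      then have "\<gamma> * (w - v) < \<gamma> * t" using dq[OF e True] p vg by (simp add: right_diff_distrib)
      then have tw: "w - v \<le> t" using g by simp
      have "h e * r e \<le> t * (1 - r e)"
      proof (cases "atm e")
        case True
        have "h e \<le> s / r e - w" using atx(1,3)[OF e(1) True] \<open>0 < h e\<close> by auto
        then have "h e * r e \<le> (s / r e - w) * r e" using r by (intro mult_right_mono) auto
        also have "\<dots> = s - w * r e" using r by (simp add: field_simps)
        also have "\<dots> = (w - v) * (1 - r e) + (v) * (\<rho> - r e)"
          unfolding rx[symmetric] wt1 by (simp add: algebra_simps)
        also have "\<dots> \<le> t * (1 - r e) + 0"
          using tw r qg atx(5)[OF e(1) True] by (intro add_mono mult_right_mono mult_nonneg_nonpos) auto
        finally show ?thesis by simp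
      next
        case False
        then have "after e" using cls e by blast
        then have "r e \<le> \<rho>" using aft[OF e(1)] by (auto simp: after_def)
        then have "h e * r e \<le> b * \<rho>" using h0 b0 r by (intro mult_mono) auto
        also have "\<dots> = (w - v) * (1 - \<rho>)" using bq by (simp add: mult.commute)
        also have "\<dots> \<le> t * (1 - r e)" using tw \<open>r e \<le> \<rho>\<close> rho tp by (intro mult_mono) auto
        finally show ?thesis .
      qed
      then show ?thesis using r by (simp add: field_simps)
    next
      case False
      then have "h e = 0" using h0(1)[of e] by simp
      then show ?thesis using r tp by (simp add: field_simps mult_left_le)
    qed
    then show "min t (a e) + h e \<le> t / r e" by linarith
  qed (use g in auto)
  \<comment> \<open>The times from \<open>s\<close> to \<open>w\<close> are all compared with the
    one time \<open>s\<close>, at which every item settled from \<open>s\<close> on is alive. For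
    the items settled after \<open>s\<close> this works because
    \<open>w + b = x \<le> s / r e\<close>.\<close>
  have nbw: "r e * nb t e \<le> bid \<gamma> s e" if e: "e \<in> set D" "\<not> old e" and t: "t \<le> w" for e t
    unfolding nb_def
  proof (rule bid_shift[OF _ new(1)[OF e] ah d_def])
    assume p: "0 < \<gamma> * min t (a e) - d e"
    show "min t (a e) + h e \<le> s / r e"
    proof (cases "atm e")
      case True then show ?thesis using atx[OF e(1) True] t ah[of e] by (auto simp: max_def split: if_splits)
    next
      case False
      then have "after e" using cls e by blast
      then show ?thesis using sr(1)[OF e(1)] t h0(2)[of e] by (auto simp: w_def)
    qed
  qed (use g in auto)
  have nbq: "nb t e \<le> gain \<gamma> e / r e" if e: "e \<in> set D" "\<not> old e" for e t
  proof -
    have "\<gamma> * min t (a e) \<le> \<gamma> * a e" using g by simp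
    then show ?thesis using ga[of e] new(4)[OF e] by (auto simp: nb_def)
  qed
  have nb0: "0 \<le> nb t e" for t e by (simp add: nb_def)
  have shN: "share \<gamma> t (N c l t' e) = (if l \<or> t \<le> t' then wt e * r e * c * nb t e else 0)" for t c l t' e
    by (simp add: share_def N_def alive_def bid_def nb_def)
  define G where "G t e = (if old e then share \<gamma> t e else 0) +
     (if after e then share \<gamma> t (N 1 (fin e) (si e / r e - b) e) else 0) +
     (if atm e then share \<gamma> t (N (if low e then \<theta> else 1) False w e) else 0) +
     (if low e then share \<gamma> t (N (1 - \<theta>) True 0 e) else 0)" for t e
  have loadG: "load \<gamma> D' t = (\<Sum>e\<leftarrow>D. G t e)" for t
    by (simp add: load_def D'_def G_def o_def sum_list_map_filter' sum_list_addf)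
  have G1: "G t e \<le> wt e * (r e * nb t e)" if e: "e \<in> set D" "\<not> old e" for e t
  proof -
    note p = mult_nonneg_nonneg[OF new(9)[OF e] nb0[of t e]]
    have "atm e \<Longrightarrow> \<not> after e" "low e \<Longrightarrow> atm e" by (auto simp: atm_def after_def low_def)
    then have "G t e \<le> wt e * r e * nb t e * (if low e then \<theta> + (1 - \<theta>) else 1)"
      using e p th(1,2) unfolding G_def shN
      by (auto simp: algebra_simps mult_left_le intro: mult_nonneg_nonneg)
    then show ?thesis by (simp add: mult.assoc split: if_splits)
  qed
  have Gs: "G t e \<le> share \<gamma> t' e"
    if e: "e \<in> set D" and t: "t \<le> s \<and> t' = t \<or> s < t \<and> t \<le> w \<and> t' = s" for e t t'
  proof (cases "old e")
    case True
    then have "G t e = share \<gamma> t e" by (auto simp: G_def old_def after_def atm_def low_def)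
    moreover have "share \<gamma> t e = 0" if "s < t" using True that by (simp add: old_def share_def alive_def)
    ultimately show ?thesis using t share_nonneg[OF ok[OF e], of \<gamma> t'] by (cases "t \<le> s") auto
  next
    case False
    then have "alive t' e" using t by (auto simp: old_def alive_def)
    moreover have "r e * nb t e \<le> bid \<gamma> t' e" using nbs[OF e False] nbw[OF e False] t by auto
    then have "wt e * (r e * nb t e) \<le> wt e * bid \<gamma> t' e" using ok[OF e]
      by (intro mult_left_mono) (auto simp: item_ok_def)
    ultimately show ?thesis using G1[OF e False, of t] by (simp add: share_def)
  qed
  have load1: "load \<gamma> D' t \<le> C" if "t \<le> w" for t
  proof -
    have "\<exists>t'. load \<gamma> D' t \<le> load \<gamma> D t'"
    proof (cases "t \<le> s")
      case True then show ?thesis unfolding loadG unfolding load_def using Gs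
        by (intro exI[of _ t] sum_list_mono) auto
    next
      case False then show ?thesis unfolding loadG unfolding load_def using Gs that
        by (intro exI[of _ s] sum_list_mono) auto
    qed
    then show ?thesis using admissibleD(2)[OF adm] by (meson order_trans)
  qed
  have load2: "load \<gamma> D' t \<le> C" if t: "w < t" for t
  proof -
    define A where "A e = (if after e then share \<gamma> t (N 1 (fin e) (si e / r e - b) e) else 0)" for e
    have A0: "A e = (if after e \<and> (fin e \<or> t \<le> si e / r e - b) then wt e * (r e * nb t e) else 0)" for e
      by (simp add: A_def shN mult.assoc)
    have GA: "G t e \<le> A e + (1 - \<theta>) * (if low e then wt e * r e * q else 0)" if e: "e \<in> set D" for e
    proof -
      have "\<not> t \<le> w" using t by simp
      moreover have "old e \<Longrightarrow> share \<gamma> t e = 0" using t ws by (auto simp: old_def share_def alive_def)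
      moreover have "wt e * r e * (1 - \<theta>) * nb t e \<le> (1 - \<theta>) * (wt e * r e * q)" if "low e"
      proof -
        have "\<not> old e" using that nold by (auto simp: low_def)
        then have "nb t e \<le> q" using nbq[OF e] new(3)[OF e] by (meson order_trans)
        then have "wt e * r e * (1 - \<theta>) * nb t e \<le> wt e * r e * (1 - \<theta>) * q"
          using new(9)[OF e \<open>\<not> old e\<close>] th by (intro mult_left_mono) auto
        then show ?thesis by (simp add: algebra_simps)
      qed
      ultimately show ?thesis by (auto simp: G_def A_def shN)
    qed
    have "(\<Sum>e\<leftarrow>D. G t e) \<le> (\<Sum>e\<leftarrow>D. A e + (1 - \<theta>) * (if low e then wt e * r e * q else 0))"
      using GA by (rule sum_list_mono)
    also have "\<dots> = (\<Sum>e\<leftarrow>D. A e) + (1 - \<theta>) * M"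
      by (simp add: sum_list_addf sum_list_const_mult M_def)
    finally have L: "load \<gamma> D' t \<le> (\<Sum>e\<leftarrow>D. A e) + (1 - \<theta>) * M" by (simp add: loadG)
    show ?thesis
    proof (cases "M \<le> Z")
      case True
      then have "\<theta> = 1" by (simp add: \<theta>_def)
      \<comment> \<open>No low item has become final, so after \<open>w\<close> only the items
        settled after \<open>s\<close> bid, and they are dominated by the scaled originals at time
        \<open>t + b\<close>.\<close>
      define S where "S = {e \<in> set D. after e \<and> (fin e \<or> t \<le> si e / r e - b)}"
      have "0 < t + b" using t ws s0 b0 by linarith
      moreover have "alive ((t + b) * r e) e" if "e \<in> S" for e
        using that new(1)[OF _ nold, of e] by (auto simp: S_def alive_def field_simps)
      moreover have "r e \<le> r e'" if "e \<in> S" "e' \<in> S" "earlier e' e" for e e'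
        using that mono[of e e'] by (auto simp: S_def after_def earlier_def)
      moreover have "finite S" by (simp add: S_def)
      ultimately obtain t' where t': "\<And>e. e \<in> S \<Longrightarrow> (t + b) * r e \<le> t' \<and> alive t' e"
        using common_time[of "t + b" S r] by metis
      have "A e \<le> share \<gamma> t' e" if e: "e \<in> set D" for e
      proof (cases "e \<in> S")
        case S: True
        then have no: "\<not> old e" using nold by (auto simp: S_def)
        have "r e * nb t e \<le> bid \<gamma> t' e"
          unfolding nb_def
        proof (rule bid_shift[OF _ new(1)[OF e no] ah d_def])
          have "t + b \<le> t' / r e" using t'[OF S] new(1)[OF e no] by (simp add: field_simps)
          then show "min t (a e) + h e \<le> t' / r e" using h0(2)[of e] by linarith
        qed (use g in auto)
        then have "wt e * (r e * nb t e) \<le> wt e * bid \<gamma> t' e" using ok[OF e]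
          by (intro mult_left_mono) (auto simp: item_ok_def)
        then show ?thesis using S t'[OF S] by (auto simp: A0 S_def share_def)
      next
        case False
        then have "A e = 0" using e by (auto simp: A0 S_def)
        then show ?thesis using share_nonneg[OF ok[OF e]] by simp
      qed
      then have "(\<Sum>e\<leftarrow>D. A e) \<le> load \<gamma> D t'" unfolding load_def by (rule sum_list_mono)
      then show ?thesis using L admissibleD(2)[OF adm, of t'] \<open>\<theta> = 1\<close> by simp
    next
      case False
      \<comment> \<open>At \<open>s\<close> the low items contribute exactly \<open>M\<close> to the
        load. After \<open>w\<close> this room is taken by the additional bids \<open>Z\<close> of
        the later items and by the final copies with at most \<open>(1 - \<theta>) * M\<close>, and
        these sum to \<open>M\<close>.\<close>
      then have MZ: "\<theta> * M = Z" using Z0 by (simp add: \<theta>_def)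
      have "A e \<le> (share \<gamma> s e - (if low e then wt e * r e * q else 0)) +
        (if after e then wt e * r e * z e else 0)"
        if e: "e \<in> set D" for e
      proof (cases "after e")
        case True
        note no = nold[OF disjI1[OF True]]
        have "\<not> low e" using True by (auto simp: low_def atm_def after_def)
        have "A e \<le> wt e * (r e * (gain \<gamma> e / r e))"
        proof -
          have 1: "r e * nb t e \<le> r e * (gain \<gamma> e / r e)"
            using nbq[OF e no, of t] new(1)[OF e no] by (intro mult_left_mono) auto
          have "wt e * (r e * nb t e) \<le> wt e * (r e * (gain \<gamma> e / r e))"
            by (rule mult_left_mono[OF 1]) (use ok[OF e] in \<open>auto simp: item_ok_def\<close>)
          moreover have "0 \<le> wt e * (r e * nb t e)"
            using new(9)[OF e no] nb0[of t e] by (simp add: mult_nonneg_nonneg flip: mult.assoc)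
          ultimately show ?thesis unfolding A0 by (smt (verit))
        qed
        also have "\<dots> = wt e * (r e * u e) + wt e * r e * z e" by (simp add: z_def algebra_simps)
        also have "r e * u e \<le> bid \<gamma> s e"
        proof -
          have "r e * max (\<gamma> * min x (al e / r e) - de e / r e) 0 \<le> r e * bid \<gamma> (s / r e) (scale (r e) e)"
            using sr(1)[OF e True] g new(1)[OF e no] unfolding bid_def
            by (intro mult_left_mono max.mono diff_mono min.mono) auto
          then show ?thesis using bid_scale[OF new(1)[OF e no], of \<gamma> "s / r e"] new(1)[OF e no]
            by (simp add: u_def)
        qed
        finally have "A e \<le> wt e * bid \<gamma> s e + wt e * r e * z e"
          using ok[OF e] by (simp add: item_ok_def mult_left_mono)
        moreover have "alive s e" using True by (auto simp: alive_def after_def)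
        ultimately show ?thesis using True \<open>\<not> low e\<close> by (simp add: share_def)
      next
        case F: False
        have "(if low e then wt e * r e * q else 0) \<le> share \<gamma> s e"
        proof (cases "low e")
          case True
          then have at': "atm e" by (simp add: low_def)
          have "gain \<gamma> e = q * r e" using at[OF e] True by (auto simp: low_def atm_def)
          moreover have "bid \<gamma> s e = max (gain \<gamma> e) 0"
            using ok[OF e] at' by (simp add: bid_def gain_def atm_def item_ok_def min_absorb2)
          ultimately have "bid \<gamma> s e = q * r e" using pos[OF e] by simp
          then show ?thesis using at' \<open>low e\<close> by (simp add: share_def alive_def atm_def)
        qed (use share_nonneg[OF ok[OF e]] in simp)
        then show ?thesis using F by (simp add: A0)
      qed
      then have "(\<Sum>e\<leftarrow>D. A e) \<le> (\<Sum>e\<leftarrow>D. (share \<gamma> s e - (if low e then wt e * r e * q else 0)) +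
        (if after e then wt e * r e * z e else 0))"
        by (rule sum_list_mono)
      also have "\<dots> = load \<gamma> D s - M + Z"
        by (simp add: sum_list_addf sum_list_subtractf load_def M_def Z_def)
      finally show ?thesis using L MZ admissibleD(2)[OF adm, of s] by (simp add: algebra_simps)
    qed
  qed
  have valN: "val \<kappa> \<Gamma> (N c l t e) - c * val \<kappa> \<Gamma> e =
      wt e * r e * c * ((\<gamma> * \<Gamma> - \<kappa>) * h e - (\<kappa> - 1) * ((if l then 0 else max (q - d e) 0) - be e / r e))"
    if e: "e \<in> set D" "\<not> old e" for c l t e
  proof -
    define A B E where "A = al e / r e" and "B = be e / r e" and "E = de e / r e"
    have "al e = A * r e" "be e = B * r e" "de e = E * r e"
      using new(1)[OF e] by (simp_all add: A_def B_def E_def)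
    then have v: "val \<kappa> \<Gamma> e = wt e * r e * (\<kappa> * A - (\<kappa> - 1) * B - \<Gamma> * E)"
      by (simp add: val_def algebra_simps)
    show ?thesis unfolding v
      unfolding val_def N_def a_def d_def A_def[symmetric] B_def[symmetric] E_def[symmetric]
      by (simp add: algebra_simps)
  qed
  have Yh: "(\<kappa> - 1) * (\<gamma> * h e) \<le> (\<gamma> * \<Gamma> - \<kappa>) * h e" for e
    using mult_right_mono[OF kG(2) h0(1)[of e]] by (simp add: algebra_simps)
  have bede: "q \<le> be e / r e + de e / r e" if e: "e \<in> set D" "\<not> old e" "\<not> fin e" "\<not> low e" for e
  proof -
    have "q * r e \<le> reach e" using aft[OF e(1)] e cls[of e] by (auto simp: low_def after_def)
    then have "q \<le> reach e / r e" using new(1)[OF e(1,2)] by (simp add: field_simps)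
    then show ?thesis by (simp add: reach_def add_divide_distrib)
  qed
  have after_val: "val \<kappa> \<Gamma> e + (\<kappa> - 1) * (1 - \<rho>) * (wt e * r e * z e) \<le>
    val \<kappa> \<Gamma> (N 1 (fin e) (si e / r e - b) e)"
    if e: "e \<in> set D" "after e" for e
  proof -
    have no: "\<not> old e" using nold e by blast
    define be' where "be' = (if fin e then 0 else max (q - d e) 0)"
    have "\<not> low e" using e(2) by (auto simp: low_def atm_def after_def)
    have B: "be' - be e / r e \<le> max (q - d e) 0 - max (q - de e / r e) 0 \<or> be' - be e / r e \<le> 0"
      using bede[OF e(1) no _ \<open>\<not> low e\<close>] new(7)[OF e(1) no] by (auto simp: be'_def)
    \<comment> \<open>The surplus that is left to pay for the low items. Up to \<open>x\<close>
      there is no \<open>z\<close> to account for; beyond \<open>x\<close> the full shift applies,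
      and \<open>\<gamma> * x \<ge> 2 * q\<close> makes \<open>\<gamma> * b\<close> at least
      \<open>(1 - \<rho>) * q\<close>.\<close>
    have key: "(1 - \<rho>) * z e \<le> \<gamma> * h e - (be' - be e / r e)"
    proof (cases "x < al e / r e")
      case False
      then have "u e = max (gain \<gamma> e / r e) 0" by (simp add: u_def gain_def diff_divide_distrib min_absorb2)
      then have "z e = 0" using new(4)[OF e(1) no] by (simp add: z_def)
      moreover have "0 \<le> \<gamma> * h e" using g h0 by simp
      moreover have "be' - be e / r e \<le> \<gamma> * h e" using B \<open>0 \<le> \<gamma> * h e\<close> unfolding d_def
        by (auto simp: max_def split: if_splits)
      ultimately show ?thesis by simp
    next
      case True
      have hb: "h e = b" using True b0 by (simp add: h_def w_def)
      have zq: "z e \<le> q" using new(3)[OF e(1) no] u0[of e] by (simp add: z_def)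
      have zd: "z e \<le> de e / r e - q"
      proof -
        have "z e \<le> gain \<gamma> e / r e - (\<gamma> * x - de e / r e)" using True by (simp add: z_def u_def)
        then have 1: "z e \<le> q - \<gamma> * x + de e / r e" using new(3)[OF e(1) no] by linarith
        then show ?thesis using gx by linarith
      qed
      have zz: "(1 - \<rho>) * z e \<le> z e" "(1 - \<rho>) * z e \<le> (1 - \<rho>) * q"
        using z0[OF e] rho zq by (auto simp: mult_left_le_one_le intro!: mult_left_mono)
      have gb: "(1 - \<rho>) * q \<le> \<gamma> * b"
      proof -
        have "\<gamma> * b = (\<gamma> * x - q) * (1 - \<rho>)" unfolding b_def vg[symmetric] by (simp add: algebra_simps)
        moreover have "q * (1 - \<rho>) \<le> (\<gamma> * x - q) * (1 - \<rho>)" using gx rho by (intro mult_right_mono) auto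
        ultimately show ?thesis by (simp add: mult.commute)
      qed
      have "be' - be e / r e \<le> max (q - d e) 0" using new(7)[OF e(1) no] by (auto simp: be'_def)
      moreover have "d e = de e / r e - \<gamma> * b" by (simp add: d_def hb)
      ultimately show ?thesis using zz gb zd hb by (auto simp: max_def split: if_splits)
    qed
    have "(\<kappa> - 1) * ((1 - \<rho>) * z e) \<le> (\<kappa> - 1) * (\<gamma> * h e - (be' - be e / r e))"
      using key kG by (intro mult_left_mono) auto
    also have "\<dots> \<le> (\<gamma> * \<Gamma> - \<kappa>) * h e - (\<kappa> - 1) * (be' - be e / r e)" using Yh[of e]
      by (simp add: algebra_simps)
    finally have "wt e * r e * ((\<kappa> - 1) * ((1 - \<rho>) * z e)) \<le>
      wt e * r e * ((\<gamma> * \<Gamma> - \<kappa>) * h e - (\<kappa> - 1) * (be' - be e / r e))"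
      using new(9)[OF e(1) no] by (rule mult_left_mono)
    then show ?thesis using valN[OF e(1) no, of 1 "fin e" "si e / r e - b"]
      by (simp add: be'_def algebra_simps)
  qed
  have at_val: "val \<kappa> \<Gamma> e \<le> val \<kappa> \<Gamma> (N 1 False w e)" if e: "e \<in> set D" "atm e" "\<not> low e" for e
  proof -
    have no: "\<not> old e" using nold e by blast
    have "\<not> fin e" using e by (simp add: atm_def)
    have "0 \<le> \<gamma> * h e" using g h0(1)[of e] by simp
    then have "max (q - d e) 0 - be e / r e \<le> \<gamma> * h e"
      using bede[OF e(1) no \<open>\<not> fin e\<close> e(3)] new(7)[OF e(1) no] unfolding d_def by linarith
    then have "(\<kappa> - 1) * (max (q - d e) 0 - be e / r e) \<le> (\<kappa> - 1) * (\<gamma> * h e)" using kG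
      by (intro mult_left_mono) auto
    then have "0 \<le> (\<gamma> * \<Gamma> - \<kappa>) * h e - (\<kappa> - 1) * (max (q - d e) 0 - be e / r e)" using Yh[of e] by linarith
    then have "0 \<le> wt e * r e * ((\<gamma> * \<Gamma> - \<kappa>) * h e - (\<kappa> - 1) * (max (q - d e) 0 - be e / r e))"
      by (rule mult_nonneg_nonneg[OF new(9)[OF e(1) no]])
    then show ?thesis using valN[OF e(1) no, of 1 False w] by simp
  qed
  have low_val: "val \<kappa> \<Gamma> e - \<theta> * ((\<kappa> - 1) * (1 - \<rho>) * (wt e * r e * q)) \<le> val \<kappa> \<Gamma> (N \<theta> False w e) +
    val \<kappa> \<Gamma> (N (1 - \<theta>) True 0 e)"
    if e: "e \<in> set D" "low e" for e
  proof -
    have no: "\<not> old e" using nold e by (auto simp: low_def)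
    note r = new(1,2)[OF e(1) no]
    have "q * \<rho> \<le> reach e" using at[OF e(1)] e(2) by (auto simp: low_def atm_def)
    also have "\<dots> \<le> reach e / r e"
      using r ok[OF e(1)] by (auto simp: reach_def item_ok_def le_divide_eq intro!: mult_left_le)
    finally have R: "q * \<rho> \<le> be e / r e + de e / r e" by (simp add: reach_def add_divide_distrib)
    have B0: "0 \<le> be e / r e" by (rule new(7)[OF e(1) no])
    have gh: "0 \<le> \<gamma> * h e" using g h0 by simp
    \<comment> \<open>As the reach is at least \<open>q * \<rho>\<close>, raising
      \<open>\<beta>\<close> costs at most \<open>(1 - \<rho>) * q\<close> beyond the amount
      \<open>\<gamma> * h e\<close> that the shift covers. The final part of the mass costs
      nothing.\<close>
    have key: "- (\<theta> * ((1 - \<rho>) * q)) \<le> \<gamma> * h e - \<theta> * max (q - d e) 0 + be e / r e"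
    proof (cases "0 \<le> q - d e")
      case True
      have "\<theta> * (\<gamma> * h e) \<le> \<gamma> * h e" "\<theta> * (be e / r e) \<le> be e / r e"
        using mult_right_mono[OF th(2) gh] mult_right_mono[OF th(2) B0] by simp_all
      moreover have "\<theta> * (q * \<rho> - be e / r e - de e / r e) \<le> 0" using R th by (intro mult_nonneg_nonpos) auto
      ultimately show ?thesis using True by (simp add: d_def algebra_simps)
    next
      case False
      have "0 \<le> \<theta> * ((1 - \<rho>) * q)" using th rho q by simp
      then show ?thesis using False gh B0 by simp
    qed
    have "- (\<theta> * ((\<kappa> - 1) * (1 - \<rho>) * q)) = (\<kappa> - 1) * (- (\<theta> * ((1 - \<rho>) * q)))" by (simp add: algebra_simps)
    also have "\<dots> \<le> (\<kappa> - 1) * (\<gamma> * h e - \<theta> * max (q - d e) 0 + be e / r e)"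
      using key kG by (intro mult_left_mono) auto
    also have "\<dots> \<le> (\<gamma> * \<Gamma> - \<kappa>) * h e - (\<kappa> - 1) * (\<theta> * max (q - d e) 0 - be e / r e)" using Yh[of e]
      by (simp add: algebra_simps)
    finally have "wt e * r e * (- (\<theta> * ((\<kappa> - 1) * (1 - \<rho>) * q))) \<le>
      wt e * r e * ((\<gamma> * \<Gamma> - \<kappa>) * h e - (\<kappa> - 1) * (\<theta> * max (q - d e) 0 - be e / r e))"
      using new(9)[OF e(1) no] by (rule mult_left_mono)
    then show ?thesis
      using valN[OF e(1) no, of \<theta> False w] valN[OF e(1) no, of "1 - \<theta>" True 0] by (simp add: algebra_simps)
  qed
  have worth: "worth \<kappa> \<Gamma> D \<le> worth \<kappa> \<Gamma> D'"
  proof -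
    define H where "H e = (if old e then val \<kappa> \<Gamma> e else 0) +
      (if after e then val \<kappa> \<Gamma> (N 1 (fin e) (si e / r e - b) e) else 0) +
      (if atm e then val \<kappa> \<Gamma> (N (if low e then \<theta> else 1) False w e) else 0) +
      (if low e then val \<kappa> \<Gamma> (N (1 - \<theta>) True 0 e) else 0)" for e
    have "val \<kappa> \<Gamma> e +
      (\<kappa> - 1) * (1 - \<rho>) * ((if after e then wt e * r e * z e else 0) - \<theta> * (if low e then wt e * r e * q else 0)) \<le> H e"
      if e: "e \<in> set D" for e
    proof -
      consider "old e" | "after e" | "atm e" "\<not> low e" | "low e" using cls by blast
      then show ?thesis
      proof cases
        case 1 then show ?thesis by (auto simp: H_def old_def after_def atm_def low_def)
      next
        case 2
        then have "\<not> old e" "\<not> atm e" "\<not> low e" by (auto simp: old_def after_def atm_def low_def)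
        then show ?thesis using after_val[OF e 2] 2 by (simp add: H_def)
      next
        case 3
        then have "\<not> old e" "\<not> after e" by (auto simp: old_def after_def atm_def low_def)
        then show ?thesis using at_val[OF e 3] 3 by (simp add: H_def)
      next
        case 4
        then have "\<not> old e" "\<not> after e" "atm e" by (auto simp: old_def after_def atm_def low_def)
        then show ?thesis using low_val[OF e 4] 4 by (simp add: H_def algebra_simps)
      qed
    qed
    then have "(\<Sum>e\<leftarrow>D. val \<kappa> \<Gamma> e +
      (\<kappa> - 1) * (1 - \<rho>) * ((if after e then wt e * r e * z e else 0) - \<theta> * (if low e then wt e * r e * q else 0))) \<le> (\<Sum>e\<leftarrow>D. H e)"
      by (rule sum_list_mono)
    then have "worth \<kappa> \<Gamma> D + (\<kappa> - 1) * (1 - \<rho>) * (Z - \<theta> * M) \<le> (\<Sum>e\<leftarrow>D. H e)"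
      by (simp add: sum_list_addf sum_list_subtractf sum_list_const_mult worth_def M_def Z_def)
    moreover have "(\<Sum>e\<leftarrow>D. H e) = worth \<kappa> \<Gamma> D'"
      by (simp add: worth_def D'_def H_def o_def sum_list_map_filter' sum_list_addf)
    moreover have "0 \<le> (\<kappa> - 1) * (1 - \<rho>) * (Z - \<theta> * M)" using kG rho th by (intro mult_nonneg_nonneg) auto
    ultimately show ?thesis by linarith
  qed
  have okN: "item_ok (N c l t e)" if "e \<in> set D" "\<not> old e" "0 \<le> c" "\<not> l \<longrightarrow> \<not> fin e \<and> a e \<le> t" for c l t e
    using d0[OF that(1,2)] da[OF that(1,2)] bea[OF that(1,2)] a0[OF that(1,2)] new(9)[OF that(1,2)] that(3,4)
    by (auto simp: item_ok_def N_def)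
  have clsN: "0 < gain \<gamma> (N c l t e) \<and> gain \<gamma> (N c l t e) \<le> q \<and> (\<not> fin (N c l t e) \<longrightarrow> s \<le> si (N c l t e) \<and> q \<le>
    reach (N c l t e))"
    if "e \<in> set D" "\<not> old e" "\<not> l \<longrightarrow> w \<le> t" for c l t e
    using ga[of e] new(3,4)[OF that(1,2)] that(3) ws by (auto simp: gain_def N_def reach_def)
  have mem: "(e \<in> set D \<and> old e) \<or> (\<exists>e' c l t. e = N c l t e' \<and> e' \<in> set D \<and> \<not> old e' \<and> 0 \<le> c \<and>
      (\<not> l \<longrightarrow> \<not> fin e' \<and> a e' \<le> t \<and> w \<le> t))" if "e \<in> set D'" for e
  proof -
    from that consider "e \<in> set D" "old e"
      | e' where "e' \<in> set D" "after e'" "e = N 1 (fin e') (si e' / r e' - b) e'"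
      | e' where "e' \<in> set D" "atm e'" "e = N (if low e' then \<theta> else 1) False w e'"
      | e' where "e' \<in> set D" "low e'" "e = N (1 - \<theta>) True 0 e'"
      by (auto simp: D'_def)
    then show ?thesis
    proof cases
      case (2 e') then show ?thesis using aft_si[of e'] nold[of e']
        by (intro disjI2 exI[of _ e'] exI conjI) auto
    next
      case (3 e')
      then show ?thesis using atx(4)[of e'] nold[of e'] th
        by (intro disjI2 exI[of _ e'] exI[of _ "if low e' then \<theta> else 1"] exI[of _ False] exI[of _ w]) (auto simp: atm_def)
    next
      case (4 e') then show ?thesis using nold[of e'] th
        by (intro disjI2 exI[of _ e'] exI[of _ "1 - \<theta>"] exI[of _ True] exI[of _ 0]) (auto simp: low_def)
    qed auto
  qed
  have cl: "(e \<in> set D \<and> \<not> fin e \<and> si e < s) \<or>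
       (0 < gain \<gamma> e \<and> gain \<gamma> e \<le> q \<and> (\<not> fin e \<longrightarrow> s \<le> si e \<and> q \<le> reach e))" if "e \<in> set D'" for e
    using mem[OF that] clsN unfolding old_def by blast
  have adm': "admissible \<gamma> C D'"
    unfolding admissible_def
  proof (intro conjI ballI allI impI)
    fix e assume "e \<in> set D'" then show "item_ok e" using mem[of e] ok okN by blast
  next
    fix e e' assume e: "e \<in> set D'" "e' \<in> set D'" and E: "earlier e e'"
    \<comment> \<open>All new gains are at most \<open>q\<close>, and all reaches of new non-final
      items are at least \<open>q\<close>, as are those of the old items by \<open>before\<close>. A
      new item never precedes an old one, so only old pairs need the original inequality.\<close>
    show "gain \<gamma> e' \<le> reach e"
      using cl[OF e(1)] cl[OF e(2)] E admissibleD(3)[OF adm, of e e'] before[of e] unfolding earlier_def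
      by (smt (verit))
  next
    fix t show "load \<gamma> D' t \<le> C" using load1[of t] load2[of t] by linarith
  qed
  have "\<exists>e\<in>set D'. fin e" if "e \<in> set D" "fin e" for e
    using that by (intro bexI[of _ "N 1 (fin e) (si e / r e - b) e"]) (auto simp: D'_def after_def N_def)
  then show ?thesis using adm' worth cl by blast
qed

text \<open>Two items settled at the same time need not satisfy the triangle inequality against each
  other. Only conflicts with the additional bound on the reach prevent a direct application of
  \<open>balance\<close>.\<close>

definition conflict :: "real \<Rightarrow> item list \<Rightarrow> real \<Rightarrow> bool" where
  "conflict \<gamma> D s \<longleftrightarrow> (\<exists>e\<in>set D. \<exists>e'\<in>set D. \<not> fin e \<and> \<not> fin e' \<and> si e = s \<and> si e' = s \<and>
     reach e < gain \<gamma> e' \<and> 2 * reach e \<le> \<gamma> * s)"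

lemma finite_conflict: "finite {s. conflict \<gamma> D s}"
  by (rule finite_subset[of _ "si ` set D"]) (auto simp: conflict_def)

lemma gain_le_si:
  assumes "0 < \<gamma>" "item_ok e" "\<not> fin e" shows "gain \<gamma> e \<le> \<gamma> * si e"
proof -
  have "\<gamma> * al e \<le> \<gamma> * si e" using assms by (auto simp: item_ok_def)
  moreover have "0 \<le> de e" using assms by (simp add: item_ok_def)
  ultimately show ?thesis unfolding gain_def by linarith
qed

text \<open>The last conflict is removed first, which creates no new one.\<close>

lemma remove_conflict:
  assumes g: "0 < \<gamma>" "\<gamma> \<le> 1" and adm: "admissible \<gamma> C D"
    and kG: "1 \<le> \<kappa>" "\<gamma> * (\<kappa> - 1) \<le> \<gamma> * \<Gamma> - \<kappa>"
    and pos: "\<And>e. e \<in> set D \<Longrightarrow> 0 < gain \<gamma> e" and fn: "\<exists>e\<in>set D. fin e"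
    and c: "conflict \<gamma> D s" and last: "\<And>s'. conflict \<gamma> D s' \<Longrightarrow> s' \<le> s"
  shows "\<exists>D'. admissible \<gamma> C D' \<and> worth \<kappa> \<Gamma> D \<le> worth \<kappa> \<Gamma> D' \<and> (\<forall>e\<in>set D'. 0 < gain \<gamma> e) \<and>
    (\<exists>e\<in>set D'. fin e) \<and> (\<forall>s'. conflict \<gamma> D' s' \<longrightarrow> conflict \<gamma> D s' \<and> s' \<noteq> s)"
proof -
  define N where "N = {e \<in> set D. \<not> fin e \<and> si e = s}"
  define P where "P = Min (reach ` N)"
  define q where "q = Max (gain \<gamma> ` N)"
  define E where "E e = {e' \<in> set D. \<not> fin e' \<and> (fin e \<or> si e' \<le> si e)}" for e :: item
  define PP where "PP e = Min (reach ` E e)" for e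
  \<comment> \<open>At \<open>s\<close> the factor makes the gain equal to \<open>q\<close>, except
    that it must not fall below \<open>\<rho> = P / q\<close>. An item whose reach is below
    \<open>q * r e\<close> therefore belongs to the first kind, since its reach is at least
    \<open>P\<close>.\<close>
  define r where "r e = (if \<not> fin e \<and> si e = s then max (gain \<gamma> e) P else PP e) / q" for e :: item
  define \<rho> where "\<rho> = P / q"
  note ok = admissibleD(1)[OF adm] and ord = admissibleD(3)[OF adm]
  obtain f where f: "f \<in> set D" "fin f" using fn by blast
  have reach0: "0 < reach e" if "e \<in> set D" "\<not> fin e" for e
    using ord[of e f] that f pos[of f] by (auto simp: earlier_def)
  obtain c1 c2 where c12: "c1 \<in> N" "c2 \<in> N" "reach c1 < gain \<gamma> c2" "2 * reach c1 \<le> \<gamma> * s"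
    using c by (auto simp: conflict_def N_def)
  have fN: "finite N" "N \<noteq> {}" using c12 by (auto simp: N_def)
  obtain eP where eP: "eP \<in> N" "P = reach eP" using Min_in[of "reach ` N"] fN unfolding P_def[symmetric]
    by blast
  obtain eq where eq: "eq \<in> N" "q = gain \<gamma> eq" using Max_in[of "gain \<gamma> ` N"] fN unfolding q_def[symmetric]
    by blast
  have Pl: "P \<le> reach e" "gain \<gamma> e \<le> q" if "e \<in> N" for e
    using that fN by (auto simp: P_def q_def)
  have P0: "0 < P" using eP reach0 by (auto simp: N_def)
  have Pq: "P < q" using Pl(1)[OF c12(1)] Pl(2)[OF c12(2)] c12(3) by linarith
  have Ps: "2 * P \<le> \<gamma> * s" using Pl(1)[OF c12(1)] c12(4) by linarith
  have q0: "0 < q" using P0 Pq by linarith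
  have qs: "q \<le> \<gamma> * s" using gain_le_si[OF g(1) ok, of eq] eq by (auto simp: N_def)
  have fE: "finite (E e)" for e by (simp add: E_def)
  have after: "0 < PP e" "PP e \<le> P" "gain \<gamma> e \<le> PP e" "\<not> fin e \<Longrightarrow> PP e \<le> reach e"
    if e: "e \<in> set D" "fin e \<or> s < si e" for e
  proof -
    have eE: "eP \<in> E e" using eP e by (auto simp: E_def N_def)
    show "PP e \<le> P" unfolding PP_def eP(2) using fE eE by (intro Min_le) auto
    have "0 < x" if "x \<in> reach ` E e" for x using that reach0 by (auto simp: E_def)
    then show "0 < PP e" unfolding PP_def using fE eE by (subst Min_gr_iff) auto
    have "gain \<gamma> e \<le> reach e'" if e': "e' \<in> E e" for e'
    proof (cases "earlier e' e")
      case True then show ?thesis using ord e e' by (auto simp: E_def)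
    next
      case False
      then have t: "\<not> fin e" "si e' = si e" "\<not> fin e'" using e' by (auto simp: E_def earlier_def)
      show ?thesis
      proof (rule ccontr)
        assume n: "\<not> ?thesis"
        \<comment> \<open>A violated tie here would be a conflict later than \<open>s\<close>: the
          gain is at most \<open>P\<close>, so the reach is below \<open>P\<close>, while
          \<open>2 * P \<le> \<gamma> * s\<close>.\<close>
        have "earlier eP e" using eP e t by (auto simp: earlier_def N_def)
        then have "gain \<gamma> e \<le> P" using ord eP e by (auto simp: N_def)
        moreover have "\<gamma> * s \<le> \<gamma> * si e" using e t g by auto
        ultimately have "conflict \<gamma> D (si e)"
          unfolding conflict_def using n t e e' Ps by (intro bexI[of _ e'] bexI[of _ e]) (auto simp: E_def)
        then show False using last e t by force
      qed
    qed
    then show "gain \<gamma> e \<le> PP e" unfolding PP_def using fE eE by (subst Min_ge_iff) auto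
    show "\<not> fin e \<Longrightarrow> PP e \<le> reach e" unfolding PP_def using fE e by (intro Min_le) (auto simp: E_def)
  qed
  have "\<exists>D'. admissible \<gamma> C D' \<and> worth \<kappa> \<Gamma> D \<le> worth \<kappa> \<Gamma> D' \<and>
    (\<forall>e\<in>set D'. (e \<in> set D \<and> \<not> fin e \<and> si e < s) \<or>
       (0 < gain \<gamma> e \<and> gain \<gamma> e \<le> q \<and> (\<not> fin e \<longrightarrow> s \<le> si e \<and> q \<le> reach e))) \<and>
    ((\<exists>e\<in>set D. fin e) \<longrightarrow> (\<exists>e\<in>set D'. fin e))"
  proof (rule close_gap[where \<rho> = \<rho> and r = r, OF g adm kG pos])
    show "0 < \<rho>" "\<rho> < 1" "0 < q" "q \<le> \<gamma> * s" using P0 Pq q0 qs by (auto simp: \<rho>_def)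
    show "2 * q * \<rho> \<le> \<gamma> * s" using Ps q0 by (simp add: \<rho>_def)
    show "q \<le> reach e" if "e \<in> set D" "\<not> fin e" "si e < s" for e
      using ord[of e eq] that eq by (auto simp: earlier_def N_def)
    show "0 < r e \<and> r e \<le> 1 \<and> gain \<gamma> e \<le> q * r e" if e: "e \<in> set D" "fin e \<or> s \<le> si e" for e
    proof (cases "\<not> fin e \<and> si e = s")
      case True
      then have "e \<in> N" using e by (simp add: N_def)
      then show ?thesis using True Pl[of e] P0 Pq q0 by (auto simp: r_def max_def)
    next
      case False
      then show ?thesis using after[of e] e q0 Pq by (auto simp: r_def)
    qed
    show "r e \<le> \<rho> \<and> (\<not> fin e \<longrightarrow> q * r e \<le> reach e)" if e: "e \<in> set D" "fin e \<or> s < si e" for e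
      using after[OF e] e q0 by (auto simp: r_def \<rho>_def divide_right_mono)
    show "\<rho> \<le> r e \<and> q * \<rho> \<le> reach e \<and> (reach e < q * r e \<longrightarrow> gain \<gamma> e = q * r e)"
      if e: "e \<in> set D" "\<not> fin e" "si e = s" for e
      using Pl[of e] e q0 by (auto simp: r_def \<rho>_def N_def divide_right_mono max_def)
    show "r e \<le> r e'" if e: "e \<in> set D" "e' \<in> set D" "earlier e' e" "s < si e'" for e e'
    proof -
      have "PP e \<le> PP e'" unfolding PP_def using e fE eP
        by (intro Min_antimono image_mono) (auto simp: E_def earlier_def N_def)
      then show ?thesis using e q0 by (auto simp: r_def earlier_def divide_right_mono)
    qed
  qed
  then obtain D' where D': "admissible \<gamma> C D'" "worth \<kappa> \<Gamma> D \<le> worth \<kappa> \<Gamma> D'"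
    and cl: "\<And>e. e \<in> set D' \<Longrightarrow> (e \<in> set D \<and> \<not> fin e \<and> si e < s) \<or>
       (0 < gain \<gamma> e \<and> gain \<gamma> e \<le> q \<and> (\<not> fin e \<longrightarrow> s \<le> si e \<and> q \<le> reach e))"
    and fn': "\<exists>e\<in>set D'. fin e" using fn by blast
  have "conflict \<gamma> D s' \<and> s' \<noteq> s" if "conflict \<gamma> D' s'" for s'
  proof -
    from that obtain e e' where e: "e \<in> set D'" "e' \<in> set D'" "\<not> fin e" "\<not> fin e'" "si e = s'" "si e' = s'"
      "reach e < gain \<gamma> e'" "2 * reach e \<le> \<gamma> * s'" by (auto simp: conflict_def)
    \<comment> \<open>Two new items cannot conflict because \<open>q\<close> separates their gains
      from their reaches, and an old and a new one have different times.\<close>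
    then have "e \<in> set D" "si e < s" "e' \<in> set D" using cl[of e] cl[of e'] by auto
    then show ?thesis using e by (auto simp: conflict_def)
  qed
  then show ?thesis using D' fn' cl pos by blast
qed

lemma remove_conflicts:
  assumes g: "0 < \<gamma>" "\<gamma> \<le> 1" and kG: "1 \<le> \<kappa>" "\<gamma> * (\<kappa> - 1) \<le> \<gamma> * \<Gamma> - \<kappa>"
    and "admissible \<gamma> C D" and "\<forall>e\<in>set D. 0 < gain \<gamma> e" and "\<exists>e\<in>set D. fin e"
  shows "\<exists>D'. admissible \<gamma> C D' \<and> worth \<kappa> \<Gamma> D \<le> worth \<kappa> \<Gamma> D' \<and> (\<forall>e\<in>set D'. 0 < gain \<gamma> e) \<and>
    (\<exists>e\<in>set D'. fin e) \<and> (\<forall>s. \<not> conflict \<gamma> D' s)"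
  using assms(5-)
proof (induction "card {s. conflict \<gamma> D s}" arbitrary: D rule: less_induct)
  case less
  show ?case
  proof (cases "{s. conflict \<gamma> D s} = {}")
    case True then show ?thesis using less.prems by blast
  next
    case False
    define s where "s = Max {s. conflict \<gamma> D s}"
    have s: "conflict \<gamma> D s" "\<And>s'. conflict \<gamma> D s' \<Longrightarrow> s' \<le> s"
      using Max_in[OF finite_conflict False] Max_ge[OF finite_conflict] by (auto simp: s_def)
    obtain D' where D': "admissible \<gamma> C D'" "worth \<kappa> \<Gamma> D \<le> worth \<kappa> \<Gamma> D'" "\<forall>e\<in>set D'. 0 < gain \<gamma> e"
      "\<exists>e\<in>set D'. fin e" "\<forall>s'. conflict \<gamma> D' s' \<longrightarrow> conflict \<gamma> D s' \<and> s' \<noteq> s"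
      using remove_conflict[OF g less.prems(1) kG _ less.prems(3) s] less.prems(2) by blast
    have "card {s. conflict \<gamma> D' s} < card {s. conflict \<gamma> D s}"
      using D'(5) s(1) by (intro psubset_card_mono finite_conflict) blast
    from less.hyps[OF this D'(1,3,4)] obtain D'' where D'': "admissible \<gamma> C D''"
      "worth \<kappa> \<Gamma> D' \<le> worth \<kappa> \<Gamma> D''"
      "\<forall>e\<in>set D''. 0 < gain \<gamma> e" "\<exists>e\<in>set D''. fin e" "\<forall>s. \<not> conflict \<gamma> D'' s" by blast
    then show ?thesis using order_trans[OF D'(2) D''(2)] by blast
  qed
qed

text \<open>The factor is the smallest reach so far, \<open>PP\<close>, if no tie is violated.
  Otherwise let \<open>K\<close> be the smallest reach up to the last violated tie and
  \<open>q\<close> the largest gain from the first one on. The values of \<open>PP\<close> from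
  \<open>K\<close> to \<open>q\<close> are all replaced by \<open>q\<close>, and smaller ones are
  multiplied by \<open>q / K\<close> to keep the factors monotone. Without conflicts
  \<open>q < 2 * K\<close>, so each reach remains above half its factor, as \<open>balance\<close>
  requires.\<close>

lemma balance_tame:
  assumes g: "0 < \<gamma>" "\<gamma> \<le> 1" and adm: "admissible \<gamma> C D"
    and pos: "\<forall>e\<in>set D. 0 < gain \<gamma> e" and fn: "\<exists>e\<in>set D. fin e"
    and tame: "\<forall>s. \<not> conflict \<gamma> D s"
  shows "\<exists>D'. admissible \<gamma> C D' \<and> balanced \<gamma> D' \<and> worth \<kappa> \<Gamma> D' = worth \<kappa> \<Gamma> D"
proof -
  define MG where "MG = Max (gain \<gamma> ` set D)"
  define E where "E e = {e' \<in> set D. \<not> fin e' \<and> (fin e \<or> si e' \<le> si e)}" for e :: item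
  define PP where "PP e = Min (insert MG (reach ` E e))" for e
  define bad where "bad s \<longleftrightarrow> (\<exists>e\<in>set D. \<exists>e'\<in>set D. \<not> fin e \<and> \<not> fin e' \<and> si e = s \<and> si e' = s \<and> reach e <
    gain \<gamma> e')" for s
  note ok = admissibleD(1)[OF adm] and ord = admissibleD(3)[OF adm]
  obtain f where f: "f \<in> set D" "fin f" using fn by blast
  have reach0: "0 < reach e" if "e \<in> set D" "\<not> fin e" for e
    using ord[of e f] that f pos by (fastforce simp: earlier_def)
  have MG: "gain \<gamma> e \<le> MG" if "e \<in> set D" for e using that by (simp add: MG_def)
  have MG0: "0 < MG" using MG[OF f(1)] pos f by force
  have fE: "finite (E e)" for e by (simp add: E_def)
  have PP0: "0 < PP e" for e unfolding PP_def using fE MG0 reach0 by (subst Min_gr_iff) (auto simp: E_def)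
  have PPr: "PP e \<le> reach e" if "e \<in> set D" "\<not> fin e" for e
    unfolding PP_def using fE that by (intro Min_le) (auto simp: E_def)
  have PPmono: "PP e \<le> PP e'" if "\<not> fin e'" "fin e \<or> si e' \<le> si e" for e e'
    unfolding PP_def using fE that by (intro Min_antimono insert_mono image_mono) (auto simp: E_def)
  have PPge: "y \<le> PP e" if "y \<le> MG" "\<And>e'. e' \<in> E e \<Longrightarrow> y \<le> reach e'" for y e
    unfolding PP_def using fE that by (subst Min_ge_iff) auto
  have good: "gain \<gamma> e \<le> PP e" if e: "e \<in> set D" "fin e \<or> \<not> bad (si e)" for e
  proof (rule PPge[OF MG[OF e(1)]])
    fix e' assume e': "e' \<in> E e"
    show "gain \<gamma> e \<le> reach e'"
    proof (cases "earlier e' e")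
      case True then show ?thesis using ord e e' by (auto simp: E_def)
    next
      case False
      then have "\<not> fin e" "si e' = si e" "\<not> fin e'" using e' by (auto simp: E_def earlier_def)
      then show ?thesis using e e' by (force simp: bad_def E_def)
    qed
  qed
  have alr: "reach e \<le> 2 * al e" if "e \<in> set D" for e using ok[OF that] by (simp add: item_ok_def reach_def)
  show ?thesis
  proof (cases "\<exists>s. bad s")
    case False
    show ?thesis
    proof (rule balance[OF g adm, where p = PP])
      show "gain \<gamma> e' / PP e' \<le> reach e / PP e" if "e \<in> set D" "e' \<in> set D" "earlier e e'" for e e'
      proof -
        have "gain \<gamma> e' / PP e' \<le> 1" using good[OF that(2)] False PP0 by simp
        also have "\<dots> \<le> reach e / PP e" using PPr[OF that(1)] that(3) PP0 by (simp add: earlier_def)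
        finally show ?thesis .
      qed
      show "PP e \<le> 2 * reach e" if "e \<in> set D" "\<not> fin e" for e
        using PPr[OF that] reach0[OF that] by linarith
      show "PP e \<le> 2 * al e \<or> PP e \<le> 2 * si e" if "e \<in> set D" "\<not> fin e" for e
        using PPr[OF that] alr[OF that(1)] by linarith
    qed (use pos PP0 PPmono good False in auto)
  next
    case True
    define B where "B = {s. bad s}"
    have fB: "finite B" unfolding B_def
      by (rule finite_subset[of _ "si ` set D"]) (auto simp: bad_def)
    have neB: "B \<noteq> {}" using True by (simp add: B_def)
    define s1 where "s1 = Min B"
    define sk where "sk = Max B"
    have s1: "bad s1" "\<And>s. bad s \<Longrightarrow> s1 \<le> s" using Min_in[OF fB neB] fB by (auto simp: s1_def B_def)
    have sk: "bad sk" "\<And>s. bad s \<Longrightarrow> s \<le> sk" using Max_in[OF fB neB] fB by (auto simp: sk_def B_def)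
    obtain a a' where a: "a \<in> set D" "a' \<in> set D" "\<not> fin a" "\<not> fin a'" "si a = s1" "si a' = s1"
      "reach a < gain \<gamma> a'"
      using s1(1) by (auto simp: bad_def)
    obtain b b' where b: "b \<in> set D" "b' \<in> set D" "\<not> fin b" "\<not> fin b'" "si b = sk" "si b' = sk"
      "reach b < gain \<gamma> b'"
      using sk(1) by (auto simp: bad_def)
    define NK where "NK = {e \<in> set D. \<not> fin e \<and> si e \<le> sk}"
    define K where "K = Min (reach ` NK)"
    define Nq where "Nq = {e \<in> set D. fin e \<or> s1 \<le> si e}"
    define q where "q = Max (gain \<gamma> ` Nq)"
    have fin: "finite NK" "finite Nq" by (auto simp: NK_def Nq_def)
    have bK: "b \<in> NK" using b by (auto simp: NK_def)
    have Kle: "K \<le> reach e" if "e \<in> NK" for e using that fin by (simp add: K_def)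
    have qge: "gain \<gamma> e \<le> q" if "e \<in> Nq" for e using that fin by (simp add: q_def)
    obtain k where k: "k \<in> NK" "K = reach k" using Min_in[of "reach ` NK"] fin bK unfolding K_def[symmetric]
      by blast
    have b'q: "b' \<in> Nq" and a'q: "a' \<in> Nq" using b a s1(2)[OF sk(1)] by (auto simp: Nq_def)
    obtain m where m: "m \<in> Nq" "q = gain \<gamma> m" using Max_in[of "gain \<gamma> ` Nq"] fin b'q
      unfolding q_def[symmetric] by blast
    have K0: "0 < K" using k reach0 by (auto simp: NK_def)
    have Kq: "K < q" using Kle[OF bK] qge[OF b'q] b by linarith
    have qs1: "q \<le> \<gamma> * s1"
    proof (cases "\<not> fin m \<and> si m = s1")
      case True then show ?thesis using gain_le_si[OF g(1) ok, of m] m by (auto simp: Nq_def)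
    next
      case False
      then have "earlier a m" using m a by (auto simp: earlier_def Nq_def)
      then have "q \<le> reach a" using ord[of a m] m a by (auto simp: Nq_def)
      also have "\<dots> < gain \<gamma> a'" using a by simp
      also have "\<dots> \<le> \<gamma> * s1" using gain_le_si[OF g(1) ok, of a'] a by auto
      finally show ?thesis by simp
    qed
    \<comment> \<open>If \<open>k\<close> is settled at the last violated tie, it loses to
      \<open>b'\<close> there, and the absence of a conflict bounds \<open>\<gamma> * sk\<close>. If
      it is settled before, the triangle inequality with \<open>b'\<close> contradicts the choice of
      \<open>b\<close>.\<close>
    have K2: "q < 2 * K"
    proof (cases "si k = sk")
      case True
      have "reach k < gain \<gamma> b'" using Kle[OF bK] k b by linarith
      then have "\<gamma> * sk < 2 * reach k" using tame True b k by (force simp: conflict_def NK_def)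
      moreover have "\<gamma> * s1 \<le> \<gamma> * sk" using s1(2)[OF sk(1)] g by simp
      ultimately show ?thesis using qs1 k by linarith
    next
      case False
      then have "earlier k b'" using k b by (auto simp: earlier_def NK_def)
      then have "gain \<gamma> b' \<le> K" using ord[of k b'] k b by (auto simp: NK_def)
      then show ?thesis using Kle[OF bK] b by linarith
    qed
    have s10: "0 < s1" using qs1 Kq K0 g by (smt (verit) mult_nonneg_nonpos)
    have qMG: "q \<le> MG" using MG m by (auto simp: Nq_def)
    define \<phi> where "\<phi> y = (if q \<le> y then y else if K \<le> y then q else q / K * y)" for y
    have phiK: "q / K * y \<le> q" if "y \<le> K" for y
    proof -
      have "q / K * y \<le> q / K * K" using that K0 Kq by (intro mult_left_mono) auto
      then show ?thesis using K0 by simp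
    qed
    have phimono: "\<phi> y \<le> \<phi> y'" if "y \<le> y'" for y y'
    proof -
      have "q / K * y \<le> q / K * y'" using that K0 Kq by (intro mult_left_mono) auto
      then show ?thesis using that phiK[of y] K0 Kq unfolding \<phi>_def by auto
    qed
    have phi0: "0 < \<phi> y" if "0 < y" for y using that K0 Kq by (simp add: \<phi>_def)
    have low: "fin e \<or> sk < si e" if "e \<in> set D" "PP e < K" for e
    proof (rule ccontr)
      assume "\<not> ?thesis"
      then have "K \<le> PP e" using Kle Kq qMG by (intro PPge) (auto simp: E_def NK_def)
      then show False using that by simp
    qed
    have lowgood: "gain \<gamma> e \<le> PP e" if "e \<in> set D" "PP e < K" for e
      using good[OF that(1)] low[OF that] sk(2)[of "si e"] by force
    have early: "q \<le> PP e" if "e \<in> set D" "\<not> fin e" "si e < s1" for e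
    proof (rule PPge[OF qMG])
      fix e' assume "e' \<in> E e"
      then show "q \<le> reach e'" using ord[of e' m] m that by (auto simp: E_def earlier_def Nq_def)
    qed
    have gp: "gain \<gamma> e \<le> \<phi> (PP e)" if e: "e \<in> set D" for e
    proof (cases "PP e < K")
      case True
      then have "PP e \<le> q / K * PP e" using K0 Kq PP0[of e] by (simp add: field_simps)
      then show ?thesis using lowgood[OF e True] True Kq by (simp add: \<phi>_def)
    next
      case F: False
      show ?thesis
      proof (cases "fin e \<or> s1 \<le> si e")
        case True
        then have "gain \<gamma> e \<le> q" using qge e by (simp add: Nq_def)
        then show ?thesis using F by (auto simp: \<phi>_def)
      next
        case False
        then have "gain \<gamma> e \<le> PP e" using good[OF e] s1(2)[of "si e"] by auto
        then show ?thesis using early[OF e] False by (simp add: \<phi>_def)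
      qed
    qed
    have rK: "K / q \<le> reach e / \<phi> (PP e)" if e: "e \<in> set D" "\<not> fin e" for e
    proof -
      have "K * \<phi> (PP e) \<le> q * reach e"
      proof -
        have y: "0 < PP e" "PP e \<le> reach e" using PP0 PPr[OF e] by auto
        consider "q \<le> PP e" | "K \<le> PP e" "PP e < q" | "PP e < K" by linarith
        then show ?thesis
        proof cases
          case 1 then show ?thesis using y Kq K0 by (auto simp: \<phi>_def intro!: mult_mono)
        next
          case 2
          then have "K * q \<le> reach e * q" using y Kq K0 by (intro mult_right_mono) auto
          then show ?thesis using 2 by (simp add: \<phi>_def mult.commute)
        next
          case 3
          then have "q * PP e \<le> q * reach e" using y Kq K0 by (intro mult_left_mono) auto
          then show ?thesis using 3 Kq K0 by (simp add: \<phi>_def)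
        qed
      qed
      then show ?thesis using phi0[OF PP0] Kq K0 by (simp add: field_simps)
    qed
    show ?thesis
    proof (rule balance[OF g adm, where p = "\<lambda>e. \<phi> (PP e)"])
      show "gain \<gamma> e' / \<phi> (PP e') \<le> reach e / \<phi> (PP e)" if e: "e \<in> set D" "e' \<in> set D" "earlier e e'" for e e'
      proof -
        have nf: "\<not> fin e" using e by (simp add: earlier_def)
        have yy: "PP e' \<le> PP e" using PPmono[of e e'] e(3) by (auto simp: earlier_def)
        \<comment> \<open>For \<open>PP e' < K\<close> the scaled gain is at most
          \<open>K / q\<close>, below every scaled reach. For \<open>q \<le> PP e\<close> the number
          1 separates gain and reach. In between, both factors are \<open>q\<close> and the original
          inequality survives.\<close>
        consider "PP e' < K" | "q \<le> PP e" | "K \<le> PP e'" "PP e < q" by linarith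
        then show ?thesis
        proof cases
          case 1
          then have "gain \<gamma> e' / \<phi> (PP e') \<le> PP e' / \<phi> (PP e')"
            using lowgood[OF e(2)] phi0[OF PP0] by (intro divide_right_mono) (auto simp: less_imp_le)
          also have "\<dots> = K / q" using 1 Kq K0 PP0[of e'] by (simp add: \<phi>_def)
          finally show ?thesis using rK[OF e(1) nf] by linarith
        next
          case 2
          have "gain \<gamma> e' / \<phi> (PP e') \<le> 1" using gp[OF e(2)] phi0[OF PP0] by simp
          also have "\<dots> \<le> reach e / \<phi> (PP e)" using 2 PPr[OF e(1) nf] PP0[of e] by (simp add: \<phi>_def)
          finally show ?thesis .
        next
          case 3
          then have "\<phi> (PP e') = q" "\<phi> (PP e) = q" using yy by (auto simp: \<phi>_def)
          then show ?thesis using ord[OF e] Kq K0 by (simp add: divide_right_mono)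
        qed
      qed
      show "\<phi> (PP e) \<le> 2 * reach e" if "e \<in> set D" "\<not> fin e" for e
      proof -
        have "1/2 < K / q" using K2 K0 Kq by (simp add: field_simps)
        then have "1/2 < reach e / \<phi> (PP e)" using rK[OF that] by linarith
        then show ?thesis using phi0[OF PP0, of e] by (simp add: field_simps)
      qed
      show "\<phi> (PP e) \<le> 2 * al e \<or> \<phi> (PP e) \<le> 2 * si e" if e: "e \<in> set D" "\<not> fin e" for e
      proof (cases "si e < s1")
        case True
        then show ?thesis using early[OF e True] PPr[OF e] alr[OF e(1)] by (auto simp: \<phi>_def)
      next
        case False
        have "PP e \<le> reach a" unfolding PP_def using fE a False by (intro Min_le) (auto simp: E_def)
        then have "PP e < q" using a qge[OF a'q] by linarith
        then have "\<phi> (PP e) \<le> q" using phiK[of "PP e"] by (auto simp: \<phi>_def)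
        also have "q \<le> 1 * s1" using qs1 s10 g mult_right_mono[of \<gamma> 1 s1] by linarith
        finally show ?thesis using False s10 by auto
      qed
    qed (use pos PP0 phi0 PPmono phimono gp in auto)
  qed
qed

text \<open>Items without gain are dropped, as their value is not positive when
  \<open>\<kappa> \<le> \<gamma> * \<Gamma>\<close>. A final item is wanted because its positive
  gain makes every other reach positive. If there is none, the items settled last are declared
  final: their bids have stopped growing by then, so the load at later times is the one at the
  latest \<open>si\<close>.\<close>

lemma normalization:
  assumes g: "0 < \<gamma>" "\<gamma> \<le> 1" and kG: "1 \<le> \<kappa>" "\<gamma> * (\<kappa> - 1) \<le> \<gamma> * \<Gamma> - \<kappa>"
    and adm: "admissible \<gamma> C D"
  shows "\<exists>D'. admissible \<gamma> C D' \<and> balanced \<gamma> D' \<and> worth \<kappa> \<Gamma> D \<le> worth \<kappa> \<Gamma> D'"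
proof -
  define D1 where "D1 = filter (\<lambda>e. 0 < gain \<gamma> e) D"
  have adm1: "admissible \<gamma> C D1" unfolding D1_def by (rule admissible_filter[OF adm])
  have pos1: "\<forall>e\<in>set D1. 0 < gain \<gamma> e" by (simp add: D1_def)
  have kG': "\<kappa> \<le> \<gamma> * \<Gamma>" using kG g by (smt (verit) mult_nonneg_nonneg)
  have "val \<kappa> \<Gamma> e \<le> (if 0 < gain \<gamma> e then val \<kappa> \<Gamma> e else 0)" if e: "e \<in> set D" for e
  proof (cases "0 < gain \<gamma> e")
    case False
    note o = admissibleD(1)[OF adm e, unfolded item_ok_def]
    have "0 \<le> \<Gamma>" using kG' kG g by (smt (verit) mult_nonneg_nonpos)
    then have "\<Gamma> * (\<gamma> * al e) \<le> \<Gamma> * de e" using False by (intro mult_left_mono) (auto simp: gain_def)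
    moreover have "\<kappa> * al e \<le> \<gamma> * \<Gamma> * al e" using kG' o by (intro mult_right_mono) auto
    moreover have "0 \<le> (\<kappa> - 1) * be e" using kG o by auto
    ultimately have "\<kappa> * al e - (\<kappa> - 1) * be e - \<Gamma> * de e \<le> 0" by (simp add: algebra_simps)
    then show ?thesis using o False by (auto simp: val_def mult_nonneg_nonpos)
  qed simp
  then have w1: "worth \<kappa> \<Gamma> D \<le> worth \<kappa> \<Gamma> D1"
    unfolding worth_def D1_def sum_list_map_filter' by (rule sum_list_mono)
  show ?thesis
  proof (cases "D1 = []")
    case True
    then show ?thesis using adm1 w1 by (intro exI[of _ "[]"]) (auto simp: balanced_def)
  next
    case ne: False
    have "\<exists>D2. admissible \<gamma> C D2 \<and> (\<forall>e\<in>set D2. 0 < gain \<gamma> e) \<and> (\<exists>e\<in>set D2. fin e) \<and> worth \<kappa> \<Gamma> D2 =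
      worth \<kappa> \<Gamma> D1"
    proof (cases "\<exists>e\<in>set D1. fin e")
      case True then show ?thesis using adm1 pos1 by blast
    next
      case False
      define m where "m = Max (si ` set D1)"
      define f where "f e = e\<lparr>fin := (si e = m)\<rparr>" for e :: item
      have m: "si e \<le> m" if "e \<in> set D1" for e using that by (simp add: m_def)
      have "m \<in> si ` set D1" unfolding m_def using ne by (intro Max_in) auto
      then obtain em where em: "em \<in> set D1" "si em = m" by blast
      have sh: "share \<gamma> t (f e) \<le> share \<gamma> (min t m) e" if e: "e \<in> set D1" for e t
      proof -
        have "bid \<gamma> t (f e) = bid \<gamma> t e" by (simp add: f_def bid_def)
        moreover have "bid \<gamma> t e = bid \<gamma> m e" if "si e = m" "m < t"
          using admissibleD(1)[OF adm1 e] False e that by (auto simp: bid_def item_ok_def min_absorb2)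
        ultimately show ?thesis using e False m[OF e] share_nonneg[OF admissibleD(1)[OF adm1 e]]
          by (auto simp: share_def alive_def f_def min_def)
      qed
      have "load \<gamma> (map f D1) t \<le> C" for t
      proof -
        have "load \<gamma> (map f D1) t \<le> load \<gamma> D1 (min t m)"
          unfolding load_def using sh by (auto simp: o_def intro!: sum_list_mono)
        then show ?thesis using admissibleD(2)[OF adm1] by (meson order_trans)
      qed
      moreover have "earlier e e'" if "earlier (f e) (f e')" "e \<in> set D1" "e' \<in> set D1" for e e'
        using that False m[of e] m[of e'] by (auto simp: earlier_def f_def)
      then have "gain \<gamma> (f e') \<le> reach (f e)" if "earlier (f e) (f e')" "e \<in> set D1" "e' \<in> set D1" for e e'
        using admissibleD(3)[OF adm1] that by (fastforce simp: f_def gain_def reach_def)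
      moreover have "item_ok (f e)" if "e \<in> set D1" for e
        using admissibleD(1)[OF adm1 that] False that by (auto simp: item_ok_def f_def)
      ultimately have "admissible \<gamma> C (map f D1)" unfolding admissible_def by auto
      moreover have "worth \<kappa> \<Gamma> (map f D1) = worth \<kappa> \<Gamma> D1" by (simp add: worth_def o_def f_def val_def)
      moreover have "\<forall>e\<in>set (map f D1). 0 < gain \<gamma> e" using pos1 by (simp add: f_def gain_def)
      moreover have "\<exists>e\<in>set (map f D1). fin e" using em by (auto simp: f_def)
      ultimately show ?thesis by blast
    qed
    then obtain D2 where D2: "admissible \<gamma> C D2" "\<forall>e\<in>set D2. 0 < gain \<gamma> e" "\<exists>e\<in>set D2. fin e"
      "worth \<kappa> \<Gamma> D2 = worth \<kappa> \<Gamma> D1" by blast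
    obtain D3 where D3: "admissible \<gamma> C D3" "worth \<kappa> \<Gamma> D2 \<le> worth \<kappa> \<Gamma> D3" "\<forall>e\<in>set D3. 0 < gain \<gamma> e"
      "\<exists>e\<in>set D3. fin e" "\<forall>s. \<not> conflict \<gamma> D3 s"
      using remove_conflicts[OF g kG D2(1-3)] by blast
    obtain D4 where "admissible \<gamma> C D4" "balanced \<gamma> D4" "worth \<kappa> \<Gamma> D4 = worth \<kappa> \<Gamma> D3"
      using balance_tame[OF g D3(1,3,4,5)] by blast
    then show ?thesis using w1 D2 D3 by (metis order_trans)
  qed
qed

section \<open>From balanced data to the program\<close>

lemma split_off_unit:
  fixes m x :: "'i \<Rightarrow> real"
  assumes J: "finite J" and m: "\<And>i. i \<in> J \<Longrightarrow> 0 \<le> m i" and M: "1 \<le> sum m J" and x: "\<And>i. i \<in> J \<Longrightarrow> 0 \<le> x i"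
  shows "\<exists>u t. 0 \<le> t \<and> sum u J = 1 \<and>
    (\<forall>i\<in>J. 0 \<le> u i \<and> u i \<le> m i \<and> (0 < u i \<longrightarrow> x i \<le> t) \<and> (u i < m i \<longrightarrow> t \<le> x i))"
proof -
  define A where "A = {v \<in> x ` J. 1 \<le> sum m {i\<in>J. x i \<le> v}}"
  have neJ: "J \<noteq> {}" using M by auto
  have fA: "finite A" using J by (simp add: A_def)
  have "{i\<in>J. x i \<le> Max (x ` J)} = J" using J by auto
  then have "Max (x ` J) \<in> A" unfolding A_def using M J neJ by (auto intro!: Max_in)
  then have neA: "A \<noteq> {}" by blast
  define t where "t = Min A"
  have tA: "t \<in> A" unfolding t_def using fA neA by (rule Min_in)
  define B where "B = {i\<in>J. x i < t}"
  define E where "E = {i\<in>J. x i = t}"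
  have fin: "finite B" "finite E" using J by (auto simp: B_def E_def)
  have L1: "sum m B < 1"
  proof (cases "B = {}")
    case False
    define v where "v = Max (x ` B)"
    have v: "v \<in> x ` B" unfolding v_def using fin False by (intro Max_in) auto
    have "{i\<in>J. x i \<le> v} = B"
    proof
      show "{i\<in>J. x i \<le> v} \<subseteq> B" using v by (auto simp: B_def)
      show "B \<subseteq> {i\<in>J. x i \<le> v}" using fin by (auto simp: v_def B_def)
    qed
    moreover have "v < t" using v by (auto simp: B_def)
    then have "v \<notin> A" using Min_le[OF fA, of v] by (auto simp: t_def)
    ultimately show ?thesis using v by (auto simp: A_def B_def)
  qed simp
  have "{i\<in>J. x i \<le> t} = B \<union> E" "B \<inter> E = {}" by (auto simp: B_def E_def)
  then have BE: "1 \<le> sum m B + sum m E" using tA fin by (simp add: A_def sum.union_disjoint)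
  \<comment> \<open>The mass exactly at the threshold is taken proportionally, so that the group has
    mass 1.\<close>
  define \<theta> where "\<theta> = (1 - sum m B) / sum m E"
  have th: "0 \<le> \<theta>" "\<theta> \<le> 1" "\<theta> * sum m E = 1 - sum m B"
    using BE L1 by (auto simp: \<theta>_def field_simps)
  define u where "u i = (if x i < t then m i else if x i = t then \<theta> * m i else 0)" for i
  have "sum u J = (\<Sum>i\<in>J. if x i < t then m i else 0) + (\<Sum>i\<in>J. if x i = t then \<theta> * m i else 0)"
    unfolding sum.distrib[symmetric] by (intro sum.cong) (auto simp: u_def)
  also have "\<dots> = sum m B + \<theta> * sum m E"
    using J by (simp add: B_def E_def sum.inter_filter[symmetric] sum_distrib_left)
  finally have "sum u J = 1" using th by simp
  moreover have "0 \<le> u i \<and> u i \<le> m i \<and> (0 < u i \<longrightarrow> x i \<le> t) \<and> (u i < m i \<longrightarrow> t \<le> x i)" if "i \<in> J" for i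
    using m[OF that] th(1,2) by (auto simp: u_def mult_left_le_one_le)
  moreover have "0 \<le> t" using tA x by (auto simp: A_def)
  ultimately show ?thesis by blast
qed

lemma unit_groups:
  fixes m x :: "'i \<Rightarrow> real"
  assumes J: "finite J" and "\<And>i. i \<in> J \<Longrightarrow> 0 \<le> m i" and "sum m J = real n" and x: "\<And>i. i \<in> J \<Longrightarrow> 0 \<le> x i"
  shows "\<exists>w t. mono t \<and> (\<forall>b. 0 \<le> t b) \<and> (\<forall>i\<in>J. \<forall>b. (0::real) \<le> w i b) \<and> (\<forall>i\<in>J. (\<Sum>b=1..n. w i b) = m i) \<and>
    (\<forall>b\<in>{1..n}. (\<Sum>i\<in>J. w i b) = 1) \<and>
    (\<forall>i\<in>J. \<forall>b\<in>{1..n}. 0 < w i b \<longrightarrow> t (b - 1) \<le> x i \<and> x i \<le> t b)"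
  using assms(2,3)
proof (induction n arbitrary: m)
  case 0
  then have "m i = 0" if "i \<in> J" for i using that sum_nonneg_eq_0_iff[OF J, of m] by auto
  then show ?case by (intro exI[of _ "\<lambda>_ _. 0"]) (auto simp: mono_def)
next
  case (Suc n)
  have "1 \<le> sum m J" using Suc.prems by simp
  then have "\<exists>u t. 0 \<le> t \<and> sum u J = 1 \<and>
    (\<forall>i\<in>J. 0 \<le> u i \<and> u i \<le> m i \<and> (0 < u i \<longrightarrow> x i \<le> t) \<and> (u i < m i \<longrightarrow> t \<le> x i))"
    using split_off_unit[of J m x] J Suc.prems(1) x by blast
  then obtain u s where s: "0 \<le> s" "sum u J = 1"
    and u: "\<And>i. i \<in> J \<Longrightarrow> 0 \<le> u i \<and> u i \<le> m i \<and> (0 < u i \<longrightarrow> x i \<le> s) \<and> (u i < m i \<longrightarrow> s \<le> x i)" by blast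
  have "sum (\<lambda>i. m i - u i) J = real n" using s Suc.prems by (simp add: sum_subtractf)
  moreover have "0 \<le> m i - u i" if "i \<in> J" for i using u[OF that] by simp
  ultimately have "\<exists>w t. mono t \<and> (\<forall>b. 0 \<le> t b) \<and> (\<forall>i\<in>J. \<forall>b. (0::real) \<le> w i b) \<and>
    (\<forall>i\<in>J. (\<Sum>b=1..n. w i b) = m i - u i) \<and> (\<forall>b\<in>{1..n}. (\<Sum>i\<in>J. w i b) = 1) \<and>
    (\<forall>i\<in>J. \<forall>b\<in>{1..n}. 0 < w i b \<longrightarrow> t (b - 1) \<le> x i \<and> x i \<le> t b)"
    by (intro Suc.IH)
  then obtain w t where W: "mono t \<and> (\<forall>b. 0 \<le> t b) \<and> (\<forall>i\<in>J. \<forall>b. (0::real) \<le> w i b) \<and>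
    (\<forall>i\<in>J. (\<Sum>b=1..n. w i b) = m i - u i) \<and> (\<forall>b\<in>{1..n}. (\<Sum>i\<in>J. w i b) = 1) \<and>
    (\<forall>i\<in>J. \<forall>b\<in>{1..n}. 0 < w i b \<longrightarrow> t (b - 1) \<le> x i \<and> x i \<le> t b)"
    by (elim exE)
  then have t: "mono t" "\<And>b. 0 \<le> t b" and w: "\<And>i b. i \<in> J \<Longrightarrow> 0 \<le> w i b"
    "\<And>i. i \<in> J \<Longrightarrow> (\<Sum>b=1..n. w i b) = m i - u i" "\<And>b. b \<in> {1..n} \<Longrightarrow> (\<Sum>i\<in>J. w i b) = 1"
    "\<And>i b. i \<in> J \<Longrightarrow> b \<in> {1..n} \<Longrightarrow> 0 < w i b \<Longrightarrow> t (b - 1) \<le> x i \<and> x i \<le> t b"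
    by simp_all
  define w' where "w' i b = (if b = 1 then u i else w i (b - 1))" for i b
  \<comment> \<open>The thresholds of the remaining groups may start below \<open>s\<close>, hence
    the maximum; the remaining values themselves are at least \<open>s\<close>.\<close>
  define t' where "t' b = (if b = 0 then 0 else max s (t (b - 1)))" for b
  have split: "{1..Suc n} = insert 1 (Suc ` {1..n})"
    by (auto simp: image_iff)
  have "mono t'" using t s by (auto simp: mono_def t'_def max_def intro: order_trans)
  moreover have "0 \<le> t' b" for b using s by (simp add: t'_def le_max_iff_disj)
  moreover have "0 \<le> w' i b" if "i \<in> J" for i b using u[OF that] w(1)[OF that] by (simp add: w'_def)
  moreover have "(\<Sum>b=1..Suc n. w' i b) = m i" if "i \<in> J" for i
  proof -
    have "(\<Sum>b=1..Suc n. w' i b) = w' i 1 + (\<Sum>b\<in>Suc ` {1..n}. w' i b)"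
      unfolding split by (subst sum.insert) auto
    also have "(\<Sum>b\<in>Suc ` {1..n}. w' i b) = (\<Sum>b=1..n. w i b)"
      by (subst sum.reindex) (auto simp: w'_def intro!: sum.cong)
    finally show ?thesis using w(2)[OF that] by (simp add: w'_def)
  qed
  moreover have "(\<Sum>i\<in>J. w' i b) = 1" if "b \<in> {1..Suc n}" for b
  proof (cases "b = 1")
    case False
    then have "b - 1 \<in> {1..n}" using that by auto
    then show ?thesis using w(3)[of "b - 1"] False by (simp add: w'_def)
  qed (use s in \<open>simp add: w'_def\<close>)
  moreover have "t' (b - 1) \<le> x i \<and> x i \<le> t' b" if i: "i \<in> J" and b: "b \<in> {1..Suc n}" and p: "0 < w' i b"
    for i b
  proof (cases "b = 1")
    case True then show ?thesis using p u[OF i] x[OF i] by (auto simp: w'_def t'_def)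
  next
    case False
    then have b1: "b - 1 \<in> {1..n}" using b by auto
    have p': "0 < w i (b - 1)" using p False by (simp add: w'_def)
    have "w i (b - 1) \<le> (\<Sum>b=1..n. w i b)" using b1 w(1)[OF i] by (intro member_le_sum) auto
    then have "s \<le> x i" using p' w(2)[OF i] u[OF i] by linarith
    then show ?thesis using w(4)[OF i b1 p'] False b by (auto simp: t'_def)
  qed
  ultimately show ?case by blast
qed

text \<open>All constraints except (vi) are invariant under a common scaling of \<open>f\<close>,
  \<open>\<alpha>\<close>, \<open>\<delta>\<close>, \<open>\<beta>\<close>, so the left side of (vi)
  becomes the denominator of a ratio. If it is 0, scaling by arbitrarily small \<open>B\<close>
  shows that the objective is at most 0.\<close>

lemma sfr_homogeneous:
  assumes n: "\<And>f q \<alpha> \<delta> \<beta>. sfr_feasible n \<gamma> \<eta> f q \<alpha> \<delta> \<beta> \<Longrightarrow> sfr_objective n \<gamma> \<eta> q \<alpha> \<beta> \<le> \<Gamma>"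
    and f: "0 \<le> f"
    and nn: "\<forall>a\<in>{1..n}. \<forall>b\<in>{1..a}. 0 \<le> q a b \<and> 0 \<le> \<alpha> a b \<and> 0 \<le> \<delta> a b \<and> 0 \<le> \<beta> a b"
    and 1: "\<forall>a\<in>{1..n}. \<forall>a'\<in>{1..n}. \<forall>b\<in>{1..a}. \<forall>b'\<in>{1..a'}. b < b' \<longrightarrow> \<alpha> a b \<le> \<alpha> a' b'"
    and 2: "\<forall>a\<in>{1..n}. \<forall>a'\<in>{1..n}. \<forall>b\<in>{1..a}. \<forall>b'\<in>{1..a'}. a < a' \<longrightarrow>
        \<gamma> * \<alpha> a' b' \<le> \<beta> a b + \<delta> a b + \<delta> a' b'"
    and 3: "\<forall>a\<in>{1..<n}.
        (\<Sum>a'=a+1..n. \<Sum>b'=1..a. q a' b' * max (\<gamma> * \<alpha> a' b' - \<delta> a' b') 0) +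
        (\<Sum>a'=a+1..n. \<Sum>b'=a+1..a'. q a' b' * max (\<gamma> * \<alpha> a a - \<delta> a' b') 0) \<le> \<eta> * f"
    and 4: "\<forall>a\<in>{1..n}. \<forall>b\<in>{1..a}. \<delta> a b \<le> \<alpha> a b"
    and 5: "\<forall>a\<in>{1..n}. \<forall>b\<in>{1..a}. \<beta> a b \<le> \<alpha> a b"
    and 7: "\<forall>b\<in>{1..n}. (\<Sum>a=b..n. q a b) = 1"
  shows "sfr_objective n \<gamma> \<eta> q \<alpha> \<beta> \<le> \<Gamma> * (f + (\<Sum>a=1..n. \<Sum>b=1..a. q a b * \<delta> a b))"
proof -
  define D where "D = f + (\<Sum>a=1..n. \<Sum>b=1..a. q a b * \<delta> a b)"
  have D0: "0 \<le> D" unfolding D_def using f nn by (intro add_nonneg_nonneg sum_nonneg mult_nonneg_nonneg) auto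
  have key: "sfr_objective n \<gamma> \<eta> q \<alpha> \<beta> \<le> \<Gamma> * B" if B: "0 < B" "D \<le> B" for B
  proof -
    define \<alpha>' \<delta>' \<beta>' where "\<alpha>' a b = \<alpha> a b / B" and "\<delta>' a b = \<delta> a b / B" and "\<beta>' a b = \<beta> a b / B" for a b
    have mx: "max (y / B) 0 = max y 0 / B" for y using B by (simp add: max_divide_distrib_right)
    have "sfr_feasible n \<gamma> \<eta> (f / B) q \<alpha>' \<delta>' \<beta>'"
      unfolding sfr_feasible_def
    proof (intro conjI)
      show "\<forall>a\<in>{1..<n}.
        (\<Sum>a'=a+1..n. \<Sum>b'=1..a. q a' b' * max (\<gamma> * \<alpha>' a' b' - \<delta>' a' b') 0) +
        (\<Sum>a'=a+1..n. \<Sum>b'=a+1..a'. q a' b' * max (\<gamma> * \<alpha>' a a - \<delta>' a' b') 0) \<le> \<eta> * (f / B)"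
      proof
        fix a assume a: "a \<in> {1..<n}"
        show "(\<Sum>a'=a+1..n. \<Sum>b'=1..a. q a' b' * max (\<gamma> * \<alpha>' a' b' - \<delta>' a' b') 0) +
        (\<Sum>a'=a+1..n. \<Sum>b'=a+1..a'. q a' b' * max (\<gamma> * \<alpha>' a a - \<delta>' a' b') 0) \<le> \<eta> * (f / B)"
          using divide_right_mono[OF 3[rule_format, OF a], of B] B
          by (simp add: \<alpha>'_def \<delta>'_def mx flip: diff_divide_distrib sum_divide_distrib add_divide_distrib)
      qed
      have "D / B \<le> 1" using B by simp
      then show "f / B + (\<Sum>a=1..n. \<Sum>b=1..a. q a b * \<delta>' a b) \<le> 1"
        by (simp add: D_def \<delta>'_def add_divide_distrib sum_divide_distrib)
      show "\<forall>a\<in>{1..n}. \<forall>a'\<in>{1..n}. \<forall>b\<in>{1..a}. \<forall>b'\<in>{1..a'}. a < a' \<longrightarrow>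
        \<gamma> * \<alpha>' a' b' \<le> \<beta>' a b + \<delta>' a b + \<delta>' a' b'"
        using 2 B by (simp add: \<alpha>'_def \<delta>'_def \<beta>'_def divide_right_mono flip: add_divide_distrib)
    qed (use f nn 1 4 5 7 B in \<open>auto simp: \<alpha>'_def \<delta>'_def \<beta>'_def divide_right_mono\<close>)
    then have "sfr_objective n \<gamma> \<eta> q \<alpha>' \<beta>' \<le> \<Gamma>" by (rule n)
    moreover have "sfr_objective n \<gamma> \<eta> q \<alpha>' \<beta>' = sfr_objective n \<gamma> \<eta> q \<alpha> \<beta> / B"
    proof -
      have "q a b * (c * (\<alpha> a b / B) - d * (\<beta> a b / B)) = q a b * (c * \<alpha> a b - d * \<beta> a b) / B" for a b c d
        by (simp add: algebra_simps diff_divide_distrib)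
      then show ?thesis by (simp only: sfr_objective_def \<alpha>'_def \<beta>'_def sum_divide_distrib)
    qed
    ultimately show ?thesis using B by (simp add: field_simps)
  qed
  have "sfr_objective n \<gamma> \<eta> q \<alpha> \<beta> \<le> \<Gamma> * D"
  proof (cases "0 < D")
    case False
    then have D: "D = 0" using D0 by simp
    have "sfr_objective n \<gamma> \<eta> q \<alpha> \<beta> \<le> 0"
    proof (rule field_le_epsilon)
      fix e :: real assume e: "0 < e"
      define B where "B = e / (\<bar>\<Gamma>\<bar> + 1)"
      have B: "0 < B" using e by (simp add: B_def)
      have "\<Gamma> * B \<le> \<bar>\<Gamma>\<bar> * B" using B by (intro mult_right_mono) auto
      also have "\<dots> \<le> e" using e by (simp add: B_def field_simps)
      finally show "sfr_objective n \<gamma> \<eta> q \<alpha> \<beta> \<le> 0 + e" using key[of B] B D by simp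
    qed
    then show ?thesis using D by simp
  qed (use key in auto)
  then show ?thesis by (simp add: D_def)
qed

text \<open>The pair \<open>(a, b)\<close> collects the part of group \<open>b\<close> that is alive
  at the thresholds before \<open>a\<close> and, for \<open>a < n\<close>, is assigned before
  \<open>t a\<close>. Then (iii) at \<open>a\<close> is the load at time \<open>t a\<close>, (ii)
  compares items on both sides of \<open>t a\<close>, and (vii) is the unit mass of a group.\<close>

lemma balanced_worth_unit:
  assumes g: "0 \<le> \<gamma>" "\<gamma> \<le> 1" and eta: "0 < \<eta>" and k: "\<kappa> = (1 + \<gamma>) / \<eta>" and n1: "1 \<le> n"
    and obj: "\<And>f q \<alpha> \<delta> \<beta>. sfr_feasible n \<gamma> \<eta> f q \<alpha> \<delta> \<beta> \<Longrightarrow> sfr_objective n \<gamma> \<eta> q \<alpha> \<beta> \<le> \<Gamma>"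
    and adm: "admissible \<gamma> C D" and bal: "balanced \<gamma> D" and M: "(\<Sum>e\<leftarrow>D. wt e) = real n"
  shows "worth \<kappa> \<Gamma> D \<le> \<Gamma> * (C / \<eta>)"
proof -
  define J where "J = {..<length D}"
  define e where "e i = D ! i" for i
  have eD: "e i \<in> set D" if "i \<in> J" for i using that by (simp add: J_def e_def)
  note ok = admissibleD(1)[OF adm eD, unfolded item_ok_def]
  have al0: "0 \<le> al (e i)" if "i \<in> J" for i using ok[OF that] by linarith
  have sl: "(\<Sum>x\<leftarrow>D. g x) = (\<Sum>i\<in>J. g (e i))" for g :: "item \<Rightarrow> real"
    by (simp add: sum_list_sum_nth J_def e_def atLeast0LessThan)
  have fJ: "finite J" by (simp add: J_def)
  have "\<exists>w t. mono t \<and> (\<forall>b. 0 \<le> t b) \<and> (\<forall>i\<in>J. \<forall>b. (0::real) \<le> w i b) \<and>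
    (\<forall>i\<in>J. (\<Sum>b=1..n. w i b) = wt (e i)) \<and> (\<forall>b\<in>{1..n}. (\<Sum>i\<in>J. w i b) = 1) \<and>
    (\<forall>i\<in>J. \<forall>b\<in>{1..n}. 0 < w i b \<longrightarrow> t (b - 1) \<le> al (e i) \<and> al (e i) \<le> t b)"
  proof (rule unit_groups[OF fJ])
    show "(\<Sum>i\<in>J. wt (e i)) = real n" using M sl[of wt] by simp
  qed (use ok al0 in auto)
  then obtain w t where W: "mono t \<and> (\<forall>b. 0 \<le> t b) \<and> (\<forall>i\<in>J. \<forall>b. (0::real) \<le> w i b) \<and>
    (\<forall>i\<in>J. (\<Sum>b=1..n. w i b) = wt (e i)) \<and> (\<forall>b\<in>{1..n}. (\<Sum>i\<in>J. w i b) = 1) \<and>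
    (\<forall>i\<in>J. \<forall>b\<in>{1..n}. 0 < w i b \<longrightarrow> t (b - 1) \<le> al (e i) \<and> al (e i) \<le> t b)"
    by (elim exE)
  then have t: "mono t" "\<And>b. 0 \<le> t b" and w0: "\<And>i b. i \<in> J \<Longrightarrow> 0 \<le> w i b"
    and wm: "\<And>i. i \<in> J \<Longrightarrow> (\<Sum>b=1..n. w i b) = wt (e i)" and w1: "\<And>b. b \<in> {1..n} \<Longrightarrow> (\<Sum>i\<in>J. w i b) = 1"
    by simp_all
  have wt: "t (b - 1) \<le> al (e i) \<and> al (e i) \<le> t b" if "i \<in> J" "b \<in> {1..n}" "0 < w i b" for i b
    using W that by simp
  have tm: "t a \<le> t b" if "a \<le> b" for a b using t(1) that by (simp add: mono_def)
  \<comment> \<open>The index \<open>n\<close> takes the final items and those alive at all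
    thresholds before \<open>n\<close>; (iii) is not demanded there.\<close>
  define late where "late i a \<longleftrightarrow> a = n \<or> (1 \<le> a \<and> \<not> fin (e i) \<and> si (e i) < t a)" for i a
  define N where "N i = (LEAST a. late i a)" for i
  have lN: "late i (N i)" "N i \<le> n" for i
    unfolding N_def by (rule LeastI[of _ n], simp add: late_def) (rule Least_le, simp add: late_def)
  have N1: "alive (t a) (e i)" if "a < N i" "1 \<le> a" for i a
    using not_less_Least[of a "late i"] that lN(2)[of i] unfolding N_def[symmetric]
    by (auto simp: late_def alive_def)
  have N2: "\<not> fin (e i) \<and> si (e i) < t a" if "N i \<le> a" "a < n" for i a
    using lN(1)[of i] tm[OF that(1)] that by (auto simp: late_def)
  define cl where "cl i b = max b (N i)" for i b
  have clb: "b \<le> cl i b" "b \<le> n \<Longrightarrow> cl i b \<le> n" for i b using lN(2)[of i] by (auto simp: cl_def)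
  define A where "A g a b = (\<Sum>i\<in>J. if cl i b = a then w i b * g (e i) else 0)" for g :: "item \<Rightarrow> real" and a b
  define q where "q = A (\<lambda>_. 1)"
  define avg where "avg g a b = (if 0 < q a b then A g a b / q a b else t b)" for g a b
  have q0: "0 \<le> q a b" for a b using w0 by (auto simp: q_def A_def intro!: sum_nonneg)
  have qw: "w i b = 0" if "i \<in> J" "cl i b = a" "q a b = 0" for i a b
  proof -
    have "\<forall>i\<in>J. (if cl i b = a then w i b * 1 else 0) = 0"
      using that(3) w0 fJ unfolding q_def A_def by (subst (asm) sum_nonneg_eq_0_iff) auto
    then show ?thesis using that by auto
  qed
  have qavg: "q a b * avg g a b = A g a b" for g a b
  proof (cases "0 < q a b")
    case False
    then have "q a b = 0" using q0[of a b] by simp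
    then show ?thesis using qw by (auto simp: A_def intro!: sum.neutral)
  qed (simp add: avg_def)
  have Amono: "A g a b \<le> A h a b" if "\<And>i. i \<in> J \<Longrightarrow> cl i b = a \<Longrightarrow> 0 < w i b \<Longrightarrow> g (e i) \<le> h (e i)" for g h a b
    unfolding A_def
  proof (rule sum_mono)
    fix i assume i: "i \<in> J"
    show "(if cl i b = a then w i b * g (e i) else 0) \<le> (if cl i b = a then w i b * h (e i) else 0)"
      using that[OF i] w0[OF i, of b] by (cases "w i b = 0") (auto intro!: mult_left_mono)
  qed
  have Alin: "A (\<lambda>x. c * g x + d * h x) a b = c * A g a b + d * A h a b" for g h c d a b
  proof -
    have "A (\<lambda>x. c * g x + d * h x) a b = (\<Sum>i\<in>J. c * (if cl i b = a then w i b * g (e i) else 0) +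
      d * (if cl i b = a then w i b * h (e i) else 0))"
      unfolding A_def by (intro sum.cong) (auto simp: algebra_simps)
    then show ?thesis by (simp add: A_def sum.distrib sum_distrib_left)
  qed
  have Aconst: "A (\<lambda>_. c) a b = c * q a b" for c a b using Alin[of c "\<lambda>_. 1" 0 "\<lambda>_. 0" a b]
    by (simp add: q_def)
  have avg_le: "avg g a b \<le> c" if "0 < q a b" "\<And>i. i \<in> J \<Longrightarrow> cl i b = a \<Longrightarrow> 0 < w i b \<Longrightarrow> g (e i) \<le> c" for g a b c
    using Amono[of b a g "\<lambda>_. c"] that Aconst[of c a b] by (simp add: avg_def divide_le_eq)
  have avg_ge: "c \<le> avg g a b" if "0 < q a b" "\<And>i. i \<in> J \<Longrightarrow> cl i b = a \<Longrightarrow> 0 < w i b \<Longrightarrow> c \<le> g (e i)" for g a b c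
    using Amono[of b a "\<lambda>_. c" g] that Aconst[of c a b] by (simp add: avg_def le_divide_eq)
  have avg_mono: "avg g a b \<le> avg h a b" if "\<And>i. i \<in> J \<Longrightarrow> g (e i) \<le> h (e i)" for g h a b
    using Amono[of b a g h] that by (simp add: avg_def divide_right_mono)
  have avg_lin: "avg (\<lambda>x. c * g x + d * h x) a b = c * avg g a b + d * avg h a b" if "0 < q a b"
    for g h c d a b
    using that Alin by (simp add: avg_def add_divide_distrib)
  have alb: "t (b - 1) \<le> avg al a b" "avg al a b \<le> t b" if "b \<in> {1..n}" for a b
    using avg_ge[of a b "t (b - 1)" al] avg_le[of a b al "t b"] wt that tm[of "b - 1" b]
    by (cases "0 < q a b"; force simp: avg_def)+
  have nonneg: "0 \<le> avg g a b" if "\<And>i. i \<in> J \<Longrightarrow> 0 \<le> g (e i)" for g a b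
    using avg_ge[of a b 0 g] that t(2)[of b] by (cases "0 < q a b") (auto simp: avg_def)
  have live: "alive (t a) (e i)" if "i \<in> J" "a < cl i b" "1 \<le> a" "b \<in> {1..n}" "0 < w i b" for i a b
  proof (cases "a < N i")
    case True then show ?thesis using N1 that by blast
  next
    case False
    then have "a \<le> b - 1" using that by (auto simp: cl_def)
    then have "t a \<le> al (e i)" using tm wt[OF that(1,4,5)] by (meson order_trans)
    then show ?thesis using ok[OF that(1)] by (auto simp: alive_def)
  qed
  have sumA: "(\<Sum>a=1..n. \<Sum>b=1..a. A g a b) = (\<Sum>i\<in>J. wt (e i) * g (e i))" for g
  proof -
    have "(\<Sum>a=1..n. \<Sum>b=1..a. A g a b) = (\<Sum>a=1..n. \<Sum>b=1..n. A g a b)"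
    proof (rule sum.cong[OF refl], rule sum.mono_neutral_left)
      fix a assume a: "a \<in> {1..n}"
      then show "{1..a} \<subseteq> {1..n}" by auto
      have "A g a b = 0" if "b \<in> {1..n} - {1..a}" for b
      proof -
        have "cl i b \<noteq> a" for i using clb(1)[of b i] that by auto
        then show ?thesis by (simp add: A_def)
      qed
      then show "\<forall>b\<in>{1..n} - {1..a}. A g a b = 0" by blast
    qed simp
    also have "\<dots> = (\<Sum>i\<in>J. \<Sum>b=1..n. \<Sum>a=1..n. if cl i b = a then w i b * g (e i) else 0)"
    proof -
      let ?F = "\<lambda>a b i. if cl i b = a then w i b * g (e i) else 0"
      have "(\<Sum>a=1..n. \<Sum>b=1..n. \<Sum>i\<in>J. ?F a b i) = (\<Sum>a=1..n. \<Sum>i\<in>J. \<Sum>b=1..n. ?F a b i)"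
        by (rule sum.cong[OF refl]) (rule sum.swap)
      also have "\<dots> = (\<Sum>i\<in>J. \<Sum>a=1..n. \<Sum>b=1..n. ?F a b i)" by (rule sum.swap)
      also have "\<dots> = (\<Sum>i\<in>J. \<Sum>b=1..n. \<Sum>a=1..n. ?F a b i)"
        by (rule sum.cong[OF refl]) (rule sum.swap)
      finally show ?thesis by (simp only: A_def)
    qed
    also have "\<dots> = (\<Sum>i\<in>J. \<Sum>b=1..n. w i b * g (e i))"
    proof (intro sum.cong refl)
      fix i b assume b: "b \<in> {1..n}"
      then have "cl i b \<in> {1..n}" using clb[of b i] by auto
      then show "(\<Sum>a=1..n. if cl i b = a then w i b * g (e i) else 0) = w i b * g (e i)" by simp
    qed
    also have "\<dots> = (\<Sum>i\<in>J. wt (e i) * g (e i))" using wm by (simp flip: sum_distrib_right)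
    finally show ?thesis .
  qed
  have C0: "0 \<le> C" by (rule admissible_nonneg[OF adm])
  have "sfr_objective n \<gamma> \<eta> q (avg al) (avg be) \<le> \<Gamma> * (C / \<eta> + (\<Sum>a=1..n. \<Sum>b=1..a. q a b * avg de a b))"
  proof (rule sfr_homogeneous[OF obj])
    show "0 \<le> C / \<eta>" using C0 eta by simp
    show "\<forall>a\<in>{1..n}. \<forall>b\<in>{1..a}. 0 \<le> q a b \<and> 0 \<le> avg al a b \<and> 0 \<le> avg de a b \<and> 0 \<le> avg be a b"
      using q0 nonneg[of al] nonneg[of de] nonneg[of be] ok al0 by simp
    show "\<forall>a\<in>{1..n}. \<forall>a'\<in>{1..n}. \<forall>b\<in>{1..a}. \<forall>b'\<in>{1..a'}. b < b' \<longrightarrow> avg al a b \<le> avg al a' b'"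
    proof (intro ballI impI)
      fix a a' b b' assume h: "a \<in> {1..n}" "a' \<in> {1..n}" "b \<in> {1..a}" "b' \<in> {1..a'}" "b < b'"
      then have "avg al a b \<le> t b" "t (b' - 1) \<le> avg al a' b'" using alb by auto
      then show "avg al a b \<le> avg al a' b'" using tm[of b "b' - 1"] h by linarith
    qed
    show "\<forall>a\<in>{1..n}. \<forall>a'\<in>{1..n}. \<forall>b\<in>{1..a}. \<forall>b'\<in>{1..a'}. a < a' \<longrightarrow>
        \<gamma> * avg al a' b' \<le> avg be a b + avg de a b + avg de a' b'"
    proof (intro ballI impI)
      fix a a' b b' assume h: "a \<in> {1..n}" "a' \<in> {1..n}" "b \<in> {1..a}" "b' \<in> {1..a'}" "a < a'"
      then have bn: "b \<in> {1..n}" "b' \<in> {1..n}" by auto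
      show "\<gamma> * avg al a' b' \<le> avg be a b + avg de a b + avg de a' b'"
      proof (cases "0 < q a' b'")
        case False
        then have "avg al a' b' = t b'" "avg de a' b' = t b'" by (auto simp: avg_def)
        moreover have "0 \<le> avg be a b" "0 \<le> avg de a b" using nonneg[of be] nonneg[of de] ok by simp_all
        ultimately show ?thesis using g t(2)[of b'] mult_right_mono[of \<gamma> 1 "t b'"] by auto
      next
        case q': True
        have "gain \<gamma> (e i') \<le> avg be a b + avg de a b" if i': "i' \<in> J" "cl i' b' = a'" "0 < w i' b'" for i'
        proof (cases "0 < q a b")
          case True
          have "gain \<gamma> (e i') \<le> reach (e i)" if i: "i \<in> J" "cl i b = a" "0 < w i b" for i
          proof -
            \<comment> \<open>Here \<open>a < n\<close>, so this item is assigned strictly before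
              \<open>t a\<close>, when the items of the pair with \<open>a'\<close> are still
              alive.\<close>
            have "N i \<le> a" using i by (auto simp: cl_def)
            then have "\<not> fin (e i) \<and> si (e i) < t a" using N2 h by auto
            moreover have "alive (t a) (e i')" using live[of i' a b'] i' bn h by auto
            ultimately have "earlier (e i) (e i')" by (auto simp: earlier_def alive_def)
            then show ?thesis using admissibleD(3)[OF adm] eD i i' by blast
          qed
          then have "gain \<gamma> (e i') \<le> avg reach a b" using True by (intro avg_ge) auto
          also have "avg reach a b = avg be a b + avg de a b"
            using avg_lin[OF True, of 1 be 1 de] by (simp add: reach_def[abs_def])
          finally show ?thesis .
        next
          case False
          \<comment> \<open>The pair is empty but its group has mass 1, and \<open>balanced\<close>
            can be applied to any member of the group.\<close>
          have "\<exists>i\<in>J. 0 < w i b"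
          proof (rule ccontr)
            assume "\<not> ?thesis"
            then have "(\<Sum>i\<in>J. w i b) \<le> 0" by (intro sum_nonpos) (auto simp: not_less)
            then show False using w1[OF bn(1)] by simp
          qed
          then obtain i where i: "i \<in> J" "0 < w i b" by blast
          have "gain \<gamma> (e i') \<le> 2 * al (e i)" using bal eD i i' by (auto simp: balanced_def)
          also have "\<dots> \<le> 2 * t b" using wt[OF i(1) bn(1) i(2)] by simp
          finally show ?thesis using False by (simp add: avg_def)
        qed
        then have "avg (gain \<gamma>) a' b' \<le> avg be a b + avg de a b" using q' by (intro avg_le) auto
        moreover have "avg (gain \<gamma>) a' b' = \<gamma> * avg al a' b' - avg de a' b'"
          using avg_lin[OF q', of \<gamma> al "-1" de] by (simp add: gain_def[abs_def])
        ultimately show ?thesis by linarith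
      qed
    qed
    show "\<forall>a\<in>{1..<n}.
        (\<Sum>a'=a+1..n. \<Sum>b'=1..a. q a' b' * max (\<gamma> * avg al a' b' - avg de a' b') 0) +
        (\<Sum>a'=a+1..n. \<Sum>b'=a+1..a'. q a' b' * max (\<gamma> * avg al a a - avg de a' b') 0) \<le> \<eta> * (C / \<eta>)"
    proof
      fix a assume a: "a \<in> {1..<n}"
      define sh where "sh x = (if alive (t a) x then bid \<gamma> (t a) x else 0)" for x
      have sh0: "0 \<le> sh x" for x by (simp add: sh_def)
      \<comment> \<open>Jensen's inequality for the maximum with 0. The coefficients
        \<open>c\<close> and \<open>y\<close> serve both sums of (iii): \<open>\<gamma>\<close> and
        0 for groups up to \<open>a\<close>, whose \<open>\<alpha>\<close> is at most
        \<open>t a\<close>, and 0 and \<open>\<gamma> * t a\<close> for those above.\<close>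
      have pull: "q a' b' * max (c * avg al a' b' + y - avg de a' b') 0 \<le> A sh a' b'"
        if "\<And>i. i \<in> J \<Longrightarrow> cl i b' = a' \<Longrightarrow> 0 < w i b' \<Longrightarrow> c * al (e i) + y - de (e i) \<le> sh (e i)" for a' b' c y
      proof -
        have "q a' b' * (c * avg al a' b' + y - avg de a' b') = A (\<lambda>x. c * al x + y - de x) a' b'"
        proof -
          have "A (\<lambda>x. c * al x + y - de x) a' b' = A (\<lambda>x. 1 * (c * al x + y * 1) + (-1) * de x) a' b'"
            by simp
          also have "\<dots> = c * A al a' b' + y * q a' b' - A de a' b'" unfolding Alin by (simp add: q_def)
          finally show ?thesis by (simp add: algebra_simps flip: qavg)
        qed
        also have "\<dots> \<le> A sh a' b'" using that by (intro Amono) auto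
        finally have 1: "q a' b' * (c * avg al a' b' + y - avg de a' b') \<le> A sh a' b'" .
        have "0 \<le> A sh a' b'" using Amono[of b' a' "\<lambda>_. 0" sh] sh0 Aconst[of 0] by simp
        then show ?thesis using 1 by (simp add: max_def)
      qed
      have first: "q a' b' * max (\<gamma> * avg al a' b' - avg de a' b') 0 \<le> A sh a' b'"
        if "a' \<in> {a+1..n}" "b' \<in> {1..a}" for a' b'
      proof -
        have "\<gamma> * al (e i) + 0 - de (e i) \<le> sh (e i)" if i: "i \<in> J" "cl i b' = a'" "0 < w i b'" for i
        proof -
          have b': "b' \<in> {1..n}" using \<open>b' \<in> {1..a}\<close> a by auto
          then have "al (e i) \<le> t a" using wt[OF i(1) b' i(3)] tm[of b' a] \<open>b' \<in> {1..a}\<close> by auto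
          moreover have "alive (t a) (e i)" using live[of i a b'] i a b' \<open>a' \<in> {a+1..n}\<close> by auto
          ultimately show ?thesis by (simp add: sh_def bid_def min_absorb2)
        qed
        from pull[of b' a' \<gamma> 0, OF this] show ?thesis by simp
      qed
      have second: "q a' b' * max (\<gamma> * avg al a a - avg de a' b') 0 \<le> A sh a' b'"
        if "a' \<in> {a+1..n}" "b' \<in> {a+1..a'}" for a' b'
      proof -
        have "0 * al (e i) + \<gamma> * t a - de (e i) \<le> sh (e i)" if i: "i \<in> J" "cl i b' = a'" "0 < w i b'" for i
        proof -
          have b': "b' \<in> {1..n}" "a \<le> b' - 1" using \<open>b' \<in> {a+1..a'}\<close> \<open>a' \<in> {a+1..n}\<close> by auto
          then have "t a \<le> al (e i)" using wt[OF i(1) b'(1) i(3)] tm[OF b'(2)] by auto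
          moreover have "alive (t a) (e i)" using live[of i a b'] i a b' \<open>a' \<in> {a+1..n}\<close> by auto
          ultimately show ?thesis by (simp add: sh_def bid_def min_absorb1)
        qed
        from pull[of b' a' 0 "\<gamma> * t a", OF this]
        have "q a' b' * max (\<gamma> * t a - avg de a' b') 0 \<le> A sh a' b'" by simp
        moreover have "q a' b' * max (\<gamma> * avg al a a - avg de a' b') 0 \<le>
          q a' b' * max (\<gamma> * t a - avg de a' b') 0"
          using alb(2)[of a a] a g q0 by (intro mult_left_mono max.mono diff_mono) auto
        ultimately show ?thesis by linarith
      qed
      have Ash: "0 \<le> A sh a' b'" for a' b' using Amono[of b' a' "\<lambda>_. 0" sh] sh0 Aconst[of 0] by simp
      have "(\<Sum>a'=a+1..n. \<Sum>b'=1..a. q a' b' * max (\<gamma> * avg al a' b' - avg de a' b') 0) +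
        (\<Sum>a'=a+1..n. \<Sum>b'=a+1..a'. q a' b' * max (\<gamma> * avg al a a - avg de a' b') 0)
        \<le> (\<Sum>a'=a+1..n. \<Sum>b'=1..a. A sh a' b') + (\<Sum>a'=a+1..n. \<Sum>b'=a+1..a'. A sh a' b')"
        using first second by (intro add_mono sum_mono) auto
      also have "\<dots> = (\<Sum>a'=a+1..n. \<Sum>b'=1..a'. A sh a' b')"
        unfolding sum.distrib[symmetric]
      proof (intro sum.cong refl)
        fix a' assume a': "a' \<in> {a+1..n}"
        then have "{1..a'} = {1..a} \<union> {a+1..a'}" by auto
        then show "(\<Sum>b'=1..a. A sh a' b') + (\<Sum>b'=a+1..a'. A sh a' b') = (\<Sum>b'=1..a'. A sh a' b')"
          by (simp add: sum.union_disjoint)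
      qed
      also have "\<dots> \<le> (\<Sum>a'=1..n. \<Sum>b'=1..a'. A sh a' b')"
        using Ash by (intro sum_mono2 sum_nonneg) auto
      also have "\<dots> = load \<gamma> D (t a)"
        unfolding sumA load_def sl by (intro sum.cong) (auto simp: sh_def share_def)
      also have "\<dots> \<le> C" by (rule admissibleD(2)[OF adm])
      finally show "(\<Sum>a'=a+1..n. \<Sum>b'=1..a. q a' b' * max (\<gamma> * avg al a' b' - avg de a' b') 0) +
        (\<Sum>a'=a+1..n. \<Sum>b'=a+1..a'. q a' b' * max (\<gamma> * avg al a a - avg de a' b') 0) \<le> \<eta> * (C / \<eta>)"
        using eta by simp
    qed
    show "\<forall>a\<in>{1..n}. \<forall>b\<in>{1..a}. avg de a b \<le> avg al a b" "\<forall>a\<in>{1..n}. \<forall>b\<in>{1..a}. avg be a b \<le> avg al a b"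
      using avg_mono[of de al] avg_mono[of be al] ok by simp_all
    show "\<forall>b\<in>{1..n}. (\<Sum>a=b..n. q a b) = 1"
    proof
      fix b assume b: "b \<in> {1..n}"
      have "(\<Sum>a=b..n. q a b) = (\<Sum>i\<in>J. \<Sum>a=b..n. if cl i b = a then w i b else 0)"
        unfolding q_def A_def by (simp add: sum.swap[of _ J] cong: if_cong)
      also have "\<dots> = (\<Sum>i\<in>J. w i b)" using clb b by (intro sum.cong) auto
      finally show "(\<Sum>a=b..n. q a b) = 1" using w1[OF b] by simp
    qed
  qed
  also have "sfr_objective n \<gamma> \<eta> q (avg al) (avg be) = (\<Sum>i\<in>J. wt (e i) * (\<kappa> * al (e i) - (\<kappa> - 1) * be (e i)))"
  proof -
    have 1: "q a b * ((1 + \<gamma>) / \<eta> * avg al a b - ((1 + \<gamma>) / \<eta> - 1) * avg be a b) = A (\<lambda>x. \<kappa> * al x +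
      (- (\<kappa> - 1)) * be x) a b" for a b
      unfolding Alin k[symmetric] by (simp add: algebra_simps flip: qavg)
    show ?thesis unfolding sfr_objective_def 1 sumA by (intro sum.cong refl) (simp add: algebra_simps)
  qed
  also have "(\<Sum>a=1..n. \<Sum>b=1..a. q a b * avg de a b) = (\<Sum>i\<in>J. wt (e i) * de (e i))"
    unfolding qavg sumA ..
  finally show ?thesis
    unfolding worth_def sl val_def by (simp add: algebra_simps sum.distrib sum_subtractf sum_distrib_left)
qed

text \<open>Multiplying all masses by \<open>n / M\<close> yields groups of mass 1. Data without
  mass require \<open>0 \<le> \<Gamma>\<close>. The other alternative in \<open>G0\<close> allows
  the lemma to be applied before the sign of \<open>\<Gamma>\<close> is known.\<close>

lemma balanced_worth:
  assumes g: "0 \<le> \<gamma>" "\<gamma> \<le> 1" and eta: "0 < \<eta>" and k: "\<kappa> = (1 + \<gamma>) / \<eta>" and n1: "1 \<le> n"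
    and G0: "0 \<le> \<Gamma> \<or> 0 < (\<Sum>e\<leftarrow>D. wt e)"
    and obj: "\<And>f q \<alpha> \<delta> \<beta>. sfr_feasible n \<gamma> \<eta> f q \<alpha> \<delta> \<beta> \<Longrightarrow> sfr_objective n \<gamma> \<eta> q \<alpha> \<beta> \<le> \<Gamma>"
    and adm: "admissible \<gamma> C D" and bal: "balanced \<gamma> D"
  shows "worth \<kappa> \<Gamma> D \<le> \<Gamma> * (C / \<eta>)"
proof -
  define M where "M = (\<Sum>e\<leftarrow>D. wt e)"
  have wt0: "0 \<le> wt e" if "e \<in> set D" for e using admissibleD(1)[OF adm that] by (simp add: item_ok_def)
  have M0: "0 \<le> M" unfolding M_def using wt0 by (rule sum_list_nonneg_map)
  show ?thesis
  proof (cases "M = 0")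
    case True
    then have "wt e = 0" if "e \<in> set D" for e
      using that wt0 unfolding M_def by (subst (asm) sum_list_nonneg_eq_0_iff) auto
    then have "worth \<kappa> \<Gamma> D = 0" unfolding worth_def by (simp add: val_def cong: map_cong)
    then show ?thesis using G0 True eta admissible_nonneg[OF adm] by (simp add: M_def)
  next
    case False
    define c where "c = real n / M"
    have c0: "0 < c" using M0 False n1 by (simp add: c_def)
    define f where "f e = e\<lparr>wt := wt e * c\<rparr>" for e :: item
    have f: "item_ok (f e) = item_ok e" "gain \<gamma> (f e) = gain \<gamma> e" "reach (f e) = reach e"
      "earlier (f e) (f e') = earlier e e'"
      "share \<gamma> t (f e) = c * share \<gamma> t e" "val \<kappa> \<Gamma> (f e) = c * val \<kappa> \<Gamma> e" "al (f e) = al e" for e e' t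
      using c0 by (auto simp: f_def item_ok_def gain_def reach_def earlier_def share_def alive_def bid_def val_def zero_le_mult_iff)
    have "load \<gamma> (map f D) t = c * load \<gamma> D t" for t by (simp add: load_def o_def f sum_list_const_mult)
    then have "admissible \<gamma> (c * C) (map f D)" using adm c0 by (auto simp: admissible_def f)
    moreover have "balanced \<gamma> (map f D)" using bal by (auto simp: balanced_def f)
    moreover have "(\<Sum>e\<leftarrow>map f D. wt e) = real n"
    proof -
      have "(\<Sum>e\<leftarrow>map f D. wt e) = M * c" by (simp add: o_def f_def M_def sum_list_mult_const)
      then show ?thesis using False by (simp add: c_def)
    qed
    ultimately have "worth \<kappa> \<Gamma> (map f D) \<le> \<Gamma> * (c * C / \<eta>)"
      by (intro balanced_worth_unit[OF g eta k n1 obj])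
    moreover have "worth \<kappa> \<Gamma> (map f D) = c * worth \<kappa> \<Gamma> D" by (simp add: worth_def o_def f sum_list_const_mult)
    ultimately have "c * worth \<kappa> \<Gamma> D \<le> c * (\<Gamma> * (C / \<eta>))" by (simp add: algebra_simps)
    then show ?thesis using c0 mult_le_cancel_left_pos by blast
  qed
qed

section \<open>A lower bound on the value of the program\<close>

text \<open>The rows \<open>(m, x, d, b, l)\<close> were found by linear programming; \<open>428\<close> is the maximum
  of their load.\<close>

definition witness_table :: "(real \<times> real \<times> real \<times> real \<times> bool) list" where
  "witness_table = [(3, 16, 4, 16, False),
     (3, 17, 3, 17, False),
     (5, 18, 2, 18, False),
     (6, 20, 0, 20, False),
     (6, 23, 3, 17, False),
     (5, 26, 6, 14, False),
     (5, 29, 9, 11, False),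
     (5, 32, 12, 8, False),
     (5, 34, 16, 4, False),
     (4, 36, 17, 3, False),
     (4, 38, 18, 2, False),
     (5, 40, 20, 0, False),
     (5, 43, 23, 0, False),
     (5, 47, 27, 0, False),
     (21, 52, 32, 0, True)]"

text \<open>The column \<open>x\<close> is \<open>\<gamma> * al\<close>, so the gains, and the load
  as a function of \<open>\<gamma> * t\<close>, do not depend on \<open>\<gamma>\<close>. Non-final
  items are assigned at the moment \<open>al\<close>.\<close>

definition witness :: "real \<Rightarrow> item list" where
  "witness \<gamma> = map (\<lambda>(m, x, d, b, l). \<lparr>wt = m, al = x / \<gamma>, de = d, be = b, si = x / \<gamma>, fin =
    l\<rparr>) witness_table"

definition witness_load :: "real \<Rightarrow> real" where
  "witness_load y = (\<Sum>(m, x, d, b, l)\<leftarrow>witness_table. if l \<or> y \<le> x then m * max (min y x - d) 0 else 0)"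

lemma load_witness:
  assumes "0 < \<gamma>" shows "load \<gamma> (witness \<gamma>) t = witness_load (\<gamma> * t)"
proof -
  have "share \<gamma> t \<lparr>wt = m, al = x / \<gamma>, de = d, be = b, si = x / \<gamma>, fin = l\<rparr> =
      (if l \<or> \<gamma> * t \<le> x then m * max (min (\<gamma> * t) x - d) 0 else 0)" for m x d b l
  proof -
    have "\<gamma> * min t (x / \<gamma>) = min (\<gamma> * t) x" using assms by (simp add: min_mult_distrib_left)
    then show ?thesis using assms by (simp add: share_def alive_def bid_def field_simps)
  qed
  then show ?thesis by (simp add: load_def witness_def witness_load_def o_def case_prod_unfold)
qed

text \<open>Between consecutive entries \<open>x\<close> the set of bidders is constant and bids
  grow, so the load is largest at these entries. Beyond 52 only the final row bids.\<close>

lemma witness_load_le: "witness_load y \<le> 428"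
proof (cases "52 < y")
  case True
  then show ?thesis by (simp add: witness_load_def witness_table_def)
next
  case False
  have step: "witness_load y \<le> witness_load s"
    if "y \<le> s" "\<forall>(m, x, d, b, l)\<in>set witness_table. y \<le> x \<longrightarrow> s \<le> x" "s \<le> 52" for s
    unfolding witness_load_def
  proof (rule sum_list_mono)
    fix e assume e: "e \<in> set witness_table"
    obtain m x d b l where [simp]: "e = (m, x, d, b, l)" by (cases e) auto
    have "0 \<le> m" using e by (auto simp: witness_table_def)
    moreover have "y \<le> x \<longrightarrow> s \<le> x" using that(2) e by auto
    ultimately show "(case e of (m, x, d, b, l) \<Rightarrow> if l \<or> y \<le> x then m * max (min y x - d) 0 else 0)
      \<le> (case e of (m, x, d, b, l) \<Rightarrow> if l \<or> s \<le> x then m * max (min s x - d) 0 else 0)"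
      using that(1) by (auto intro!: mult_left_mono)
  qed
  define X where "X = {x \<in> (\<lambda>e. fst (snd e)) ` set witness_table. y \<le> x}"
  have "52 \<in> X" using False by (simp add: X_def witness_table_def)
  moreover have fX: "finite X" by (simp add: X_def)
  ultimately have s: "Min X \<in> X" "Min X \<le> 52" by (auto intro: Min_in Min_le)
  have "y \<le> x \<longrightarrow> Min X \<le> x" if "(m, x, d, b, l) \<in> set witness_table" for m x d b l
    using that fX by (force simp: X_def intro: Min_le)
  then have "witness_load y \<le> witness_load (Min X)" using s by (intro step) (auto simp: X_def)
  moreover have "\<forall>e\<in>set witness_table. witness_load (fst (snd e)) \<le> 428"
    unfolding witness_load_def by (simp add: witness_table_def)
  ultimately show ?thesis using s(1) by (fastforce simp: X_def)
qed

text \<open>The number 20 separates the gains from the reaches of all rows, and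
  \<open>x \<ge> 16\<close> gives \<open>2 * al e \<ge> 20\<close>.\<close>

lemma admissible_witness:
  assumes g: "0 < \<gamma>" "\<gamma> \<le> 1"
  shows "admissible \<gamma> 428 (witness \<gamma>)" "balanced \<gamma> (witness \<gamma>)"
proof -
  have x: "x \<le> x / \<gamma>" if "0 \<le> x" for x using g that by (simp add: le_divide_eq mult_left_le)
  have tab: "0 \<le> m \<and> 16 \<le> x \<and> 0 \<le> d \<and> d \<le> x \<and> 0 \<le> b \<and> b \<le> x \<and> x - d \<le> 20 \<and> (\<not> l \<longrightarrow> 20 \<le> b + d)"
    if "(m, x, d, b, l) \<in> set witness_table" for m x d b l
    using that by (auto simp: witness_table_def)
  have it: "item_ok e \<and> gain \<gamma> e \<le> 20 \<and> (\<not> fin e \<longrightarrow> 20 \<le> reach e) \<and> 16 \<le> al e" if e: "e \<in> set (witness \<gamma>)"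
    for e
  proof -
    obtain m x d b l where t: "(m, x, d, b, l) \<in> set witness_table"
      and [simp]: "e = \<lparr>wt = m, al = x / \<gamma>, de = d, be = b, si = x / \<gamma>, fin = l\<rparr>"
      using e by (auto simp: witness_def)
    show ?thesis using tab[OF t] x[of x] g by (auto simp: item_ok_def gain_def reach_def)
  qed
  show "admissible \<gamma> 428 (witness \<gamma>)"
    unfolding admissible_def
  proof (intro conjI ballI allI impI)
    fix e e' assume "e \<in> set (witness \<gamma>)" "e' \<in> set (witness \<gamma>)" "earlier e e'"
    then show "gain \<gamma> e' \<le> reach e" using it[of e] it[of e'] by (auto simp: earlier_def)
  qed (use it load_witness[OF g(1)] witness_load_le in auto)
  show "balanced \<gamma> (witness \<gamma>)" unfolding balanced_def
  proof (intro ballI)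
    fix e e' assume "e \<in> set (witness \<gamma>)" "e' \<in> set (witness \<gamma>)"
    then show "gain \<gamma> e' \<le> 2 * al e" using it[of e] it[of e'] by linarith
  qed
qed

text \<open>Averaging turns the one list \<open>witness \<gamma>\<close> into feasible points for
  all \<open>n\<close>, which makes the bound uniform in \<open>n\<close>.\<close>

lemma sfr_lower_bound:
  assumes g: "0 < \<gamma>" "\<gamma> \<le> 1" and eta: "1 \<le> \<eta>" "\<eta> \<le> 1 + \<gamma>" and k: "\<kappa> = (1 + \<gamma>) / \<eta>" and n1: "1 \<le> n"
    and obj: "\<And>f q \<alpha> \<delta> \<beta>. sfr_feasible n \<gamma> \<eta> f q \<alpha> \<delta> \<beta> \<Longrightarrow> sfr_objective n \<gamma> \<eta> q \<alpha> \<beta> \<le> \<Gamma>"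
  shows "\<kappa> / \<gamma> + \<kappa> - 1 \<le> \<Gamma>"
proof -
  define u where "u = \<kappa> / \<gamma>"
  define v where "v = \<kappa> - 1"
  define w where "w = 428 / \<eta>"
  have "0 < (\<Sum>e\<leftarrow>witness \<gamma>. wt e)" by (simp add: witness_def witness_table_def)
  then have "worth \<kappa> \<Gamma> (witness \<gamma>) \<le> \<Gamma> * (428 / \<eta>)"
    using eta g by (intro balanced_worth[OF _ g(2) _ k n1 _ obj admissible_witness[OF g]]) auto
  moreover have "worth \<kappa> \<Gamma> (witness \<gamma>) = 3090 * u - 616 * v - \<Gamma> * 1426"
    by (simp add: worth_def val_def witness_def witness_table_def u_def v_def field_simps)
  ultimately have main: "3090 * u - 616 * v \<le> \<Gamma> * (1426 + w)" by (simp add: w_def algebra_simps)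
  have w: "0 < w" "w \<le> 428" using eta by (auto simp: w_def field_simps)
  have k1: "1 \<le> \<kappa>" using eta k by simp
  have uv: "0 \<le> v" "2 * v \<le> u"
  proof -
    show "0 \<le> v" using k1 by (simp add: v_def)
    have k2: "\<kappa> \<le> 1 + \<gamma>" unfolding k using eta g by (simp add: divide_le_eq)
    have "2 * \<gamma> * (\<kappa> - 1) \<le> \<kappa>"
    proof -
      have "2 * \<gamma> * (\<kappa> - 1) \<le> 2 * 1 * (\<kappa> - 1)" using g k1 by (intro mult_right_mono) auto
      then show ?thesis using k2 g by simp
    qed
    then show "2 * v \<le> u" using g by (simp add: u_def v_def field_simps)
  qed
  \<comment> \<open>The constants 3090, 616 and 1426 are the sums of \<open>m * x\<close>,
    \<open>m * b\<close> and \<open>m * d\<close>. In the worst case \<open>w = 428\<close> the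
    inequality reads \<open>2470 * v \<le> 1236 * u\<close>, which \<open>2 * v \<le> u\<close> just
    suffices for.\<close>
  have "(u + v) * (1426 + w) \<le> 3090 * u - 616 * v"
  proof -
    have "(u + v) * w \<le> (u + v) * 428" using w uv by (intro mult_left_mono) auto
    then show ?thesis using uv by (simp add: algebra_simps)
  qed
  then have "(u + v) * (1426 + w) \<le> \<Gamma> * (1426 + w)" using main by linarith
  then have "u + v \<le> \<Gamma>" using w by (simp add: mult_le_cancel_right)
  then show ?thesis by (simp add: u_def v_def)
qed

lemma admissible_worth:
  assumes g: "0 < \<gamma>" "\<gamma> \<le> 1" and eta: "1 \<le> \<eta>" "\<eta> \<le> 1 + \<gamma>" and k: "\<kappa> = (1 + \<gamma>) / \<eta>" and n1: "1 \<le> n"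
    and obj: "\<And>f q \<alpha> \<delta> \<beta>. sfr_feasible n \<gamma> \<eta> f q \<alpha> \<delta> \<beta> \<Longrightarrow> sfr_objective n \<gamma> \<eta> q \<alpha> \<beta> \<le> \<Gamma>"
    and adm: "admissible \<gamma> C D"
  shows "worth \<kappa> \<Gamma> D \<le> \<Gamma> * (C / \<eta>)"
proof -
  have lb: "\<kappa> / \<gamma> + \<kappa> - 1 \<le> \<Gamma>" by (rule sfr_lower_bound[OF g eta k n1 obj])
  have k1: "1 \<le> \<kappa>" using eta k by simp
  have "0 \<le> \<kappa> / \<gamma>" using g k1 by simp
  then have G0: "0 \<le> \<Gamma>" using lb k1 by linarith
  have "\<gamma> * (\<kappa> / \<gamma> + \<kappa> - 1) \<le> \<gamma> * \<Gamma>" using lb g by simp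
  moreover have "\<gamma> * (\<kappa> / \<gamma> + \<kappa> - 1) = \<kappa> + \<gamma> * (\<kappa> - 1)" using g by (simp add: field_simps)
  ultimately have "\<gamma> * (\<kappa> - 1) \<le> \<gamma> * \<Gamma> - \<kappa>" by linarith
  from normalization[OF g k1 this adm] obtain D' where D': "admissible \<gamma> C D'" "balanced \<gamma> D'"
    "worth \<kappa> \<Gamma> D \<le> worth \<kappa> \<Gamma> D'" by blast
  have "worth \<kappa> \<Gamma> D' \<le> \<Gamma> * (C / \<eta>)"
    using eta g G0 by (intro balanced_worth[OF _ g(2) _ k n1 _ obj D'(1,2)]) auto
  then show ?thesis using D'(3) by linarith
qed

section \<open>Runs of the algorithm\<close>

text \<open>A run records the clock \<open>T\<close> and the time \<open>\<sigma> e L\<close> of the assignment of a facility to the end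
  \<open>L\<close> of \<open>e\<close>; as long as there is none, \<open>\<sigma> e L\<close> is junk.\<close>

inductive run :: "real \<Rightarrow> real \<Rightarrow> lflp \<Rightarrow> state \<Rightarrow> real \<Rightarrow> (edge \<Rightarrow> side \<Rightarrow> real) \<Rightarrow> bool" for \<gamma> \<eta> I where
  run_init: "run \<gamma> \<eta> I (init_state I) 0 (\<lambda>_ _. 0)"
| run_event: "\<lbrakk>run \<gamma> \<eta> I s T \<sigma>; event \<gamma> \<eta> I s s'\<rbrakk>
    \<Longrightarrow> run \<gamma> \<eta> I s' T (\<lambda>e L. if psi s e L = None then T else \<sigma> e L)"
| run_wait: "\<lbrakk>run \<gamma> \<eta> I s T \<sigma>; 0 < r; \<And>r' s'. 0 \<le> r' \<Longrightarrow> r' < r \<Longrightarrow> \<not> event \<gamma> \<eta> I (wait r' s) s'\<rbrakk>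
    \<Longrightarrow> run \<gamma> \<eta> I (wait r s) (T + r) \<sigma>"

lemma run_of_steps:
  assumes "(greedy_step \<gamma> \<eta> I)\<^sup>*\<^sup>* (init_state I) s"
  shows "\<exists>T \<sigma>. run \<gamma> \<eta> I s T \<sigma>"
  using assms
proof induction
  case base then show ?case using run_init by blast
next
  case (step s s')
  then obtain T \<sigma> where r: "run \<gamma> \<eta> I s T \<sigma>" by blast
  from step(2) show ?case
  proof cases
    case step_event then show ?thesis using run_event[OF r] by blast
  next
    case (step_wait t) then show ?thesis using run_wait[OF r, of t] by blast
  qed
qed

lemma run_greedy_inv:
  assumes I: "lflp_instance I" and g: "\<gamma> \<in> {0..1}" and "0 \<le> \<eta>" and "run \<gamma> \<eta> I s T \<sigma>"
  shows "greedy_inv \<gamma> \<eta> I s"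
  using assms(4)
proof induction
  case run_init then show ?case using init_inv[OF I \<open>0 \<le> \<eta>\<close>] .
next
  case run_event then show ?case using event_inv(1)[OF I g] by blast
next
  case (run_wait s T \<sigma> r)
  then show ?case by (intro wait_inv) auto
qed

text \<open>The last two clauses carry the geometry. An open facility is at distance at least
  \<open>\<gamma> * \<alpha>\<close> from an unassigned end, for otherwise the end would have been
  assigned to it. The last clause remembers this for ends assigned later; it is strict because
  simultaneous assignments give no information.\<close>

definition clock_inv :: "real \<Rightarrow> lflp \<Rightarrow> state \<Rightarrow> real \<Rightarrow> (edge \<Rightarrow> side \<Rightarrow> real) \<Rightarrow> bool" where
  "clock_inv \<gamma> I s T \<sigma> \<longleftrightarrow> 0 \<le> T \<and>
     (\<forall>e\<in>unconn s. alpha s e = T \<and> (\<forall>L. psi s e L = None)) \<and>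
     (\<forall>e\<in>edges I - unconn s. alpha s e \<le> T \<and> (\<exists>L. psi s e L \<noteq> None)) \<and>
     (\<forall>e\<in>edges I. \<forall>L i. psi s e L = Some i \<longrightarrow>
        i \<in> sol s \<and> end_dist I e L i \<le> alpha s e \<and> alpha s e \<le> \<sigma> e L \<and> \<sigma> e L \<le> T) \<and>
     (\<forall>e\<in>edges I - unconn s. \<forall>L. psi s e L = None \<longrightarrow> (\<forall>i\<in>sol s. \<gamma> * alpha s e \<le> end_dist I e L i)) \<and>
     (\<forall>e\<in>edges I. \<forall>e'\<in>edges I. \<forall>L L' i. psi s e L = Some i \<longrightarrow> psi s e' L' \<noteq> None \<longrightarrow> \<sigma> e L < \<sigma> e' L' \<longrightarrow>
        \<gamma> * alpha s e' \<le> end_dist I e' L' i)"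

lemma clock_invD:
  assumes "clock_inv \<gamma> I s T \<sigma>"
  shows "0 \<le> T"
    and "e \<in> unconn s \<Longrightarrow> alpha s e = T" "e \<in> unconn s \<Longrightarrow> psi s e L = None"
    and "e \<in> edges I \<Longrightarrow> e \<notin> unconn s \<Longrightarrow> alpha s e \<le> T"
    and "e \<in> edges I \<Longrightarrow> e \<notin> unconn s \<Longrightarrow> \<exists>L. psi s e L \<noteq> None"
    and "e \<in> edges I \<Longrightarrow> psi s e L = Some i \<Longrightarrow> i \<in> sol s \<and> end_dist I e L i \<le> alpha s e \<and> alpha s e \<le> \<sigma> e L \<and>
      \<sigma> e L \<le> T"
    and "e \<in> edges I \<Longrightarrow> e \<notin> unconn s \<Longrightarrow> psi s e L = None \<Longrightarrow> i \<in> sol s \<Longrightarrow> \<gamma> * alpha s e \<le> end_dist I e L i"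
    and "e \<in> edges I \<Longrightarrow> e' \<in> edges I \<Longrightarrow> psi s e L = Some i \<Longrightarrow> psi s e' L' \<noteq> None \<Longrightarrow> \<sigma> e L < \<sigma> e' L' \<Longrightarrow>
        \<gamma> * alpha s e' \<le> end_dist I e' L' i"
  using assms unfolding clock_inv_def by (auto simp del: split_paired_All)

lemma event_effect:
  assumes inv: "greedy_inv \<gamma> \<eta> I s" and ev: "event \<gamma> \<eta> I s s'" and g: "\<gamma> \<in> {0..1}"
    and clk: "clock_inv \<gamma> I s T \<sigma>"
  shows "alpha s' = alpha s" "sol s \<subseteq> sol s'" "unconn s' \<subseteq> unconn s"
    and "\<And>e L i. e \<in> edges I \<Longrightarrow> psi s e L = Some i \<Longrightarrow> psi s' e L = Some i"
    and "\<And>e L. e \<in> unconn s' \<Longrightarrow> psi s' e L = None"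
    and "\<And>e. e \<in> unconn s - unconn s' \<Longrightarrow> \<exists>L. psi s' e L \<noteq> None"
    and "\<And>e L i. e \<in> edges I \<Longrightarrow> psi s e L = None \<Longrightarrow> psi s' e L = Some i \<Longrightarrow> i \<in> sol s' \<and> end_dist I e L i \<le>
      alpha s e"
    and "\<And>e L i. e \<in> edges I - unconn s' \<Longrightarrow> psi s' e L = None \<Longrightarrow> i \<in> sol s' \<Longrightarrow> \<gamma> * alpha s e \<le> end_dist I e L i"
proof -
  have fresh: "psi s e L = None" if "e \<in> unconn s" for e L using clock_invD(3)[OF clk that] .
  have far: "\<gamma> * alpha s e \<le> end_dist I e L i" if "e \<in> edges I - unconn s" "psi s e L = None" "i \<in> sol s"
    for e L i
    using clock_invD(7)[OF clk] that by blast
  have al: "0 \<le> alpha s e" for e using inv by (cases e) (auto simp: greedy_inv_def)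
  have ga: "\<gamma> * alpha s e \<le> alpha s e" for e using g al by (simp add: mult_left_le_one_le)
  have near: "alpha s e \<le> end_dist I e L i" if "e \<in> unconn s" "i \<in> sol s" for e i L
    using inv that edge_dist_le[of I e i L] unfolding greedy_inv_def by (meson order_trans)
  have UE: "unconn s \<subseteq> edges I" using inv by (simp add: greedy_inv_def)
  have A: "alpha s' = alpha s \<and> sol s \<subseteq> sol s' \<and> unconn s' \<subseteq> unconn s \<and>
    (\<forall>e L i. e \<in> edges I \<longrightarrow> psi s e L = Some i \<longrightarrow> psi s' e L = Some i) \<and>
    (\<forall>e L. e \<in> unconn s' \<longrightarrow> psi s' e L = None) \<and>
    (\<forall>e. e \<in> unconn s - unconn s' \<longrightarrow> (\<exists>L. psi s' e L \<noteq> None)) \<and>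
    (\<forall>e L i. e \<in> edges I \<longrightarrow> psi s e L = None \<longrightarrow> psi s' e L = Some i \<longrightarrow> i \<in> sol s' \<and> end_dist I e L i \<le> alpha s e) \<and>
    (\<forall>e L i. e \<in> edges I - unconn s' \<longrightarrow> psi s' e L = None \<longrightarrow> i \<in> sol s' \<longrightarrow> \<gamma> * alpha s e \<le> end_dist I e L i)"
    using ev
  proof cases
    case (event_connect e0 i0)
    have p: "psi s' e L = (if e = e0 \<and> alpha s e0 = end_dist I e0 L i0 then Some i0 else psi s e L)" for e L
      using event_connect by (simp add: connect_def)
    have s: "alpha s' = alpha s" "sol s' = sol s" "unconn s' = unconn s - {e0}"
      using event_connect by (auto simp: connect_def)
    obtain L0 where L0: "end_dist I e0 L0 i0 = edge_dist I e0 i0" using edge_dist_attained by blast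
    show ?thesis
      unfolding s p
    proof (intro conjI allI impI)
      fix e assume "e \<in> unconn s - (unconn s - {e0})"
      then show "\<exists>L. (if e = e0 \<and> alpha s e0 = end_dist I e0 L i0 then Some i0 else psi s e L) \<noteq> None"
        using L0 event_connect by (intro exI[of _ L0]) auto
    next
      fix e L i assume e: "e \<in> edges I - (unconn s - {e0})"
        "(if e = e0 \<and> alpha s e0 = end_dist I e0 L i0 then Some i0 else psi s e L) = None" "i \<in> sol s"
      show "\<gamma> * alpha s e \<le> end_dist I e L i"
      proof (cases "e = e0")
        case True then show ?thesis using near[of e i L] ga[of e] e event_connect by auto
      next
        case False then show ?thesis using far[of e L i] e by (auto split: if_splits)
      qed
    qed (use event_connect fresh[of e0] fresh in \<open>auto split: if_splits\<close>)
  next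
    case (event_open i0)
    have p: "psi s' e L = (if e \<in> edges I - unconn s \<and> psi s e L = None \<and> end_dist I e L i0 \<le> \<gamma> * alpha s e
          \<or> e \<in> unconn s \<and> edge_dist I e i0 \<le> alpha s e \<and> end_dist I e L i0 \<le> alpha s e
       then Some i0 else psi s e L)" for e L
      using event_open by (simp add: open_facility_def)
    have s: "alpha s' = alpha s" "sol s' = insert i0 (sol s)"
      "unconn s' = {e \<in> unconn s. \<not> edge_dist I e i0 \<le> alpha s e}"
      using event_open by (auto simp: open_facility_def)
    show ?thesis
    proof (intro conjI allI impI)
      fix e assume e: "e \<in> unconn s - unconn s'"
      obtain L0 where "end_dist I e L0 i0 = edge_dist I e i0" using edge_dist_attained by blast
      then show "\<exists>L. psi s' e L \<noteq> None" using e by (intro exI[of _ L0]) (auto simp: p s)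
    next
      fix e L i assume e: "e \<in> edges I" "psi s e L = Some i"
      then have "e \<notin> unconn s" using fresh[of e L] by auto
      then show "psi s' e L = Some i" using e by (simp add: p)
    next
      fix e L assume "e \<in> unconn s'" then show "psi s' e L = None" using fresh[of e L] by (auto simp: p s)
    next
      fix e L i assume e: "e \<in> edges I" "psi s e L = None" "psi s' e L = Some i"
      then show "end_dist I e L i \<le> alpha s e" using ga[of e] unfolding p by (auto split: if_splits)
      show "i \<in> sol s'" using e unfolding p s by (auto split: if_splits)
    next
      fix e L i assume e: "e \<in> edges I - unconn s'" "psi s' e L = None" "i \<in> sol s'"
      show "\<gamma> * alpha s e \<le> end_dist I e L i"
      proof (cases "e \<in> unconn s")
        case True
        then have "\<not> end_dist I e L i0 \<le> alpha s e" using e unfolding p s by (auto split: if_splits)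
        then show ?thesis using near[OF True, of i L] ga[of e] e by (auto simp: s)
      next
        case False
        then have "psi s e L = None" "\<not> end_dist I e L i0 \<le> \<gamma> * alpha s e" using e unfolding p
          by (auto split: if_splits)
        then show ?thesis using far[of e L i] e False by (auto simp: s)
      qed
    qed (auto simp: s)
  qed
  then show "alpha s' = alpha s" "sol s \<subseteq> sol s'" "unconn s' \<subseteq> unconn s"
    and "\<And>e L i. e \<in> edges I \<Longrightarrow> psi s e L = Some i \<Longrightarrow> psi s' e L = Some i"
    and "\<And>e L. e \<in> unconn s' \<Longrightarrow> psi s' e L = None"
    and "\<And>e. e \<in> unconn s - unconn s' \<Longrightarrow> \<exists>L. psi s' e L \<noteq> None"
    and "\<And>e L i. e \<in> edges I \<Longrightarrow> psi s e L = None \<Longrightarrow> psi s' e L = Some i \<Longrightarrow> i \<in> sol s' \<and> end_dist I e L i \<le>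
      alpha s e"
    and "\<And>e L i. e \<in> edges I - unconn s' \<Longrightarrow> psi s' e L = None \<Longrightarrow> i \<in> sol s' \<Longrightarrow> \<gamma> * alpha s e \<le> end_dist I e L i"
    by (simp_all del: split_paired_All)
qed

lemma run_clock_inv:
  assumes I: "lflp_instance I" and g: "\<gamma> \<in> {0..1}" and eta: "0 \<le> \<eta>" and "run \<gamma> \<eta> I s T \<sigma>"
  shows "clock_inv \<gamma> I s T \<sigma>"
  using assms(4)
proof induction
  case run_init then show ?case by (simp add: clock_inv_def init_state_def)
next
  case (run_event s T \<sigma> s')
  note inv = run_greedy_inv[OF I g eta run_event(1)]
  note C = clock_invD[OF run_event.IH]
  have UE: "unconn s \<subseteq> edges I" using inv by (simp add: greedy_inv_def)
  note E = event_effect[OF inv run_event(2) g run_event.IH]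
  define \<sigma>' where "\<sigma>' e L = (if psi s e L = None then T else \<sigma> e L)" for e L
  have al: "alpha s e \<le> T" if "e \<in> edges I" for e using C(2)[of e] C(4)[of e] that by fastforce
  have al0: "0 \<le> alpha s e" for e using inv by (cases e) (auto simp: greedy_inv_def)
  have ga: "\<gamma> * alpha s e \<le> alpha s e" for e using g al0 by (simp add: mult_left_le_one_le)
  have "clock_inv \<gamma> I s' T \<sigma>'"
    unfolding clock_inv_def
  proof (intro conjI ballI allI impI)
    show "0 \<le> T" by (rule C(1))
  next
    fix e assume "e \<in> unconn s'"
    then have "e \<in> unconn s" using E(3) by blast
    then show "alpha s' e = T" using C(2)[of e] E(1) by simp
  next
    fix e L assume "e \<in> unconn s'" then show "psi s' e L = None" using E(5) by blast
  next
    fix e assume "e \<in> edges I - unconn s'" then show "alpha s' e \<le> T" using E(1) al by simp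
  next
    fix e assume e: "e \<in> edges I - unconn s'"
    show "\<exists>L. psi s' e L \<noteq> None"
    proof (cases "e \<in> unconn s")
      case True then show ?thesis using E(6) e by blast
    next
      case False
      then obtain L where "psi s e L \<noteq> None" using C(5)[of e] e by auto
      then show ?thesis using E(4)[of e L] e by auto
    qed
  next
    fix e L i assume e: "e \<in> edges I" "psi s' e L = Some i"
    have "i \<in> sol s' \<and> end_dist I e L i \<le> alpha s' e \<and> alpha s' e \<le> \<sigma>' e L \<and> \<sigma>' e L \<le> T"
    proof (cases "psi s e L")
      case None then show ?thesis using E(1) E(7)[OF e(1) None e(2)] al[OF e(1)] by (simp add: \<sigma>'_def)
    next
      case (Some j)
      then have "j = i" using E(4)[OF e(1) Some] e by simp
      then show ?thesis using C(6)[OF e(1) Some] E(1,2) Some by (auto simp: \<sigma>'_def)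
    qed
    then show "i \<in> sol s'" "end_dist I e L i \<le> alpha s' e" "alpha s' e \<le> \<sigma>' e L" "\<sigma>' e L \<le> T" by auto
  next
    fix e L i assume "e \<in> edges I - unconn s'" "psi s' e L = None" "i \<in> sol s'"
    then show "\<gamma> * alpha s' e \<le> end_dist I e L i" using E(1) E(8) by simp
  next
    fix e e' L L' i assume e: "e \<in> edges I" "e' \<in> edges I" "psi s' e L = Some i" "psi s' e' L' \<noteq> None"
      "\<sigma>' e L < \<sigma>' e' L'"
    have le: "\<sigma>' e' L' \<le> T"
      using C(6)[OF e(2), of L'] by (cases "psi s e' L'") (auto simp: \<sigma>'_def)
    \<comment> \<open>An assignment made by this event has the latest possible time, so the earlier
      of the two assignments is an old one.\<close>
    have "psi s e L \<noteq> None"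
    proof
      assume "psi s e L = None"
      then have "\<sigma>' e L = T" by (simp add: \<sigma>'_def)
      then show False using e(5) le by simp
    qed
    then have eL: "psi s e L = Some i" using E(4)[OF e(1)] e(3) by fastforce
    then have isol: "i \<in> sol s" using C(6)[OF e(1)] by blast
    show "\<gamma> * alpha s' e' \<le> end_dist I e' L' i"
    proof (cases "psi s e' L' = None")
      case False
      then show ?thesis using C(8)[OF e(1,2) eL False] e(5) eL E(1) by (auto simp: \<sigma>'_def)
    next
      case True
      show ?thesis
      proof (cases "e' \<in> unconn s")
        case u: True
        then have "alpha s e' \<le> edge_dist I e' i" using inv isol unfolding greedy_inv_def by blast
        then show ?thesis using edge_dist_le[of I e' i L'] ga[of e'] E(1) by simp
      next
        case u: False then show ?thesis using C(7)[OF e(2) u True isol] E(1) by simp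
      qed
    qed
  qed
  then show ?case by (simp add: \<sigma>'_def[abs_def])
next
  case (run_wait s T \<sigma> r)
  note C = clock_invD[OF run_wait.IH]
  have "alpha (wait r s) e = alpha s e" if "e \<notin> unconn s" for e using that by simp
  show ?case
    unfolding clock_inv_def
  proof (intro conjI ballI allI impI)
    show "0 \<le> T + r" using C(1) run_wait by simp
  next
    fix e assume "e \<in> edges I - unconn (wait r s)" then show "alpha (wait r s) e \<le> T + r"
      using C(4)[of e] run_wait by auto
  next
    fix e L i assume e: "e \<in> edges I" "psi (wait r s) e L = Some i"
    then have "e \<notin> unconn s" using C(3)[of e L] by auto
    then show "i \<in> sol (wait r s)" "end_dist I e L i \<le> alpha (wait r s) e" "alpha (wait r s) e \<le> \<sigma> e L"
      "\<sigma> e L \<le> T + r"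
      using C(6)[of e L i] e run_wait(2) by simp_all
  next
    fix e e' L L' i assume e: "e \<in> edges I" "e' \<in> edges I" "psi (wait r s) e L = Some i"
      "psi (wait r s) e' L' \<noteq> None" "\<sigma> e L < \<sigma> e' L'"
    then have "e' \<notin> unconn s" using C(3)[of e' L'] by auto
    then show "\<gamma> * alpha (wait r s) e' \<le> end_dist I e' L' i" using C(8)[of e e' L i L'] e by simp
  qed (use C in auto)
qed

text \<open>An edge bids at its full rate \<open>t - d\<close> until time \<open>alpha\<close>, and at the discounted rate
  thereafter, until its endpoint is assigned.\<close>

definition bids :: "real \<Rightarrow> lflp \<Rightarrow> state \<Rightarrow> (edge \<Rightarrow> side \<Rightarrow> real) \<Rightarrow> (edge \<Rightarrow> side) \<Rightarrow> nat \<Rightarrow> real \<Rightarrow> real" where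
  "bids \<gamma> I s \<sigma> Lf i t = (\<Sum>e\<in>edges I. if psi s e (Lf e) = None \<or> t \<le> \<sigma> e (Lf e)
     then people I e * max ((if e \<in> unconn s \<or> t \<le> alpha s e then t else \<gamma> * alpha s e) - end_dist I e (Lf e) i) 0
     else 0)"

section \<open>Offers along a run\<close>

lemma people_nonneg: "lflp_instance I \<Longrightarrow> e \<in> edges I \<Longrightarrow> 0 \<le> people I e"
  by (simp add: lflp_instance_def)

lemma end_dist_nonneg: "lflp_instance I \<Longrightarrow> 0 \<le> end_dist I e L i"
  using edge_dist_nonneg edge_dist_le order_trans by metis

lemma unset_le_single:
  assumes I: "lflp_instance I" and "e \<in> edges I" "e \<notin> unconn s" "psi s e L = None"
  shows "people I e * max (\<gamma> * alpha s e - end_dist I e L i) 0 \<le> single \<gamma> I s i e"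
proof -
  have "people I e * max (\<gamma> * alpha s e - end_dist I e L i) 0 =
     (\<Sum>L\<in>{L}. people I e * max (\<gamma> * alpha s e - end_dist I e L i) 0)" by simp
  also have "\<dots> \<le> (\<Sum>L | psi s e L = None. people I e * max (\<gamma> * alpha s e - end_dist I e L i) 0)"
    using assms people_nonneg[OF I] by (intro sum_mono2) auto
  finally show ?thesis using assms by (simp add: single_def)
qed

text \<open>The past bids are read off the current data, and an event does not increase them. New
  times come from waiting. There, the state at time \<open>t\<close> itself satisfies the invariant:
  if \<open>i\<close> is closed, its offer bounds the bids of one end per edge, and if
  \<open>i\<close> is open, all these bids vanish.\<close>

lemma run_bids:
  assumes I: "lflp_instance I" and g: "\<gamma> \<in> {0..1}" and eta: "0 \<le> \<eta>" and i: "i \<in> locs I" and "run \<gamma> \<eta> I s T \<sigma>"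
    and "0 \<le> t" "t \<le> T"
  shows "bids \<gamma> I s \<sigma> Lf i t \<le> \<eta> * open_cost I i"
  using assms(5-)
proof (induction arbitrary: t)
  case run_init
  then have t: "t = 0" by simp
  have "max ((if e \<in> unconn (init_state I) \<or> t \<le>
    alpha (init_state I) e then t else \<gamma> * alpha (init_state I) e) - end_dist I e (Lf e) i) 0 = 0" for e
    using end_dist_nonneg[OF I, of e "Lf e" i] t by (simp add: init_state_def)
  then have "bids \<gamma> I (init_state I) (\<lambda>_ _. 0) Lf i t = 0" unfolding bids_def by (intro sum.neutral) simp
  then show ?case using i eta I by (simp add: lflp_instance_def)
next
  case (run_event s T \<sigma> s')
  note inv = run_greedy_inv[OF I g eta run_event(1)]
  note C = clock_invD[OF run_clock_inv[OF I g eta run_event(1)]]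
  note E = event_effect[OF inv run_event(2) g run_clock_inv[OF I g eta run_event(1)]]
  define \<sigma>' where "\<sigma>' e L = (if psi s e L = None then T else \<sigma> e L)" for e L
  have "bids \<gamma> I s' \<sigma>' Lf i t \<le> bids \<gamma> I s \<sigma> Lf i t"
    unfolding bids_def
  proof (rule sum_mono)
    fix e assume e: "e \<in> edges I"
    let ?w = "\<lambda>s. people I e * max ((if e \<in> unconn s \<or> t \<le>
      alpha s e then t else \<gamma> * alpha s e) - end_dist I e (Lf e) i) 0"
    have w: "?w s' = ?w s"
    proof (cases "e \<in> unconn s")
      case True then show ?thesis using C(2)[of e] \<open>t \<le> T\<close> E(1) by simp
    next
      case False
      then have "e \<notin> unconn s'" using E(3) by blast
      then show ?thesis using False E(1) by simp
    qed
    have p: "psi s e (Lf e) = None \<or> t \<le> \<sigma> e (Lf e)" if "psi s' e (Lf e) = None \<or> t \<le> \<sigma>' e (Lf e)"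
      using that E(4)[OF e, of "Lf e"] by (cases "psi s e (Lf e)") (auto simp: \<sigma>'_def)
    show "(if psi s' e (Lf e) = None \<or> t \<le> \<sigma>' e (Lf e) then ?w s' else 0) \<le> (if psi s e (Lf e) = None \<or> t \<le>
      \<sigma> e (Lf e) then ?w s else 0)"
      using p people_nonneg[OF I e] unfolding w by auto
  qed
  then show ?case using run_event.IH[OF run_event.prems] by (simp add: \<sigma>'_def[abs_def])
next
  case (run_wait s T \<sigma> r)
  note inv = run_greedy_inv[OF I g eta run_wait(1)]
  note C = clock_invD[OF run_clock_inv[OF I g eta run_wait(1)]]
  show ?case
  proof (cases "t \<le> T")
    case True
    have "bids \<gamma> I (wait r s) \<sigma> Lf i t = bids \<gamma> I s \<sigma> Lf i t"
      unfolding bids_def by (intro sum.cong refl) simp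
    then show ?thesis using run_wait.IH[OF run_wait.prems(1) True] by simp
  next
    case False
    define r' where "r' = t - T"
    define s1 where "s1 = wait r' s"
    have r': "0 < r'" "r' \<le> r" using False run_wait.prems by (auto simp: r'_def)
    have inv1: "greedy_inv \<gamma> \<eta> I s1" unfolding s1_def
      using r' run_wait(3) by (intro wait_inv[OF inv]) auto
    have dead: "\<not> t \<le> \<sigma> e (Lf e)" if "e \<in> edges I" "psi s e (Lf e) \<noteq> None" for e
      using C(6)[OF that(1)] that(2) False by fastforce
    define b where "b e = (if psi (wait r s) e (Lf e) = None \<or> t \<le> \<sigma> e (Lf e)
     then people I e * max ((if e \<in> unconn (wait r s) \<or> t \<le> alpha (wait r s) e then t else \<gamma> * alpha (wait r s) e) - end_dist I e (Lf e) i) 0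
     else 0)" for e
    have b1: "b e = people I e * max (t - end_dist I e (Lf e) i) 0" if "e \<in> edges I" "e \<in> unconn s" for e
      using C(3)[OF that(2)] that by (simp add: b_def)
    have b2: "b e = people I e * max (\<gamma> * alpha s e - end_dist I e (Lf e) i) 0"
      if "e \<in> edges I" "e \<notin> unconn s" "psi s e (Lf e) = None" for e
      using C(4)[OF that(1,2)] that False by (simp add: b_def)
    have b3: "b e = 0" if "e \<in> edges I" "e \<notin> unconn s" "psi s e (Lf e) \<noteq> None" for e
      using dead[OF that(1,3)] that by (auto simp: b_def)
    have B: "bids \<gamma> I (wait r s) \<sigma> Lf i t = (\<Sum>e\<in>edges I. b e)" unfolding bids_def b_def ..
    show ?thesis
    proof (cases "i \<in> sol s")
      case True
      have "b e = 0" if e: "e \<in> edges I" for e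
      proof (cases "e \<in> unconn s")
        case u: True
        have "alpha s1 e \<le> edge_dist I e i" using inv1 u True unfolding greedy_inv_def s1_def by auto
        then have "t \<le> end_dist I e (Lf e) i" using edge_dist_le[of I e i "Lf e"] C(2)[OF u] u
          by (simp add: s1_def r'_def)
        then show ?thesis using b1[OF e u] by simp
      next
        case u: False
        then show ?thesis using b2[OF e u] b3[OF e u] C(7)[OF e u _ True]
          by (cases "psi s e (Lf e) = None") auto
      qed
      then show ?thesis unfolding B using i eta I by (simp add: lflp_instance_def)
    next
      case False
      have "b e \<le> single \<gamma> I s1 i e" if e: "e \<in> edges I" for e
      proof (cases "e \<in> unconn s")
        case u: True
        have "alpha s1 e = t" using C(2)[OF u] u by (simp add: s1_def r'_def)
        then have "single \<gamma> I s1 i e = people I e * max (t - edge_dist I e i) 0" using u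
          by (simp add: single_def s1_def)
        moreover have "max (t - end_dist I e (Lf e) i) 0 \<le> max (t - edge_dist I e i) 0"
          using edge_dist_le[of I e i "Lf e"] by auto
        ultimately show ?thesis using b1[OF e u] people_nonneg[OF I e] by (simp add: mult_left_mono)
      next
        case u: False
        show ?thesis
        proof (cases "psi s e (Lf e) = None")
          case True
          then show ?thesis using b2[OF e u True] unset_le_single[OF I e, of s1 "Lf e" \<gamma> i] u
            by (simp add: s1_def)
        next
          case p: False
          have "0 \<le> single \<gamma> I s1 i e" using u people_nonneg[OF I e]
            by (auto simp: single_def s1_def intro!: sum_nonneg)
          then show ?thesis using b3[OF e u p] by simp
        qed
      qed
      then have "(\<Sum>e\<in>edges I. b e) \<le> (\<Sum>e\<in>edges I. single \<gamma> I s1 i e)" by (rule sum_mono)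
      also have "\<dots> = offer \<gamma> I s1 i" using inv1 by (simp add: offer_single greedy_inv_def)
      also have "\<dots> \<le> \<eta> * open_cost I i" using inv1 False i by (auto simp: greedy_inv_def s1_def)
      finally show ?thesis unfolding B .
    qed
  qed
qed

text \<open>Bounds the contributions of \<open>e\<close> to the opening costs. If the second end is assigned after \<open>e\<close>
  was connected, \<open>e\<close> pays \<open>\<alpha> - d\<close> once and \<open>\<gamma> \<alpha> - d'\<close> later.\<close>

definition paid :: "real \<Rightarrow> lflp \<Rightarrow> state \<Rightarrow> edge \<Rightarrow> real" where
  "paid \<gamma> I s e = (case (psi s e Home, psi s e Work) of
     (Some i, Some j) \<Rightarrow> max (alpha s e - min (end_dist I e Home i) (end_dist I e Work j))
        ((1 + \<gamma>) * alpha s e - end_dist I e Home i - end_dist I e Work j)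
   | (Some i, None) \<Rightarrow> alpha s e - end_dist I e Home i
   | (None, Some j) \<Rightarrow> alpha s e - end_dist I e Work j
   | (None, None) \<Rightarrow> 0)"

lemma sum_side: "(\<Sum>L | P L. f L) = (if P Home then f Home else 0) + (if P Work then f Work else (0::real))"
proof -
  have "{L. P L} = (if P Home then {Home} else {}) \<union> (if P Work then {Work} else {})"
    by (auto split: if_splits) (metis side.exhaust)+
  then show ?thesis by auto
qed

text \<open>\<open>paid\<close> serves as a potential: connecting does not decrease it, and an
  opening raises it for every edge by at least the share of that edge in the offer, which sums to
  \<open>\<eta> * open_cost I i\<close>.\<close>

lemma run_paid:
  assumes I: "lflp_instance I" and g: "\<gamma> \<in> {0..1}" and eta: "0 \<le> \<eta>" and "run \<gamma> \<eta> I s T \<sigma>"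
  shows "\<eta> * (\<Sum>i\<in>sol s. open_cost I i) \<le> (\<Sum>e\<in>edges I. people I e * paid \<gamma> I s e)"
  using assms(4)
proof induction
  case run_init then show ?case by (simp add: init_state_def paid_def)
next
  case (run_event s T \<sigma> s')
  note inv = run_greedy_inv[OF I g eta run_event(1)]
  note C = clock_invD[OF run_clock_inv[OF I g eta run_event(1)]]
  have UE: "unconn s \<subseteq> edges I" using inv by (simp add: greedy_inv_def)
  from run_event(2) show ?case
  proof cases
    case (event_connect e0 i0)
    have al: "alpha s' = alpha s" and so: "sol s' = sol s" using event_connect by (auto simp: connect_def)
    have "paid \<gamma> I s e \<le> paid \<gamma> I s' e" for e
    proof (cases "e = e0")
      case False
      then have "psi s' e = psi s e" using event_connect by (simp add: connect_def)
      then show ?thesis unfolding paid_def al by simp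
    next
      case True
      have p: "psi s' e L = (if alpha s e = end_dist I e L i0 then Some i0 else None)" for L
        using event_connect True C(3)[of e L] by (simp add: connect_def)
      have "paid \<gamma> I s e = 0" using True event_connect C(3)[of e] by (simp add: paid_def)
      moreover have "0 \<le> paid \<gamma> I s' e" by (auto simp: paid_def p al)
      ultimately show ?thesis by simp
    qed
    then have "(\<Sum>e\<in>edges I. people I e * paid \<gamma> I s e) \<le> (\<Sum>e\<in>edges I. people I e * paid \<gamma> I s' e)"
      using people_nonneg[OF I] by (intro sum_mono mult_left_mono) auto
    then show ?thesis using run_event.IH by (simp add: so)
  next
    case (event_open i0)
    have al: "alpha s' = alpha s" and so: "sol s' = insert i0 (sol s)" using event_open
      by (auto simp: open_facility_def)
    have p: "psi s' e L = (if e \<in> edges I - unconn s \<and> psi s e L = None \<and> end_dist I e L i0 \<le> \<gamma> * alpha s e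
          \<or> e \<in> unconn s \<and> edge_dist I e i0 \<le> alpha s e \<and> end_dist I e L i0 \<le> alpha s e
       then Some i0 else psi s e L)" for e L
      using event_open by (simp add: open_facility_def)
    have "people I e * paid \<gamma> I s e + single \<gamma> I s i0 e \<le> people I e * paid \<gamma> I s' e" if e: "e \<in> edges I"
      for e
    proof -
      note pe = people_nonneg[OF I e]
      show ?thesis
      proof (cases "e \<in> unconn s")
        case True
        have n: "psi s e L = None" for L using C(3)[OF True] .
        have "max (alpha s e - edge_dist I e i0) 0 \<le> paid \<gamma> I s' e"
          unfolding paid_def p n al using True by (auto simp: edge_dist_def)
        moreover have "paid \<gamma> I s e = 0" by (simp add: paid_def n)
        ultimately show ?thesis using True pe by (simp add: single_def mult_left_mono)
      next
        case False
        have c: "psi s' e L = (if psi s e L = None \<and> end_dist I e L i0 \<le>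
          \<gamma> * alpha s e then Some i0 else psi s e L)" for L
          using False e by (simp add: p)
        obtain L where L: "psi s e L \<noteq> None" using C(5)[OF e False] by blast
        have "paid \<gamma> I s e + ((if psi s e Home =
          None then max (\<gamma> * alpha s e - end_dist I e Home i0) 0 else 0) +
           (if psi s e Work = None then max (\<gamma> * alpha s e - end_dist I e Work i0) 0 else 0)) \<le> paid \<gamma> I s' e"
          using L by (cases L; cases "psi s e Home"; cases "psi s e Work"; auto simp: paid_def c al max_def min_def algebra_simps)
        then have "people I e * (paid \<gamma> I s e + ((if psi s e Home =
          None then max (\<gamma> * alpha s e - end_dist I e Home i0) 0 else 0) +
           (if psi s e Work = None then max (\<gamma> * alpha s e - end_dist I e Work i0) 0 else 0))) \<le> people I e * paid \<gamma> I s' e"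
          using pe by (rule mult_left_mono)
        moreover have "single \<gamma> I s i0 e = people I e * ((if psi s e Home =
          None then max (\<gamma> * alpha s e - end_dist I e Home i0) 0 else 0) +
           (if psi s e Work = None then max (\<gamma> * alpha s e - end_dist I e Work i0) 0 else 0))"
          using False by (simp add: single_def sum_side distrib_left)
        ultimately show ?thesis by (simp add: distrib_left)
      qed
    qed
    then have "(\<Sum>e\<in>edges I. people I e * paid \<gamma> I s e + single \<gamma> I s i0 e) \<le>
      (\<Sum>e\<in>edges I. people I e * paid \<gamma> I s' e)"
      by (rule sum_mono)
    moreover have "(\<Sum>e\<in>edges I. single \<gamma> I s i0 e) = \<eta> * open_cost I i0"
      using offer_single[OF UE, of \<gamma> i0] event_open by simp
    moreover have "finite (sol s)" using inv finite_subset[of "sol s" "locs I"]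
      by (auto simp: greedy_inv_def locs_def)
    then have "\<eta> * (\<Sum>i\<in>sol s'. open_cost I i) = \<eta> * open_cost I i0 + \<eta> * (\<Sum>i\<in>sol s. open_cost I i)"
      unfolding so using event_open(3) by (simp add: distrib_left)
    ultimately show ?thesis using run_event.IH by (simp add: sum.distrib)
  qed
next
  case (run_wait s T \<sigma> r)
  note C = clock_invD[OF run_clock_inv[OF I g eta run_wait(1)]]
  have "paid \<gamma> I (wait r s) e = paid \<gamma> I s e" for e
  proof (cases "e \<in> unconn s")
    case True then show ?thesis using C(3)[OF True] by (simp add: paid_def)
  qed (simp add: paid_def split: option.split)
  then show ?case using run_wait by simp
qed

section \<open>The total payment of an edge\<close>

lemma pay_once:
  assumes "1 \<le> \<eta>" "d \<le> (\<alpha>::real)" shows "(\<alpha> - d) / \<eta> + d \<le> \<alpha>"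
proof -
  have "(\<alpha> - d) / \<eta> \<le> \<alpha> - d" using assms mult_left_mono[of 1 \<eta> "\<alpha> - d"] by (simp add: divide_le_eq)
  then show ?thesis by simp
qed

text \<open>After multiplication by \<open>\<eta>\<close> this is
  \<open>\<eta> * c \<le> (\<eta> - \<gamma>) * d1 + d2\<close>, where
  \<open>\<gamma> \<le> 1 \<le> \<eta>\<close> makes both coefficients suitable. The roles of
  \<open>d1\<close> and \<open>d2\<close> may be exchanged, so \<open>d1\<close> can be taken at
  either end.\<close>

lemma pay_twice:
  fixes \<eta> :: real
  assumes eta: "1 \<le> \<eta>" "\<eta> \<le> 1 + \<gamma>" and g: "0 \<le> \<gamma>" "\<gamma> \<le> 1" and d: "0 \<le> d1" "0 \<le> d2" and c: "c \<le> d1" "c \<le> d2"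
  shows "((1 + \<gamma>) * \<alpha> - d1 - d2) / \<eta> + c \<le> (1 + \<gamma>) / \<eta> * \<alpha> - ((1 + \<gamma>) / \<eta> - 1) * d1"
proof -
  have "(\<eta> - \<gamma>) * c + \<gamma> * c \<le> (\<eta> - \<gamma>) * d1 + \<gamma> * d2"
    using mult_left_mono[of c d1 "\<eta> - \<gamma>"] mult_left_mono[of c d2 \<gamma>] c eta g by linarith
  moreover have "\<gamma> * d2 \<le> 1 * d2" using g d by (intro mult_right_mono) auto
  ultimately have *: "((1 + \<gamma>) * \<alpha> - d1 - d2) + \<eta> * c \<le> (1 + \<gamma>) * \<alpha> - (1 + \<gamma> - \<eta>) * d1"
    by (simp add: algebra_simps)
  have "((1 + \<gamma>) * \<alpha> - d1 - d2) / \<eta> + c = (((1 + \<gamma>) * \<alpha> - d1 - d2) + \<eta> * c) / \<eta>"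
    using eta by (simp add: field_simps)
  also have "\<dots> \<le> ((1 + \<gamma>) * \<alpha> - (1 + \<gamma> - \<eta>) * d1) / \<eta>" using * eta by (intro divide_right_mono) auto
  also have "\<dots> = (1 + \<gamma>) / \<eta> * \<alpha> - ((1 + \<gamma>) / \<eta> - 1) * d1" using eta by (simp add: field_simps)
  finally show ?thesis .
qed

section \<open>The approximation ratio\<close>

definition settled :: "lflp \<Rightarrow> state \<Rightarrow> edge \<Rightarrow> side \<Rightarrow> real" where
  "settled I s e L = (case psi s e L of Some i \<Rightarrow> end_dist I e L i | None \<Rightarrow> alpha s e)"

locale completed_run =
  fixes \<gamma> \<eta> :: real and I :: lflp and s :: state and T :: real and \<sigma> :: "edge \<Rightarrow> side \<Rightarrow> real" and \<kappa> :: real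
  assumes I: "lflp_instance I" and gamma: "\<gamma> \<in> {0..1}" and eta: "\<eta> \<in> {1..1 + \<gamma>}"
    and run: "run \<gamma> \<eta> I s T \<sigma>" and all_connected: "unconn s = {}"
    and kappa: "\<kappa> = (1 + \<gamma>) / \<eta>"
begin

lemma eta0: "0 \<le> \<eta>" using eta by simp
lemma kappa1: "1 \<le> \<kappa>" using eta by (simp add: kappa)

lemmas inv = run_greedy_inv[OF I gamma eta0 run]
lemmas clock = clock_invD[OF run_clock_inv[OF I gamma eta0 run]]

lemma alpha0: "0 \<le> alpha s e"
  using inv by (cases e) (auto simp: greedy_inv_def)

lemma sol_locs: "sol s \<subseteq> locs I" "finite (sol s)"
  using inv finite_subset[of "sol s" "locs I"] by (auto simp: greedy_inv_def locs_def)

lemma settled_bounds: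
  assumes "e \<in> edges I" shows "0 \<le> settled I s e L" "settled I s e L \<le> alpha s e"
  using end_dist_nonneg[OF I] alpha0 clock(6)[OF assms, of L]
  by (auto simp: settled_def split: option.split)

text \<open>The bound holds at both ends, which leaves \<open>L\<close> free to be the end nearest
  to the optimal facility. An edge that pays only once costs at most \<open>\<alpha>\<close>, and
  this is below the right side because \<open>settled\<close> is at most
  \<open>\<alpha>\<close>.\<close>

lemma edge_cost:
  assumes e: "e \<in> edges I"
  shows "paid \<gamma> I s e / \<eta> + (MIN i\<in>sol s. edge_dist I e i) \<le> \<kappa> * alpha s e - (\<kappa> - 1) * settled I s e L"
proof -
  define c where "c = (MIN i\<in>sol s. edge_dist I e i)"
  have c: "c \<le> end_dist I e L' i" "end_dist I e L' i \<le> alpha s e" if "psi s e L' = Some i" for L' i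
  proof -
    have "i \<in> sol s" using clock(6)[OF e that] by blast
    then have "c \<le> edge_dist I e i" unfolding c_def using sol_locs by (intro Min_le) auto
    then show "c \<le> end_dist I e L' i" using edge_dist_le order_trans by blast
    show "end_dist I e L' i \<le> alpha s e" using clock(6)[OF e that] by blast
  qed
  have "(\<kappa> - 1) * settled I s e L \<le> (\<kappa> - 1) * alpha s e"
    using settled_bounds[OF e] kappa1 by (intro mult_left_mono) auto
  then have R: "alpha s e \<le> \<kappa> * alpha s e - (\<kappa> - 1) * settled I s e L" by (simp add: algebra_simps)
  have once: "(alpha s e - d) / \<eta> + c \<le> \<kappa> * alpha s e - (\<kappa> - 1) * settled I s e L" if "c \<le> d"
    "d \<le> alpha s e" for d
    using pay_once[of \<eta> d "alpha s e"] R that eta by simp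
  have "\<exists>L. psi s e L \<noteq> None" using clock(5)[OF e] all_connected by simp
  then have some: "psi s e Home \<noteq> None \<or> psi s e Work \<noteq> None" by (metis side.exhaust)
  show ?thesis
  proof (cases "psi s e Home")
    case None
    then obtain j where "psi s e Work = Some j" using some by auto
    then show ?thesis using None once c by (simp add: paid_def c_def[symmetric])
  next
    case (Some i)
    show ?thesis
    proof (cases "psi s e Work")
      case None
      then show ?thesis using Some once c by (simp add: paid_def c_def[symmetric])
    next
      case S: (Some j)
      let ?d1 = "end_dist I e Home i" and ?d2 = "end_dist I e Work j"
      have d: "settled I s e Home = ?d1" "settled I s e Work = ?d2" using Some S by (auto simp: settled_def)
      have nn: "0 \<le> ?d1" "0 \<le> ?d2" using end_dist_nonneg[OF I] by auto
      have "((1 + \<gamma>) * alpha s e - ?d1 - ?d2) / \<eta> + c \<le> \<kappa> * alpha s e - (\<kappa> - 1) * settled I s e L"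
      proof (cases L)
        case Home
        then show ?thesis using pay_twice[of \<eta> \<gamma> ?d1 ?d2 c "alpha s e"] eta gamma nn c(1)[OF Some] c(1)[OF S]
          by (simp add: d kappa)
      next
        case Work
        then show ?thesis using pay_twice[of \<eta> \<gamma> ?d2 ?d1 c "alpha s e"] eta gamma nn c(1)[OF Some] c(1)[OF S]
          by (simp add: d kappa diff_diff_eq add.commute)
      qed
      moreover have "(alpha s e - min ?d1 ?d2) / \<eta> + c \<le> \<kappa> * alpha s e - (\<kappa> - 1) * settled I s e L"
        using c[OF Some] c[OF S] by (intro once) auto
      ultimately show ?thesis using Some S by (auto simp: paid_def c_def[symmetric] max_def)
    qed
  qed
qed

lemma cost_le: "cost I (sol s) \<le> (\<Sum>e\<in>edges I. people I e * (\<kappa> * alpha s e - (\<kappa> - 1) * settled I s e (Lf e)))"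
proof -
  have "(\<Sum>i\<in>sol s. open_cost I i) \<le> (\<Sum>e\<in>edges I. people I e * paid \<gamma> I s e) / \<eta>"
    using run_paid[OF I gamma eta0 run] eta by (simp add: field_simps)
  also have "\<dots> = (\<Sum>e\<in>edges I. people I e * (paid \<gamma> I s e / \<eta>))" by (simp add: sum_divide_distrib)
  finally have "cost I (sol s) \<le> (\<Sum>e\<in>edges I. people I e * (paid \<gamma> I s e / \<eta>)) +
    (\<Sum>e\<in>edges I. people I e * (MIN i\<in>sol s. edge_dist I e i))"
    by (simp add: cost_def)
  also have "\<dots> = (\<Sum>e\<in>edges I. people I e * (paid \<gamma> I s e / \<eta> + (MIN i\<in>sol s. edge_dist I e i)))"
    by (simp add: sum.distrib distrib_left)
  also have "\<dots> \<le> (\<Sum>e\<in>edges I. people I e * (\<kappa> * alpha s e - (\<kappa> - 1) * settled I s e (Lf e)))"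
    using edge_cost people_nonneg[OF I] by (intro sum_mono mult_left_mono) auto
  finally show ?thesis .
qed

definition edge_item :: "(edge \<Rightarrow> side) \<Rightarrow> nat \<Rightarrow> edge \<Rightarrow> item" where
  "edge_item Lf i e = \<lparr>wt = people I e, al = alpha s e, de = edge_dist I e i, be = settled I s e (Lf e),
     si = \<sigma> e (Lf e), fin = (psi s e (Lf e) = None)\<rparr>"

text \<open>The gain condition follows from the path from \<open>e'\<close> through \<open>i\<close>
  and the earlier edge \<open>e\<close> to the facility of \<open>e\<close>. For the load,
  \<open>run_bids\<close> covers the times up to \<open>T\<close>; later, the final offer does if
  \<open>i\<close> is closed, and the distance of unassigned ends from open facilities if it is
  open.\<close>

lemma cluster_admissible:
  assumes i: "i \<in> locs I" and D: "set D \<subseteq> edges I" "distinct D"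
    and Lf: "\<And>e. e \<in> set D \<Longrightarrow> end_dist I e (Lf e) i = edge_dist I e i"
    and near: "\<And>e. e \<in> set D \<Longrightarrow> edge_dist I e i \<le> alpha s e"
  shows "admissible \<gamma> (\<eta> * open_cost I i) (map (edge_item Lf i) D)"
  unfolding admissible_def
proof (intro conjI ballI allI impI)
  fix x assume "x \<in> set (map (edge_item Lf i) D)"
  then obtain e where e: "e \<in> set D" "x = edge_item Lf i e" by auto
  then have eE: "e \<in> edges I" using D by blast
  have "psi s e (Lf e) = None \<or> alpha s e \<le> \<sigma> e (Lf e)" using clock(6)[OF eE] by (cases "psi s e (Lf e)") auto
  then show "item_ok x"
    using e near[OF e(1)] people_nonneg[OF I eE] edge_dist_nonneg[OF I] settled_bounds[OF eE]
    by (auto simp: item_ok_def edge_item_def)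
next
  fix x x' assume "x \<in> set (map (edge_item Lf i) D)" "x' \<in> set (map (edge_item Lf i) D)" and E: "earlier x x'"
  then obtain e e' where e: "e \<in> set D" "x = edge_item Lf i e" "e' \<in> set D" "x' = edge_item Lf i e'" by auto
  then have eE: "e \<in> edges I" "e' \<in> edges I" using D by auto
  obtain j where j: "psi s e (Lf e) = Some j" using E e by (auto simp: earlier_def edge_item_def)
  have js: "j \<in> sol s" using clock(6)[OF eE(1) j] by blast
  have "\<gamma> * alpha s e' \<le> end_dist I e' (Lf e') j"
  proof (cases "psi s e' (Lf e') = None")
    case True then show ?thesis using clock(7)[OF eE(2) _ True js] all_connected by simp
  next
    case False
    then have "\<sigma> e (Lf e) < \<sigma> e' (Lf e')" using E e by (auto simp: earlier_def edge_item_def)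
    then show ?thesis using clock(8)[OF eE j False] by blast
  qed
  also have "end_dist I e' (Lf e') j \<le> end_dist I e' (Lf e') i + (end_dist I e (Lf e) i +
    end_dist I e (Lf e) j)"
  proof -
    interpret M: Metric_space "locs I" "metric I" using I by (simp add: lflp_instance_def)
    have loc: "endpoint e'' L \<in> locs I" if "e'' \<in> edges I" for e'' L
      using that by (cases L) (auto simp: edges_def)
    note l = loc[OF eE(1), of "Lf e"] loc[OF eE(2), of "Lf e'"] subsetD[OF sol_locs(1) js]
    have "metric I (endpoint e' (Lf e')) j \<le> metric I (endpoint e' (Lf e')) i + metric I i j"
      using l i by (intro M.triangle)
    moreover have "metric I i j \<le> metric I i (endpoint e (Lf e)) + metric I (endpoint e (Lf e)) j"
      using l i by (intro M.triangle)
    ultimately show ?thesis using M.commute by (simp add: end_dist_def)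
  qed
  finally show "gain \<gamma> x' \<le> reach x" using e j Lf by (simp add: gain_def reach_def edge_item_def settled_def)
next
  fix t
  have load: "load \<gamma> (map (edge_item Lf i) D) t = (\<Sum>e\<in>set D. share \<gamma> t (edge_item Lf i e))"
    using D(2) by (simp add: load_def o_def sum_list_distinct_conv_sum_set)
  have f0: "0 \<le> \<eta> * open_cost I i" using I i eta0 by (simp add: lflp_instance_def)
  have sh: "share \<gamma> t (edge_item Lf i e) =
     (if psi s e (Lf e) = None \<or> t \<le> \<sigma> e (Lf e) then people I e * max (\<gamma> * min t (alpha s e) - edge_dist I e i) 0 else 0)" for e
    by (simp add: share_def alive_def bid_def edge_item_def)
  have fin: "finite (edges I)" by simp
  consider "t < 0" | "0 \<le> t" "t \<le> T" | "T < t" by linarith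
  then show "load \<gamma> (map (edge_item Lf i) D) t \<le> \<eta> * open_cost I i"
  proof cases
    case 1
    have "share \<gamma> t (edge_item Lf i e) = 0" for e
    proof -
      have "\<gamma> * min t (alpha s e) \<le> 0" using 1 gamma by (intro mult_nonneg_nonpos) auto
      then show ?thesis unfolding sh using edge_dist_nonneg[OF I, of e i] alpha0[of e] 1
        by (simp add: min_def)
    qed
    then show ?thesis using f0 unfolding load by simp
  next
    case 2
    define b where "b e = (if psi s e (Lf e) = None \<or> t \<le> \<sigma> e (Lf e)
     then people I e * max ((if e \<in> unconn s \<or> t \<le> alpha s e then t else \<gamma> * alpha s e) - end_dist I e (Lf e) i) 0
     else 0)" for e
    have "share \<gamma> t (edge_item Lf i e) \<le> b e" if e: "e \<in> set D" for e
    proof -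
      have "\<gamma> * t \<le> t" using 2 gamma by (simp add: mult_left_le_one_le)
      then have "max (\<gamma> * min t (alpha s e) - edge_dist I e i) 0 \<le> max ((if e \<in> unconn s \<or> t \<le>
        alpha s e then t else \<gamma> * alpha s e) - end_dist I e (Lf e) i) 0"
        using all_connected Lf[OF e] by (auto simp: min_def)
      then show ?thesis unfolding sh b_def using people_nonneg[OF I subsetD[OF D(1) e]]
        by (auto intro!: mult_left_mono)
    qed
    then have "load \<gamma> (map (edge_item Lf i) D) t \<le> (\<Sum>e\<in>set D. b e)" unfolding load by (rule sum_mono)
    also have "\<dots> \<le> (\<Sum>e\<in>edges I. b e)"
      using D(1) people_nonneg[OF I] by (intro sum_mono2) (auto simp: b_def)
    also have "\<dots> = bids \<gamma> I s \<sigma> Lf i t" unfolding bids_def b_def ..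
    also have "\<dots> \<le> \<eta> * open_cost I i" by (rule run_bids[OF I gamma eta0 i run 2])
    finally show ?thesis .
  next
    case 3
    have shz: "share \<gamma> t (edge_item Lf i e) = (if psi s e (Lf e) =
      None then people I e * max (\<gamma> * alpha s e - end_dist I e (Lf e) i) 0 else 0)"
      if e: "e \<in> set D" for e
    proof -
      have eE: "e \<in> edges I" using e D by blast
      have "alpha s e \<le> t" using clock(4)[OF eE] all_connected 3 by simp
      moreover have "\<not> t \<le> \<sigma> e (Lf e)" if "psi s e (Lf e) \<noteq> None" using clock(6)[OF eE] that 3 by fastforce
      ultimately show ?thesis unfolding sh using Lf[OF e] by (auto simp: min_absorb2)
    qed
    show ?thesis
    proof (cases "i \<in> sol s")
      case True
      have "share \<gamma> t (edge_item Lf i e) = 0" if e: "e \<in> set D" for e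
        using shz[OF e] clock(7)[of e "Lf e" i] True all_connected e D by auto
      then show ?thesis using f0 unfolding load by simp
    next
      case False
      have "share \<gamma> t (edge_item Lf i e) \<le> single \<gamma> I s i e" if e: "e \<in> set D" for e
      proof -
        have eE: "e \<in> edges I" using e D by blast
        have "0 \<le> single \<gamma> I s i e" using people_nonneg[OF I eE] all_connected
          by (auto simp: single_def intro!: sum_nonneg)
        then show ?thesis using shz[OF e] unset_le_single[OF I eE, of s "Lf e" \<gamma> i] all_connected by auto
      qed
      then have "load \<gamma> (map (edge_item Lf i) D) t \<le> (\<Sum>e\<in>set D. single \<gamma> I s i e)" unfolding load
        by (rule sum_mono)
      also have "\<dots> \<le> (\<Sum>e\<in>edges I. single \<gamma> I s i e)"
        using D(1) people_nonneg[OF I] all_connected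
          by (intro sum_mono2) (auto simp: single_def intro!: sum_nonneg)
      also have "\<dots> = offer \<gamma> I s i" by (rule offer_single[symmetric]) (simp add: all_connected)
      also have "\<dots> \<le> \<eta> * open_cost I i" using inv i False by (auto simp: greedy_inv_def)
      finally show ?thesis .
    qed
  qed
qed

text \<open>Edges farther from \<open>i\<close> than their \<open>\<alpha>\<close> are not valid
  items, but their value is not positive because \<open>\<kappa> \<le> \<Gamma>\<close>.\<close>

lemma cluster_cost:
  assumes g: "0 < \<gamma>" and n1: "1 \<le> n"
    and obj: "\<And>f q \<alpha> \<delta> \<beta>. sfr_feasible n \<gamma> \<eta> f q \<alpha> \<delta> \<beta> \<Longrightarrow> sfr_objective n \<gamma> \<eta> q \<alpha> \<beta> \<le> \<Gamma>"
    and i: "i \<in> locs I" and E: "E \<subseteq> edges I"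
    and Lf: "\<And>e. e \<in> E \<Longrightarrow> end_dist I e (Lf e) i = edge_dist I e i"
  shows "(\<Sum>e\<in>E. people I e * (\<kappa> * alpha s e - (\<kappa> - 1) * settled I s e (Lf e)))
    \<le> \<Gamma> * (open_cost I i + (\<Sum>e\<in>E. people I e * edge_dist I e i))"
proof -
  have g1: "\<gamma> \<le> 1" and e1: "1 \<le> \<eta>" "\<eta> \<le> 1 + \<gamma>" using gamma eta by auto
  define v where "v e = people I e * (\<kappa> * alpha s e - (\<kappa> - 1) * settled I s e (Lf e) - \<Gamma> * edge_dist I e i)"
    for e
  define N where "N = {e \<in> E. edge_dist I e i \<le> alpha s e}"
  have fE: "finite E" using E finite_edges finite_subset by blast
  have "\<kappa> / \<gamma> + \<kappa> - 1 \<le> \<Gamma>" by (rule sfr_lower_bound[OF g g1 e1 kappa n1 obj])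
  moreover have "\<kappa> \<le> \<kappa> / \<gamma>" using g g1 kappa1 by (simp add: le_divide_eq mult_left_le)
  ultimately have kG: "\<kappa> \<le> \<Gamma>" using kappa1 by linarith
  obtain D where D: "set D = N" "distinct D" using finite_distinct_list[of N] fE by (auto simp: N_def)
  have "worth \<kappa> \<Gamma> (map (edge_item Lf i) D) \<le> \<Gamma> * (\<eta> * open_cost I i / \<eta>)"
    using i E D Lf by (intro admissible_worth[OF g g1 e1 kappa n1 obj] cluster_admissible) (auto simp: N_def)
  moreover have "worth \<kappa> \<Gamma> (map (edge_item Lf i) D) = (\<Sum>e\<in>N. v e)"
    using D by (simp add: worth_def o_def sum_list_distinct_conv_sum_set val_def edge_item_def v_def)
  moreover have "(\<Sum>e\<in>E. v e) = (\<Sum>e\<in>E - N. v e) + (\<Sum>e\<in>N. v e)"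
    by (rule sum.subset_diff) (auto simp: N_def fE)
  moreover have "(\<Sum>e\<in>E - N. v e) \<le> 0"
  proof (rule sum_nonpos)
    fix e assume e: "e \<in> E - N"
    then have eE: "e \<in> edges I" and a: "alpha s e \<le> edge_dist I e i" using E by (auto simp: N_def)
    have "\<kappa> * alpha s e \<le> \<Gamma> * edge_dist I e i" using kG kappa1 a alpha0 by (intro mult_mono) auto
    moreover have "0 \<le> (\<kappa> - 1) * settled I s e (Lf e)" using kappa1 settled_bounds[OF eE] by simp
    ultimately show "v e \<le> 0" unfolding v_def using people_nonneg[OF I eE] by (intro mult_nonneg_nonpos) auto
  qed
  moreover have "\<Gamma> * (\<eta> * open_cost I i / \<eta>) = \<Gamma> * open_cost I i" using e1 by simp
  ultimately have "(\<Sum>e\<in>E. v e) \<le> \<Gamma> * open_cost I i" by linarith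
  then show ?thesis by (simp add: v_def algebra_simps sum.distrib sum_subtractf sum_distrib_left)
qed

lemma cost_ratio:
  assumes g: "0 < \<gamma>" and n1: "1 \<le> n"
    and obj: "\<And>f q \<alpha> \<delta> \<beta>. sfr_feasible n \<gamma> \<eta> f q \<alpha> \<delta> \<beta> \<Longrightarrow> sfr_objective n \<gamma> \<eta> q \<alpha> \<beta> \<le> \<Gamma>"
    and S: "S \<subseteq> locs I" "S \<noteq> {}"
  shows "cost I (sol s) \<le> \<Gamma> * cost I S"
proof -
  have fS: "finite S" using S finite_subset by (auto simp: locs_def)
  have "\<exists>i\<in>S. edge_dist I e i = (MIN i\<in>S. edge_dist I e i)" for e
    using Min_in[of "edge_dist I e ` S"] fS S
      by (metis (mono_tags, lifting) finite_imageI image_iff image_is_empty)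
  then obtain near where near: "\<And>e. near e \<in> S" "\<And>e. edge_dist I e (near e) = (MIN i\<in>S. edge_dist I e i)"
    by metis
  have "\<exists>Lf. \<forall>e. end_dist I e (Lf e) (near e) = edge_dist I e (near e)"
    by (intro choice allI edge_dist_attained)
  then obtain Lf where Lf: "\<And>e. end_dist I e (Lf e) (near e) = edge_dist I e (near e)" by blast
  define E where "E i = {e \<in> edges I. near e = i}" for i
  define v where "v e = people I e * (\<kappa> * alpha s e - (\<kappa> - 1) * settled I s e (Lf e))" for e
  have "cost I (sol s) \<le> (\<Sum>e\<in>edges I. v e)" unfolding v_def by (rule cost_le)
  also have "\<dots> = (\<Sum>i\<in>S. \<Sum>e\<in>E i. v e)"
    unfolding E_def using near fS by (subst sum.group) auto
  also have "\<dots> \<le> (\<Sum>i\<in>S. \<Gamma> * (open_cost I i + (\<Sum>e\<in>E i. people I e * edge_dist I e i)))"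
    unfolding v_def using S Lf by (intro sum_mono cluster_cost[OF g n1 obj]) (auto simp: E_def)
  also have "\<dots> = \<Gamma> * ((\<Sum>i\<in>S. open_cost I i) + (\<Sum>i\<in>S. \<Sum>e\<in>E i. people I e * edge_dist I e (near e)))"
    by (simp add: sum_distrib_left[symmetric] sum.distrib E_def)
  also have "(\<Sum>i\<in>S. \<Sum>e\<in>E i. people I e * edge_dist I e (near e)) =
    (\<Sum>e\<in>edges I. people I e * edge_dist I e (near e))"
    unfolding E_def using near fS by (subst sum.group) auto
  finally show ?thesis by (simp add: cost_def near)
qed

text \<open>This covers an infinite ratio, where the bound is still 0. Every populated edge has a
  free facility at distance 0, and its own bid there forces \<open>alpha\<close> to be 0.\<close>

lemma cost_zero:
  assumes S: "S \<subseteq> locs I" "S \<noteq> {}" and z: "cost I S = 0"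
  shows "cost I (sol s) \<le> 0"
proof -
  have fS: "finite S" using S finite_subset by (auto simp: locs_def)
  have o0: "0 \<le> open_cost I i" if "i \<in> S" for i using I S that by (auto simp: lflp_instance_def)
  have m0: "0 \<le> (MIN i\<in>S. edge_dist I e i)" for e using fS S edge_dist_nonneg[OF I] by (subst Min_ge_iff) auto
  have A: "0 \<le> (\<Sum>i\<in>S. open_cost I i)" "0 \<le> (\<Sum>e\<in>edges I. people I e * (MIN i\<in>S. edge_dist I e i))"
    using o0 m0 people_nonneg[OF I] by (auto intro!: sum_nonneg)
  then have z': "(\<Sum>i\<in>S. open_cost I i) = 0" "(\<Sum>e\<in>edges I. people I e * (MIN i\<in>S. edge_dist I e i)) = 0"
    using z unfolding cost_def by linarith+
  have oz: "open_cost I i = 0" if "i \<in> S" for i using z'(1) o0 fS that by (simp add: sum_nonneg_eq_0_iff)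
  have "people I e * alpha s e = 0" if e: "e \<in> edges I" for e
  proof (cases "people I e = 0")
    case False
    then have pe: "0 < people I e" using people_nonneg[OF I e] by simp
    have "people I e * (MIN i\<in>S. edge_dist I e i) = 0"
      using z'(2) m0 people_nonneg[OF I] e by (subst (asm) sum_nonneg_eq_0_iff) auto
    then have "(MIN i\<in>S. edge_dist I e i) = 0" using pe by simp
    moreover have "(MIN i\<in>S. edge_dist I e i) \<in> edge_dist I e ` S" using fS S by (intro Min_in) auto
    ultimately obtain i where i: "i \<in> S" "edge_dist I e i = 0" by auto
    obtain L where L: "end_dist I e L i = 0" using edge_dist_attained[of I e i] i by auto
    have t: "0 \<le> alpha s e" "alpha s e \<le> T" using alpha0 clock(4)[OF e] all_connected by auto
    have "people I e * max (alpha s e - 0) 0 \<le> bids \<gamma> I s \<sigma> (\<lambda>_. L) i (alpha s e)"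
    proof -
      let ?b = "\<lambda>e'. if psi s e' L = None \<or> alpha s e \<le> \<sigma> e' L
        then people I e' * max ((if e' \<in> unconn s \<or> alpha s e \<le> alpha s e' then alpha s e else \<gamma> * alpha s e') - end_dist I e' L i) 0 else 0"
      have "psi s e L = None \<or> alpha s e \<le> \<sigma> e L" using clock(6)[OF e, of L] by (cases "psi s e L") auto
      then have "people I e * max (alpha s e - 0) 0 = ?b e" using L by simp
      also have "\<dots> \<le> (\<Sum>e'\<in>edges I. ?b e')" using e people_nonneg[OF I] by (intro member_le_sum) auto
      finally show ?thesis by (simp add: bids_def)
    qed
    also have "\<dots> \<le> \<eta> * open_cost I i" using S i by (intro run_bids[OF I gamma eta0 _ run t]) auto
    finally have "people I e * alpha s e \<le> 0" using oz[OF i(1)] t by simp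
    then show ?thesis using pe t by (simp add: mult_le_0_iff)
  qed simp
  then have "people I e * (\<kappa> * alpha s e - (\<kappa> - 1) * settled I s e L) \<le> 0" if "e \<in> edges I" for e L
  proof -
    have "0 \<le> people I e * ((\<kappa> - 1) * settled I s e L)"
      using that kappa1 settled_bounds[OF that] people_nonneg[OF I that] by (intro mult_nonneg_nonneg) auto
    moreover have "people I e * (\<kappa> * alpha s e) = \<kappa> * (people I e * alpha s e)" by simp
    ultimately show ?thesis using \<open>\<And>e. e \<in> edges I \<Longrightarrow> people I e * alpha s e = 0\<close>[OF that]
      by (auto simp: right_diff_distrib)
  qed
  then have "(\<Sum>e\<in>edges I. people I e * (\<kappa> * alpha s e - (\<kappa> - 1) * settled I s e Home)) \<le> 0"
    by (intro sum_nonpos) auto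
  then show ?thesis using cost_le[of "\<lambda>_. Home"] by linarith
qed

end

text \<open>For \<open>\<gamma> = 0\<close> only \<open>\<eta> = 1\<close> is possible, and (ii) and
  (iii) hold trivially, so \<open>\<alpha>\<close> can grow without bound at no cost. A real bound
  on the objective therefore implies \<open>\<gamma> > 0\<close>.\<close>

lemma sfr_unbounded:
  assumes n1: "1 \<le> n" and eta: "\<eta> = 1"
  shows "\<exists>f q \<alpha> \<delta> \<beta>. sfr_feasible n 0 \<eta> f q \<alpha> \<delta> \<beta> \<and> \<Gamma> < sfr_objective n 0 \<eta> q \<alpha> \<beta>"
proof -
  define c where "c = \<bar>\<Gamma>\<bar> + 1"
  define q where "q a b = (if a = b then 1 else 0 :: real)" for a b :: nat
  have "sfr_feasible n 0 \<eta> 0 q (\<lambda>_ _. c) (\<lambda>_ _. 0) (\<lambda>_ _. 0)"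
    by (auto simp: sfr_feasible_def q_def c_def eta)
  moreover have "sfr_objective n 0 \<eta> q (\<lambda>_ _. c) (\<lambda>_ _. 0) = (\<Sum>a=1..n. c)"
    unfolding sfr_objective_def
  proof (rule sum.cong[OF refl])
    fix a assume "a \<in> {1..n}"
    have "(\<Sum>b=1..a. q a b * ((1 + 0) / \<eta> * c - ((1 + 0) / \<eta> - 1) * 0)) = (\<Sum>b=1..a. if a = b then c else 0)"
      by (intro sum.cong) (auto simp: q_def eta)
    then show "(\<Sum>b=1..a. q a b * ((1 + 0) / \<eta> * c - ((1 + 0) / \<eta> - 1) * 0)) = c" using \<open>a \<in> {1..n}\<close> by simp
  qed
  moreover have "\<Gamma> < (\<Sum>a=1..n. c)"
  proof -
    have "c \<le> real n * c" using n1 mult_right_mono[of 1 "real n" c] by (simp add: c_def)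
    then show ?thesis by (simp add: c_def)
  qed
  ultimately show ?thesis by (intro exI conjI) auto
qed

theorem theorem4p1:
  fixes \<gamma> \<eta> :: real
  assumes "\<gamma> \<in> {0..1}" and "\<eta> \<in> {1..1 + \<gamma>}"
  shows "approx_ratio_at_most (two_chance_greedy \<gamma> \<eta>) (Gamma_SFR \<gamma> \<eta>)"
  unfolding approx_ratio_at_most_def
proof (intro allI impI)
  fix I S assume I: "lflp_instance I" and "two_chance_greedy \<gamma> \<eta> I S"
  then obtain s where "(greedy_step \<gamma> \<eta> I)\<^sup>*\<^sup>* (init_state I) s" and s: "unconn s = {}" "sol s = S"
    by (auto simp: two_chance_greedy_def)
  then obtain T \<sigma> where "run \<gamma> \<eta> I s T \<sigma>" using run_of_steps by blast
  then interpret completed_run \<gamma> \<eta> I s T \<sigma> "(1 + \<gamma>) / \<eta>"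
    using I assms s by unfold_locales auto
  define Y where "Y = {S. S \<subseteq> locs I \<and> S \<noteq> {}}"
  have "finite Y" unfolding Y_def by (rule finite_subset[of _ "Pow (locs I)"]) (auto simp: locs_def)
  moreover have "locs I \<in> Y" using I by (auto simp: Y_def lflp_instance_def locs_def)
  ultimately have "opt_cost I \<in> cost I ` Y" unfolding opt_cost_def Y_def[symmetric] by (intro Min_in) auto
  then obtain O' where O': "O' \<subseteq> locs I" "O' \<noteq> {}" "opt_cost I = cost I O'" by (auto simp: Y_def)
  have "finite O'" using O' finite_subset by (auto simp: locs_def)
  then have "0 \<le> (MIN i\<in>O'. edge_dist I e i)" for e using O' edge_dist_nonneg[OF I] by (subst Min_ge_iff) auto
  then have opt0: "0 \<le> opt_cost I"
    using people_nonneg[OF I] I O' unfolding O'(3) cost_def lflp_instance_def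
      by (intro add_nonneg_nonneg sum_nonneg mult_nonneg_nonneg) auto
  show "ereal (cost I S) \<le> Gamma_SFR \<gamma> \<eta> * ereal (opt_cost I)"
  proof (cases "opt_cost I = 0")
    case True
    then have "cost I S \<le> 0" using cost_zero[OF O'(1,2)] O'(3) s by simp
    then show ?thesis using True by (simp add: zero_ereal_def[symmetric])
  next
    case False
    then have opt: "0 < opt_cost I" using opt0 by simp
    have "ereal (cost I S / opt_cost I) \<le> Obj_SFR n \<gamma> \<eta>" if n: "n \<in> {1..}" for n
    proof (rule ccontr)
      assume "\<not> ?thesis"
      \<comment> \<open>The value of the program may be infinite; a real number strictly between
        reduces the claim to real arithmetic.\<close>
      then obtain \<Gamma> where G: "Obj_SFR n \<gamma> \<eta> < ereal \<Gamma>" "ereal \<Gamma> < ereal (cost I S / opt_cost I)"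
        using ereal_dense2 by (metis not_le)
      have obj: "sfr_objective n \<gamma> \<eta> q \<alpha> \<beta> \<le> \<Gamma>" if "sfr_feasible n \<gamma> \<eta> f q \<alpha> \<delta> \<beta>" for f q \<alpha> \<delta> \<beta>
      proof -
        have "ereal (sfr_objective n \<gamma> \<eta> q \<alpha> \<beta>) \<le> Obj_SFR n \<gamma> \<eta>"
          unfolding Obj_SFR_def using that by (intro Sup_upper) blast
        then show ?thesis using G(1) by (metis ereal_less_eq(3) less_imp_le order_trans)
      qed
      have "\<gamma> \<noteq> 0"
      proof
        assume "\<gamma> = 0"
        then have "\<eta> = 1" using assms by simp
        then show False using sfr_unbounded[of n \<eta> \<Gamma>] obj n \<open>\<gamma> = 0\<close> by fastforce
      qed
      then have "cost I S \<le> \<Gamma> * opt_cost I"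
        using cost_ratio[OF _ _ obj O'(1,2)] assms n s O'(3) by simp
      then show False using G(2) opt by (simp add: less_divide_eq)
    qed
    then have "ereal (cost I S / opt_cost I) \<le> Gamma_SFR \<gamma> \<eta>"
      unfolding Gamma_SFR_def by (intro INF_greatest) auto
    then have "ereal (cost I S / opt_cost I) * ereal (opt_cost I) \<le> Gamma_SFR \<gamma> \<eta> * ereal (opt_cost I)"
      using opt by (intro ereal_mult_right_mono) auto
    then show ?thesis using opt by simp
  qed
qed

end
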